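(* Let $B$ be a noise Boolean algebra under $\mathbb{P}$ with a spectral resolution $((S,\Sigma,\mu);\Psi)$. Then: (i) $\mathrm{L}^2(\mathbb{P}|_{0_{\mathbb{P}}})^\circ$ is the one-dimensional space of constants; $0_{\mathbb{P}}\in B^\circ$. (ii) For $x,y\in \mathrm{Cl}(B)$ and $g\in \mathrm{L}^2(\mathbb{P}|_x)^\circ$ we have $\mathbb{P}_y(g)=\mathbb{P}_{x\land y}(g)$, and this equals $g$ if $x\subset y$ (equivalently $x\subset x\land y$), and $0$ otherwise. (iii) If $x\in \mathrm{Cl}(B)^\circ$, then $\mathrm{L}^2(\mathbb{P}|_x)^\circ=H(Q)$ for some (up to $\mu$-a.e. equality unique) atom $Q$ of $\mu$. (iv) Conversely, if $Q$ is an atom of $\mu$, then $x:=\bigwedge\{y\in \mathrm{Cl}(B):\sigma(H(Q))\subset y\}$ belongs to $\mathrm{Cl}(B)^\circ$ and $H(Q)=\mathrm{L}^2(\mathbb{P}|_x)^\circ$; if also $H(Q)=\mathrm{L}^2(\mathbb{P}|_y)^\circ$ for some $y\in \mathrm{Cl}(B)$, then $y=x$. (v) The closed linear subspaces $\mathrm{L}^2(\mathbb{P}|_x)^\circ$, $x\in \mathrm{Cl}(B)$, are (pairwise) orthogonal. (vi) $\mathrm{Cl}(B)^\circ$ is countable. (vii) If $x,y\in B^\circ$ with $x$ independent of $y$, then $\mathrm{L}^2(\mathbb{P}|_{x\lor y})^\circ$ is the closure of the linear span of $\{fg:(f,g)\in \mathrm{L}^2(\mathbb{P}|_x)^\circ\times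 \mathrm{L}^2(\mathbb{P}|_y)^\circ\}$. The same is true if, instead of assuming $x,y\in B^\circ$ and $x$ independent of $y$, one assumes that $x,y\in \mathrm{Cl}(B)^\circ$ and $x\subset u$, $y\subset v$ for some $u,v\in\overline{B}$ with $u$ independent of $v$. (viii) $B^\circ$ is an ideal of the Boolean algebra $B$ (possibly improper, i.e. equal to $B$; possibly trivial, i.e. consisting of one element). In particular, for $x\in B^\circ$, $B_x$ is countable. (ix) For $x\in \mathrm{Cl}(B)$, $\left(\bigoplus_{y\in \mathrm{Cl}(B)^\circ}\mathrm{L}^2(\mathbb{P}|_y)^\circ\right)\cap \mathrm{L}^2(\mathbb{P}|_x)=\bigoplus_{y\in \mathrm{Cl}(B)^\circ,\,y\subset x}\mathrm{L}^2(\mathbb{P}|_y)^\circ$. In particular, if $\bigoplus_{y\in \mathrm{Cl}(B)^\circ,\,y\subset a}\mathrm{L}^2(\mathbb{P}|_y)^\circ=\mathrm{L}^2(\mathbb{P}|_a)$ for some $a\in\hat{\mathbb{P}}$, then $\bigoplus_{y\in \mathrm{Cl}(B)^\circ,\,y\subset x}\mathrm{L}^2(\mathbb{P}|_y)^\circ=\mathrm{L}^2(\mathbb{P}|_x)$ for all $x\in \mathrm{Cl}(B)$ with $x\subset a$.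
   Context: All $\mathrm{L}^p$ and Hilbert spaces are real. $(\Omega,\mathcal{F},\mathbb{P})$ is an essentially separable probability space: some countable subset of $\mathcal{F}$ together with the $\mathbb{P}$-null sets generates $\mathcal{F}$. $\mathbb{P}[f]$ is the expectation, $\mathbb{P}[f|x]$ the conditional expectation given $x$. $\sigma(\cdots)$ denotes the $\sigma$-field generated by the indicated objects and by the null sets of the relevant measure. "Countable" means finite or countably infinite. $\hat{\mathbb{P}}$ is the lattice of all complete sub-$\sigma$-fields of $\mathcal{F}$ (those containing $0_{\mathbb{P}}:=\mathbb{P}^{-1}(\{0,1\})$), ordered by inclusion, with bottom $0_{\mathbb{P}}$, top $1_{\mathbb{P}}:=\mathcal{F}$, meet $\land=\cap$ and join $\lor$ = generated $\sigma$-field. For $x\in\hat{\mathbb{P}}$, $\mathbb{P}_x$ is the conditional expectation operator $f\mapsto\mathbb{P}[f|x]$ on $\mathrm{L}^2(\mathbb{P})$ (the orthogonal projection onto $\mathrm{L}^2(\mathbb{P}|_x)$). $\hat{\mathbb{P}}$ carries the topology of strong operator convergence: $x_n\to x$ iff $\mathbb{P}_{x_n}f\to\mathbb{P}_xf$ in $\mathrm{L}^2(\mathbb{P})$ for all $f\in\mathrm{L}^2(\mathbb{P})$ (it is metrizable). A noise Boolean algebra under $\mathbb{P}$ is a non-empty distributive sublattice $B$ of $\hat{\mathbb{P}}$ every element $x$ of which admits an independent complement in $B$, i.e. an $x'\in B$ independent of $x$ with $x\lor x'=1_{\mathbb{P}}$ ($x'$ is then unique, and $B$ is a Boolean algebra).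 $B_x:=\{y\in B:y\subset x\}$. $\mathrm{Cl}(B)$ is the closure of $B$ in $\hat{\mathbb{P}}$; $\overline{B}$ is the noise completion of $B$: the set of those $x\in\mathrm{Cl}(B)$ that have an independent complement belonging to $\mathrm{Cl}(B)$. For $x\in\mathrm{Cl}(B)$, $\mathrm{L}^2(\mathbb{P}|_x)^\circ$ is the orthogonal complement in $\mathrm{L}^2(\mathbb{P}|_x)$ of the closure of the linear span of $\bigcup\{\mathrm{L}^2(\mathbb{P}|_y):y\in\mathrm{Cl}(B),\,y\subsetneq x\}$. $\mathrm{Cl}(B)^\circ:=\{x\in\mathrm{Cl}(B):\mathrm{L}^2(\mathbb{P}|_x)^\circ\ne\{0\}\}$ and $B^\circ:=B\cap\mathrm{Cl}(B)^\circ$. Spectral resolution. Let $\mathcal{A}$ be the strong operator closure of the real linear span of $\{\mathbb{P}_x:x\in B\}$. A standard measure space is the completion of a $\sigma$-finite measure on a standard Borel space, possibly adjoined with an extra null set. A spectral resolution $((S,\Sigma,\mu);\Psi)$ of $B$ consists of a standard measure space $(S,\Sigma,\mu)$ and a unitary isomorphism $\Psi$ of $\mathrm{L}^2(\mathbb{P})$ onto the direct integral $\int_S^\oplus H_s\,\mu(\mathrm{d}s)$ of a $\mu$-measurable field of $\mu$-a.e. non-zero separable Hilbert spaces, carrying $\mathcal{A}$ onto the algebra of diagonalizable operators (multiplications by elements of $\mathrm{L}^\infty(\mu)$); it always exists. For $E\in\Sigma$, $H(E):=\Psi^{-1}\left(\int_E^\oplus H_s\,\mu(\mathrm{d}s)\right)$.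 An atom of $\mu$ is a set $Q\in\Sigma$ with $\mu(Q)>0$ such that for every $E\in\Sigma$ either $\mu(Q\cap E)=0$ or $\mu(Q\setminus E)=0$. *)

theory Defs
  imports "HOL-Probability.Probability"
begin

text \<open>
  Conventions.  A sub-\<open>\<sigma>\<close>-field of the probability space \<open>M\<close> is its family of measurable sets, so
  that inclusion and meet in the lattice of sub-\<open>\<sigma>\<close>-fields are \<open>\<subseteq>\<close> and \<open>\<inter>\<close>.  Elements of
  \<open>L\<^sup>2\<close>-spaces (and of direct integrals) are represented by functions, equality of elements being
  equality almost everywhere.  All subspaces below are saturated sets of representatives: a
  measurable function that equals almost everywhere a member is a member.  For the subspaces
  attached to a sub-\<open>\<sigma>\<close>-field this is so because the sub-\<open>\<sigma>\<close>-fields contain all null sets of \<open>M\<close>.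
\<close>

subsection \<open>Complete sub-\<open>\<sigma>\<close>-fields\<close>

definition essentially_separable :: "'a measure \<Rightarrow> bool" where
  "essentially_separable M \<longleftrightarrow>
     (\<exists>C. countable C \<and> C \<subseteq> sets M \<and> sets M = sigma_sets (space M) (C \<union> null_sets M))"

definition bot_field :: "'a measure \<Rightarrow> 'a set set" where
  "bot_field M = {A \<in> sets M. measure M A = 0 \<or> measure M A = 1}"

text \<open>Completeness is relative to \<open>sets M\<close>; \<open>M\<close> itself need not be a complete measure.\<close>
definition subfields :: "'a measure \<Rightarrow> 'a set set set" where
  "subfields M = {x. sigma_algebra (space M) x \<and> bot_field M \<subseteq> x \<and> x \<subseteq> sets M}"

definition field_join :: "'a measure \<Rightarrow> 'a set set \<Rightarrow> 'a set set \<Rightarrow> 'a set set" where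
  "field_join M x y = sigma_sets (space M) (x \<union> y)"

definition indep_complement :: "'a measure \<Rightarrow> 'a set set \<Rightarrow> 'a set set \<Rightarrow> bool" where
  "indep_complement M x x' \<longleftrightarrow> prob_space.indep_set M x x' \<and> field_join M x x' = sets M"

text \<open>The \<open>\<sigma>\<close>-field generated by a family of random variables and by the null sets.\<close>
definition sigma_gen :: "'a measure \<Rightarrow> ('a \<Rightarrow> real) set \<Rightarrow> 'a set set" where
  "sigma_gen M G = sigma_sets (space M)
     ({f -` A \<inter> space M | f A. f \<in> G \<and> A \<in> sets borel} \<union> null_sets M)"


subsection \<open>\<open>L\<^sup>2\<close>-spaces\<close>

definition l2_inner :: "'a measure \<Rightarrow> ('a \<Rightarrow> 'b::real_inner) \<Rightarrow> ('a \<Rightarrow> 'b) \<Rightarrow> real" where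
  "l2_inner M f g = (\<integral>\<omega>. f \<omega> \<bullet> g \<omega> \<partial>M)"

definition l2_norm :: "'a measure \<Rightarrow> ('a \<Rightarrow> 'b::real_inner) \<Rightarrow> real" where
  "l2_norm M f = sqrt (\<integral>\<omega>. (norm (f \<omega>))\<^sup>2 \<partial>M)"

definition L2 :: "'a measure \<Rightarrow> 'a set set \<Rightarrow> ('a \<Rightarrow> real) set" where
  "L2 M x = {f \<in> borel_measurable (sigma (space M) x). integrable M (\<lambda>\<omega>. (f \<omega>)\<^sup>2)}"

definition lin_span :: "('a \<Rightarrow> real) set \<Rightarrow> ('a \<Rightarrow> real) set" where
  "lin_span G = {\<lambda>\<omega>. \<Sum>g\<in>F. c g * g \<omega> | F c. finite F \<and> F \<subseteq> G}"

text \<open>The closure in \<open>L\<^sup>2\<close> of the linear span of \<open>G \<subseteq> L\<^sup>2\<close>.  For \<open>G\<close> a union of pairwise orthogonal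
  closed subspaces this is their Hilbert space direct sum.\<close>
definition closed_span :: "'a measure \<Rightarrow> ('a \<Rightarrow> real) set \<Rightarrow> ('a \<Rightarrow> real) set" where
  "closed_span M G =
     {f \<in> L2 M (sets M). \<forall>\<epsilon>>0. \<exists>g\<in>lin_span G. l2_norm M (\<lambda>\<omega>. f \<omega> - g \<omega>) < \<epsilon>}"

definition cexp :: "'a measure \<Rightarrow> 'a set set \<Rightarrow> ('a \<Rightarrow> real) \<Rightarrow> ('a \<Rightarrow> real)" where
  "cexp M x = real_cond_exp M (sigma (space M) x)"


subsection \<open>Noise Boolean algebras\<close>

text \<open>The topology of strong operator convergence: the coarsest topology on the complete
  sub-\<open>\<sigma>\<close>-fields making all maps \<open>x \<mapsto> cexp M x f\<close> into \<open>L\<^sup>2\<close>, for \<open>f\<close> in \<open>L\<^sup>2\<close>, continuous.\<close>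
definition subfield_topology :: "'a measure \<Rightarrow> 'a set set topology" where
  "subfield_topology M = topology_generated_by
     {{y \<in> subfields M. l2_norm M (\<lambda>\<omega>. cexp M y f \<omega> - cexp M x f \<omega>) < \<epsilon>} | x f \<epsilon>.
        x \<in> subfields M \<and> f \<in> L2 M (sets M) \<and> \<epsilon> > 0}"

definition noise_boolean_algebra :: "'a measure \<Rightarrow> 'a set set set \<Rightarrow> bool" where
  "noise_boolean_algebra M B \<longleftrightarrow>
     B \<noteq> {} \<and> B \<subseteq> subfields M \<and>
     (\<forall>x\<in>B. \<forall>y\<in>B. x \<inter> y \<in> B \<and> field_join M x y \<in> B) \<and>
     (\<forall>x\<in>B. \<forall>y\<in>B. \<forall>z\<in>B.
        x \<inter> field_join M y z = field_join M (x \<inter> y) (x \<inter> z)) \<and>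
     (\<forall>x\<in>B. \<exists>x'\<in>B. indep_complement M x x')"

definition Cl :: "'a measure \<Rightarrow> 'a set set set \<Rightarrow> 'a set set set" where
  "Cl M B = (subfield_topology M) closure_of B"

definition noise_completion :: "'a measure \<Rightarrow> 'a set set set \<Rightarrow> 'a set set set" where
  "noise_completion M B = {x \<in> Cl M B. \<exists>x'\<in>Cl M B. indep_complement M x x'}"

text \<open>\<open>L2c M B x\<close> is \<open>L\<^sup>2(P|\<^sub>x)\<^sup>\<circ>\<close>.\<close>
definition L2c :: "'a measure \<Rightarrow> 'a set set set \<Rightarrow> 'a set set \<Rightarrow> ('a \<Rightarrow> real) set" where
  "L2c M B x = {f \<in> L2 M x.
     \<forall>g \<in> closed_span M (\<Union>y\<in>{y \<in> Cl M B. y \<subset> x}. L2 M y). l2_inner M f g = 0}"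

definition Clc :: "'a measure \<Rightarrow> 'a set set set \<Rightarrow> 'a set set set" where
  "Clc M B = {x \<in> Cl M B. \<exists>f\<in>L2c M B x. \<not> (AE \<omega> in M. f \<omega> = 0)}"

definition Bc :: "'a measure \<Rightarrow> 'a set set set \<Rightarrow> 'a set set set" where
  "Bc M B = B \<inter> Clc M B"

definition ideal_of :: "'a measure \<Rightarrow> 'a set set set \<Rightarrow> 'a set set set \<Rightarrow> bool" where
  "ideal_of M B I \<longleftrightarrow>
     I \<noteq> {} \<and> I \<subseteq> B \<and>
     (\<forall>x\<in>I. \<forall>y\<in>B. y \<subseteq> x \<longrightarrow> y \<in> I) \<and> (\<forall>x\<in>I. \<forall>y\<in>I. field_join M x y \<in> I)"


subsection \<open>The algebra of a noise Boolean algebra\<close>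

definition bounded_ops :: "'a measure \<Rightarrow> (('a \<Rightarrow> real) \<Rightarrow> ('a \<Rightarrow> real)) set" where
  "bounded_ops M = {T.
     (\<forall>f\<in>L2 M (sets M). T f \<in> L2 M (sets M)) \<and>
     (\<forall>f\<in>L2 M (sets M). \<forall>g\<in>L2 M (sets M). \<forall>a b.
        AE \<omega> in M. T (\<lambda>\<omega>. a * f \<omega> + b * g \<omega>) \<omega> = a * T f \<omega> + b * T g \<omega>) \<and>
     (\<exists>K. \<forall>f\<in>L2 M (sets M). l2_norm M (T f) \<le> K * l2_norm M f)}"

text \<open>The strong operator closure of the linear span of the operators \<open>cexp M x\<close>, \<open>x \<in> B\<close>.\<close>
definition noise_operators :: "'a measure \<Rightarrow> 'a set set set \<Rightarrow> (('a \<Rightarrow> real) \<Rightarrow> ('a \<Rightarrow> real)) set" where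
  "noise_operators M B = {T \<in> bounded_ops M.
     \<forall>G \<epsilon>. finite G \<and> G \<subseteq> L2 M (sets M) \<and> \<epsilon> > 0 \<longrightarrow>
       (\<exists>F c. finite F \<and> F \<subseteq> B \<and>
          (\<forall>f\<in>G. l2_norm M (\<lambda>\<omega>. T f \<omega> - (\<Sum>x\<in>F. c x * cexp M x f \<omega>)) < \<epsilon>))}"


subsection \<open>Standard measure spaces and direct integrals\<close>

definition standard_borel :: "'s measure \<Rightarrow> bool" where
  "standard_borel \<nu> \<longleftrightarrow>
     (\<exists>T. completely_metrizable_space T \<and> second_countable T \<and> topspace T = space \<nu> \<and>
          sets \<nu> = sigma_sets (space \<nu>) {U. openin T U})"

text \<open>The completion of a \<open>\<sigma>\<close>-finite measure \<open>\<nu>\<close> on a standard Borel space, to which the null set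
  \<open>space \<mu> - space \<nu>\<close> (with all of its subsets, possibly empty) has been adjoined.\<close>
definition standard_measure_space :: "'s measure \<Rightarrow> bool" where
  "standard_measure_space \<mu> \<longleftrightarrow>
     (\<exists>\<nu>. standard_borel \<nu> \<and> sigma_finite_measure \<nu> \<and> space \<nu> \<subseteq> space \<mu> \<and>
        sets \<mu> = {E \<union> N | E N. E \<in> sets (completion \<nu>) \<and> N \<subseteq> space \<mu> - space \<nu>} \<and>
        (\<forall>E\<in>sets \<mu>. emeasure \<mu> E = emeasure (completion \<nu>) (E \<inter> space \<nu>)))"

text \<open>A measurable field of separable Hilbert spaces in the sense of Dixmier.  The fibres are
  realised as complete subspaces of one inner product space, which need not be separable and whose
  topology plays no role across fibres: measurability of sections is governed solely by the given
  space \<open>\<SS>\<close> of measurable sections.  The last clause (a sequence of measurable sections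
  that is total in every fibre) entails separability of the fibres.\<close>
definition measurable_field ::
    "'s measure \<Rightarrow> ('s \<Rightarrow> 'h::real_inner set) \<Rightarrow> ('s \<Rightarrow> 'h) set \<Rightarrow> bool" where
  "measurable_field \<mu> H \<SS> \<longleftrightarrow>
     (\<forall>s\<in>space \<mu>. subspace (H s) \<and> uniform_space_class.complete (H s)) \<and>
     (\<forall>\<xi>\<in>\<SS>. \<forall>s\<in>space \<mu>. \<xi> s \<in> H s) \<and>
     (\<forall>\<xi>\<in>\<SS>. \<forall>\<eta>\<in>\<SS>. \<forall>a b. (\<lambda>s. a *\<^sub>R \<xi> s + b *\<^sub>R \<eta> s) \<in> \<SS>) \<and>
     (\<forall>\<xi>\<in>\<SS>. (\<lambda>s. norm (\<xi> s)) \<in> borel_measurable \<mu>) \<and>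
     (\<forall>\<eta>. (\<forall>s\<in>space \<mu>. \<eta> s \<in> H s) \<and> (\<forall>\<xi>\<in>\<SS>. (\<lambda>s. \<xi> s \<bullet> \<eta> s) \<in> borel_measurable \<mu>)
        \<longrightarrow> \<eta> \<in> \<SS>) \<and>
     (\<exists>e::nat \<Rightarrow> 's \<Rightarrow> 'h. (\<forall>n. e n \<in> \<SS>) \<and>
        (\<forall>s\<in>space \<mu>. H s = closure (span (range (\<lambda>n. e n s)))))"

definition direct_integral :: "'s measure \<Rightarrow> ('s \<Rightarrow> 'h::real_inner) set \<Rightarrow> ('s \<Rightarrow> 'h) set" where
  "direct_integral \<mu> \<SS> = {\<xi> \<in> \<SS>. integrable \<mu> (\<lambda>s. (norm (\<xi> s))\<^sup>2)}"

definition unitary_iso ::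
    "'a measure \<Rightarrow> 's measure \<Rightarrow> ('s \<Rightarrow> 'h::real_inner) set \<Rightarrow> (('a \<Rightarrow> real) \<Rightarrow> ('s \<Rightarrow> 'h)) \<Rightarrow> bool"
  where
  "unitary_iso M \<mu> \<SS> \<Psi> \<longleftrightarrow>
     (\<forall>f\<in>L2 M (sets M). \<Psi> f \<in> direct_integral \<mu> \<SS>) \<and>
     (\<forall>f\<in>L2 M (sets M). \<forall>g\<in>L2 M (sets M). \<forall>a b.
        AE s in \<mu>. \<Psi> (\<lambda>\<omega>. a * f \<omega> + b * g \<omega>) s = a *\<^sub>R \<Psi> f s + b *\<^sub>R \<Psi> g s) \<and>
     (\<forall>f\<in>L2 M (sets M). \<forall>g\<in>L2 M (sets M). l2_inner \<mu> (\<Psi> f) (\<Psi> g) = l2_inner M f g) \<and>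
     (\<forall>\<xi>\<in>direct_integral \<mu> \<SS>. \<exists>f\<in>L2 M (sets M). AE s in \<mu>. \<Psi> f s = \<xi> s)"

definition Linfty :: "'s measure \<Rightarrow> ('s \<Rightarrow> real) set" where
  "Linfty \<mu> = {h \<in> borel_measurable \<mu>. \<exists>K. AE s in \<mu>. \<bar>h s\<bar> \<le> K}"

text \<open>The last clause says that \<open>T \<mapsto> \<Psi> T \<Psi>\<^sup>-\<^sup>1\<close> maps \<open>noise_operators M B\<close> onto the algebra of
  diagonalizable operators: an operator \<open>T\<close> belongs to the former if and only if \<open>\<Psi> T \<Psi>\<^sup>-\<^sup>1\<close> is the
  multiplication by some \<open>h \<in> L\<^sup>\<infinity>(\<mu>)\<close>.\<close>
definition spectral_resolution ::
    "'a measure \<Rightarrow> 'a set set set \<Rightarrow> 's measure \<Rightarrow> ('s \<Rightarrow> 'h::real_inner set) \<Rightarrow> ('s \<Rightarrow> 'h) set \<Rightarrow>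
     (('a \<Rightarrow> real) \<Rightarrow> ('s \<Rightarrow> 'h)) \<Rightarrow> bool" where
  "spectral_resolution M B \<mu> H \<SS> \<Psi> \<longleftrightarrow>
     standard_measure_space \<mu> \<and> measurable_field \<mu> H \<SS> \<and> (AE s in \<mu>. H s \<noteq> {0}) \<and>
     unitary_iso M \<mu> \<SS> \<Psi> \<and>
     (\<forall>T\<in>bounded_ops M. T \<in> noise_operators M B \<longleftrightarrow>
        (\<exists>h\<in>Linfty \<mu>. \<forall>f\<in>L2 M (sets M). AE s in \<mu>. \<Psi> (T f) s = h s *\<^sub>R \<Psi> f s))"

text \<open>\<open>spectral_subspace M \<mu> \<Psi> E\<close> is \<open>H(E)\<close>, the preimage under \<open>\<Psi>\<close> of the direct integral over \<open>E\<close>.\<close>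
definition spectral_subspace ::
    "'a measure \<Rightarrow> 's measure \<Rightarrow> (('a \<Rightarrow> real) \<Rightarrow> ('s \<Rightarrow> 'h::real_inner)) \<Rightarrow> 's set \<Rightarrow> ('a \<Rightarrow> real) set"
  where
  "spectral_subspace M \<mu> \<Psi> E = {f \<in> L2 M (sets M). AE s in \<mu>. s \<notin> E \<longrightarrow> \<Psi> f s = 0}"

definition measure_atom :: "'s measure \<Rightarrow> 's set \<Rightarrow> bool" where
  "measure_atom \<mu> Q \<longleftrightarrow> Q \<in> sets \<mu> \<and> emeasure \<mu> Q > 0 \<and>
     (\<forall>E\<in>sets \<mu>. emeasure \<mu> (Q \<inter> E) = 0 \<or> emeasure \<mu> (Q - E) = 0)"

end

theory Submission
  imports Defs
begin

text \<open>
  The proof rests on one rigidity property.  Since \<open>B\<close> is distributive and complemented, each \<open>x\<close>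
  in \<open>B\<close> is the join of a part below \<open>y\<close> and a part independent of \<open>y\<close>, whence the conditional
  expectations \<open>cexp M x\<close>, \<open>x \<in> B\<close>, commute (\<open>cexp_commute_B\<close>).  Strong limits of commuting
  projections commute, so on the closure the product of \<open>cexp M x\<close> and \<open>cexp M y\<close> is
  \<open>cexp M (x \<inter> y)\<close>, and \<open>Cl M B\<close> is stable under intersections (\<open>Cl_inter\<close>, \<open>Cl_cexp\<close>).  An element
  \<open>g\<close> of \<open>L2c M B x\<close> is therefore either fixed by \<open>cexp M y\<close>, if \<open>x \<subseteq> y\<close>, or annihilated by it, as
  \<open>x \<inter> y\<close> is then strictly below \<open>x\<close> (\<open>L2c_cexp\<close>).  Orthogonality of the spaces \<open>L2c M B x\<close>, their
  countability (by Bessel's inequality and separability) and the statements on their direct sums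
  are consequences.

  The same dichotomy shows that every operator in the algebra generated by the projections acts on
  \<open>L2c M B x\<close> as a scalar (\<open>noise_operators_scalar\<close>).  In the spectral resolution \<open>cexp M x\<close> is the
  multiplication by the indicator of a set \<open>supp x\<close>, and all multiplications by indicators belong to
  the algebra.  Hence the spectral support of a non-zero element of \<open>L2c M B x\<close> is an atom, whose
  spectral subspace is \<open>L2c M B x\<close> (\<open>L2c_atom\<close>).  Conversely, an atom \<open>Q\<close> lies, up to null sets, inside
  or outside of each \<open>supp y\<close>, so that its spectral subspace is contained in or orthogonal to
  \<open>L2 M y\<close>; a least \<open>y\<close> of the first kind exists because \<open>Cl M B\<close> is stable under the relevant
  infinite intersections (\<open>Inter_Cl\<close>, \<open>atom_L2c\<close>).

  The statements on products use tensor products; \<open>x \<or> y\<close> denotes \<open>field_join M x y\<close>.  If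
  \<open>u\<close> and \<open>u'\<close> are complementary in \<open>Cl M B\<close>, then \<open>L2 M (sets M)\<close> is the tensor product of \<open>L2 M u\<close> and \<open>L2 M u'\<close>, and every \<open>cexp M w\<close> with \<open>w\<close> in
  \<open>Cl M B\<close> factorizes accordingly (\<open>splits_compl\<close>).  The delicate point is that \<open>x \<or> y\<close> belongs to
  \<open>Cl M B\<close> for \<open>x \<subseteq> u\<close> and \<open>y \<subseteq> u'\<close> (\<open>join_Cl\<close>): joins are not continuous, and if elements of \<open>B\<close>
  converge to \<open>u\<close>, their complements need not converge to \<open>u'\<close>.  An iterated limit helps, in which
  approximations \<open>X\<close>, \<open>Y\<close> of \<open>x\<close>, \<open>y\<close> are kept fixed while those of \<open>u\<close>, \<open>u'\<close> vary
  (\<open>frozen_join_limit\<close>).  Integrating out one factor then maps \<open>L2c M B (x \<or> y)\<close> into \<open>L2c M B x\<close>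
  (\<open>L2c_slice\<close>).  This yields both the product formula (\<open>L2c_join\<close>) and the hereditary property that
  makes \<open>Bc M B\<close> an ideal (\<open>Bc_downward\<close>).
\<close>


section \<open>The pseudo-Hilbert space of square-integrable functions\<close>

lemma borel_measurable_sigma_sets [simp]:
  "borel_measurable (sigma (space M) (sets M)) = borel_measurable M"
  by (rule measurable_cong_sets) (auto simp: sets.space_closed)

lemma L2_top_iff:
  "f \<in> L2 M (sets M) \<longleftrightarrow> f \<in> borel_measurable M \<and> integrable M (\<lambda>\<omega>. (f \<omega>)\<^sup>2)"
  by (simp add: L2_def)

lemma L2_mult_integrable:
  assumes "f \<in> L2 M (sets M)" "g \<in> L2 M (sets M)"
  shows "integrable M (\<lambda>\<omega>. f \<omega> * g \<omega>)"
proof (rule Bochner_Integration.integrable_bound)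
  show "integrable M (\<lambda>\<omega>. (f \<omega>)\<^sup>2 + (g \<omega>)\<^sup>2)" using assms by (auto simp: L2_top_iff)
  show "(\<lambda>\<omega>. f \<omega> * g \<omega>) \<in> borel_measurable M" using assms by (auto simp: L2_top_iff)
  have "\<bar>a * b\<bar> \<le> a\<^sup>2 + b\<^sup>2" for a b :: real
    using sum_squares_bound[of "\<bar>a\<bar>" "\<bar>b\<bar>"] mult_nonneg_nonneg[of "\<bar>a\<bar>" "\<bar>b\<bar>"]
    unfolding abs_mult mult.assoc by (simp only: power2_abs abs_ge_zero simp_thms True_implies_equals)
  then show "AE \<omega> in M. norm (f \<omega> * g \<omega>) \<le> norm ((f \<omega>)\<^sup>2 + (g \<omega>)\<^sup>2)"
    by (auto intro!: AE_I2)
qed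

lemma L2_add:
  assumes "f \<in> L2 M (sets M)" "g \<in> L2 M (sets M)"
  shows "(\<lambda>\<omega>. f \<omega> + g \<omega>) \<in> L2 M (sets M)"
proof -
  have "integrable M (\<lambda>\<omega>. (f \<omega>)\<^sup>2 + (g \<omega>)\<^sup>2 + 2 * (f \<omega> * g \<omega>))"
    using assms L2_mult_integrable[OF assms] by (auto simp: L2_top_iff)
  then show ?thesis using assms by (auto simp: L2_top_iff power2_sum mult.assoc)
qed

lemma L2_cmult:
  assumes "f \<in> L2 M (sets M)"
  shows "(\<lambda>\<omega>. c * f \<omega>) \<in> L2 M (sets M)"
  using assms by (auto simp: L2_top_iff power_mult_distrib)

lemma L2_diff:
  assumes "f \<in> L2 M (sets M)" "g \<in> L2 M (sets M)"
  shows "(\<lambda>\<omega>. f \<omega> - g \<omega>) \<in> L2 M (sets M)"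
  using L2_add[OF assms(1) L2_cmult[OF assms(2), of "-1"]] by simp

lemma L2_lincomb:
  assumes "f \<in> L2 M (sets M)" "g \<in> L2 M (sets M)"
  shows "(\<lambda>\<omega>. a * f \<omega> + b * g \<omega>) \<in> L2 M (sets M)"
  by (intro L2_add L2_cmult assms)

lemma L2_sum:
  assumes "\<And>i. i \<in> F \<Longrightarrow> f i \<in> L2 M (sets M)"
  shows "(\<lambda>\<omega>. \<Sum>i\<in>F. f i \<omega>) \<in> L2 M (sets M)"
  using assms
proof (induction F rule: infinite_finite_induct)
  case (insert i F)
  then show ?case using L2_add[of "f i" M "\<lambda>\<omega>. \<Sum>i\<in>F. f i \<omega>"] by auto
qed (auto simp: L2_top_iff)

lemma l2_inner_real: "l2_inner M f g = (\<integral>\<omega>. f \<omega> * g \<omega> \<partial>M)" for f g :: "'a \<Rightarrow> real"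
  by (simp add: l2_inner_def)

lemma l2_inner_commute: "l2_inner M f g = l2_inner M g f"
  by (simp add: l2_inner_def inner_commute)

lemma l2_inner_lincomb_left:
  fixes f :: "'a \<Rightarrow> real"
  assumes "f \<in> L2 M (sets M)" "g \<in> L2 M (sets M)" "h \<in> L2 M (sets M)"
  shows "l2_inner M (\<lambda>\<omega>. a * f \<omega> + b * g \<omega>) h = a * l2_inner M f h + b * l2_inner M g h"
proof -
  have i: "integrable M (\<lambda>\<omega>. f \<omega> * h \<omega>)" "integrable M (\<lambda>\<omega>. g \<omega> * h \<omega>)"
    using assms L2_mult_integrable by blast+
  have "l2_inner M (\<lambda>\<omega>. a * f \<omega> + b * g \<omega>) h
      = (\<integral>\<omega>. a * (f \<omega> * h \<omega>) + b * (g \<omega> * h \<omega>) \<partial>M)"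
    by (simp add: l2_inner_real algebra_simps)
  also have "\<dots> = a * l2_inner M f h + b * l2_inner M g h"
    using i by (simp add: l2_inner_real)
  finally show ?thesis .
qed

lemma l2_inner_diff_left:
  fixes f :: "'a \<Rightarrow> real"
  assumes "f \<in> L2 M (sets M)" "g \<in> L2 M (sets M)" "h \<in> L2 M (sets M)"
  shows "l2_inner M (\<lambda>\<omega>. f \<omega> - g \<omega>) h = l2_inner M f h - l2_inner M g h"
  using l2_inner_lincomb_left[OF assms, of 1 "-1"] by simp

lemma l2_inner_AE_cong:
  fixes f :: "'a \<Rightarrow> real"
  assumes "AE \<omega> in M. f \<omega> = f' \<omega>" "AE \<omega> in M. g \<omega> = g' \<omega>"
    "f \<in> borel_measurable M" "f' \<in> borel_measurable M" "g \<in> borel_measurable M" "g' \<in> borel_measurable M"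
  shows "l2_inner M f g = l2_inner M f' g'"
  unfolding l2_inner_real using assms by (intro integral_cong_AE) (auto simp: borel_measurable_times)

text \<open>The \<open>L\<^sup>2\<close> distance, a pseudometric on the square-integrable functions that vanishes exactly
  for almost everywhere equal functions.\<close>
definition l2_dist :: "'a measure \<Rightarrow> ('a \<Rightarrow> real) \<Rightarrow> ('a \<Rightarrow> real) \<Rightarrow> real" where
  "l2_dist M f g = l2_norm M (\<lambda>\<omega>. f \<omega> - g \<omega>)"

lemma l2_norm_nonneg [simp]: "0 \<le> l2_norm M f"
  by (simp add: l2_norm_def)

lemma l2_norm_power2: "(l2_norm M f)\<^sup>2 = l2_inner M f f"
  by (simp add: l2_norm_def l2_inner_def power2_norm_eq_inner)

lemma l2_norm_AE_cong:
  fixes f :: "'a \<Rightarrow> real"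
  assumes "AE \<omega> in M. f \<omega> = f' \<omega>" "f \<in> borel_measurable M" "f' \<in> borel_measurable M"
  shows "l2_norm M f = l2_norm M f'"
  unfolding l2_norm_def using assms by (intro arg_cong[where f=sqrt] integral_cong_AE) auto

lemma l2_norm_zero_iff:
  assumes "f \<in> L2 M (sets M)"
  shows "l2_norm M f = 0 \<longleftrightarrow> (AE \<omega> in M. f \<omega> = 0)"
  using assms integral_nonneg_eq_0_iff_AE[of M "\<lambda>\<omega>. (f \<omega>)\<^sup>2"] by (simp add: l2_norm_def L2_top_iff)

lemma l2_norm_cmult: "l2_norm M (\<lambda>\<omega>. c * f \<omega>) = \<bar>c\<bar> * l2_norm M f" for f :: "'a \<Rightarrow> real"
  by (simp add: l2_norm_def power_mult_distrib real_sqrt_mult)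

lemma l2_Cauchy_Schwarz:
  fixes f :: "'a \<Rightarrow> real"
  assumes "f \<in> L2 M (sets M)" "g \<in> L2 M (sets M)"
  shows "\<bar>l2_inner M f g\<bar> \<le> l2_norm M f * l2_norm M g"
proof -
  let ?a = "l2_inner M f f" and ?b = "l2_inner M f g" and ?c = "l2_inner M g g"
  \<comment> \<open>The quadratic form of the Gram matrix of \<open>f\<close> and \<open>g\<close> is positive semidefinite.\<close>
  have q: "0 \<le> s\<^sup>2 * ?a + 2 * s * t * ?b + t\<^sup>2 * ?c" for s t
  proof -
    let ?h = "\<lambda>\<omega>. s * f \<omega> + t * g \<omega>"
    have "0 \<le> l2_inner M ?h ?h" by (simp add: l2_inner_def)
    also have "\<dots> = s * l2_inner M f ?h + t * l2_inner M g ?h"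
      using assms L2_lincomb by (intro l2_inner_lincomb_left) auto
    also have "l2_inner M f ?h = s * ?a + t * ?b"
      using l2_inner_lincomb_left[OF assms assms(1)] by (metis l2_inner_commute)
    also have "l2_inner M g ?h = s * ?b + t * ?c"
      using l2_inner_lincomb_left[OF assms assms(2)] by (metis l2_inner_commute)
    finally show ?thesis by (simp add: algebra_simps power2_eq_square)
  qed
  have a0: "0 \<le> ?a" "0 \<le> ?c" by (simp_all add: l2_inner_def)
  have "?b\<^sup>2 \<le> ?a * ?c"
  proof (cases "?a = 0")
    case True
    have "?b = 0"
    proof (rule ccontr)
      assume b: "?b \<noteq> 0"
      have "0 \<le> 2 * (- (?c + 1) / (2 * ?b)) * 1 * ?b + 1\<^sup>2 * ?c"
        using q[of "- (?c + 1) / (2 * ?b)" 1] True by simp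
      then show False using b by (simp add: field_simps)
    qed
    then show ?thesis using a0 by simp
  next
    case False
    with a0 have pos: "?a > 0" by linarith
    have "0 \<le> (- ?b)\<^sup>2 * ?a + 2 * (- ?b) * ?a * ?b + ?a\<^sup>2 * ?c" by (rule q)
    then have "0 \<le> ?a * (?a * ?c - ?b\<^sup>2)" by (simp add: algebra_simps power2_eq_square)
    with pos show ?thesis by (simp add: zero_le_mult_iff)
  qed
  then have "\<bar>?b\<bar>\<^sup>2 \<le> (l2_norm M f * l2_norm M g)\<^sup>2"
    unfolding power_mult_distrib l2_norm_power2 by simp
  then show ?thesis by (rule power2_le_imp_le) simp
qed

lemma l2_norm_triangle:
  fixes f :: "'a \<Rightarrow> real"
  assumes "f \<in> L2 M (sets M)" "g \<in> L2 M (sets M)"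
  shows "l2_norm M (\<lambda>\<omega>. f \<omega> + g \<omega>) \<le> l2_norm M f + l2_norm M g"
proof -
  let ?h = "\<lambda>\<omega>. f \<omega> + g \<omega>"
  have h: "?h \<in> L2 M (sets M)" using assms by (rule L2_add)
  have "(l2_norm M ?h)\<^sup>2 = l2_inner M f ?h + l2_inner M g ?h"
    using l2_inner_lincomb_left[OF assms h, of 1 1] by (simp add: l2_norm_power2)
  also have "l2_inner M f ?h = (l2_norm M f)\<^sup>2 + l2_inner M f g"
    using l2_inner_lincomb_left[OF assms assms(1), of 1 1] l2_inner_commute[of M f ?h]
      l2_inner_commute[of M g f] by (simp add: l2_norm_power2)
  also have "l2_inner M g ?h = l2_inner M f g + (l2_norm M g)\<^sup>2"
    using l2_inner_lincomb_left[OF assms assms(2), of 1 1] l2_inner_commute[of M g ?h]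
    by (simp add: l2_norm_power2)
  finally have "(l2_norm M ?h)\<^sup>2 \<le> (l2_norm M f + l2_norm M g)\<^sup>2"
    using l2_Cauchy_Schwarz[OF assms] by (simp add: power2_sum)
  then show ?thesis by (rule power2_le_imp_le) simp
qed

lemma l2_dist_triangle:
  assumes "f \<in> L2 M (sets M)" "g \<in> L2 M (sets M)" "h \<in> L2 M (sets M)"
  shows "l2_dist M f h \<le> l2_dist M f g + l2_dist M g h"
  using l2_norm_triangle[OF L2_diff[OF assms(1,2)] L2_diff[OF assms(2,3)]]
  by (simp add: l2_dist_def)

lemma l2_dist_commute: "l2_dist M f g = l2_dist M g f"
  by (simp add: l2_dist_def l2_norm_def power2_commute)

lemma l2_dist_nonneg [simp]: "0 \<le> l2_dist M f g"
  by (simp add: l2_dist_def)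

lemma l2_dist_zero_iff:
  assumes "f \<in> L2 M (sets M)" "g \<in> L2 M (sets M)"
  shows "l2_dist M f g = 0 \<longleftrightarrow> (AE \<omega> in M. f \<omega> = g \<omega>)"
  unfolding l2_dist_def using l2_norm_zero_iff[OF L2_diff[OF assms]] by simp

lemma l2_dist_self [simp]: "l2_dist M f f = 0"
  by (simp add: l2_dist_def l2_norm_def)

lemma l2_dist_AE_cong:
  assumes "AE \<omega> in M. f \<omega> = f' \<omega>" "AE \<omega> in M. g \<omega> = g' \<omega>"
    "f \<in> L2 M (sets M)" "f' \<in> L2 M (sets M)" "g \<in> L2 M (sets M)" "g' \<in> L2 M (sets M)"
  shows "l2_dist M f g = l2_dist M f' g'"
  unfolding l2_dist_def using assms by (intro l2_norm_AE_cong) (auto simp: L2_top_iff)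

lemma l2_dist_lincomb:
  assumes "f \<in> L2 M (sets M)" "f' \<in> L2 M (sets M)" "g \<in> L2 M (sets M)" "g' \<in> L2 M (sets M)"
  shows "l2_dist M (\<lambda>\<omega>. a * f \<omega> + b * g \<omega>) (\<lambda>\<omega>. a * f' \<omega> + b * g' \<omega>)
    \<le> \<bar>a\<bar> * l2_dist M f f' + \<bar>b\<bar> * l2_dist M g g'"
  using l2_norm_triangle[OF L2_cmult[OF L2_diff[OF assms(1,2)], of a] L2_cmult[OF L2_diff[OF assms(3,4)], of b]]
  unfolding l2_norm_cmult by (simp add: l2_dist_def algebra_simps)

lemma l2_inner_dist_bound:
  assumes "f \<in> L2 M (sets M)" "g \<in> L2 M (sets M)" "h \<in> L2 M (sets M)"
  shows "\<bar>l2_inner M f h - l2_inner M g h\<bar> \<le> l2_dist M f g * l2_norm M h"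
  using l2_Cauchy_Schwarz[OF L2_diff[OF assms(1,2)] assms(3)] l2_inner_diff_left[OF assms]
  by (simp add: l2_dist_def)

lemma l2_orth_self_zero:
  assumes "f \<in> L2 M (sets M)" "l2_inner M f f = 0"
  shows "AE \<omega> in M. f \<omega> = 0"
  using assms l2_norm_zero_iff[OF assms(1)] l2_norm_power2[of M f] by simp


section \<open>Closed subspaces\<close>

text \<open>The closed linear subspaces of \<open>L\<^sup>2\<close>; closedness under limits includes saturation with
  respect to almost everywhere equality.\<close>
definition closed_subspace :: "'a measure \<Rightarrow> ('a \<Rightarrow> real) set \<Rightarrow> bool" where
  "closed_subspace M V \<longleftrightarrow> V \<subseteq> L2 M (sets M) \<and> (\<lambda>_. 0) \<in> V \<and>
     (\<forall>f\<in>V. \<forall>g\<in>V. \<forall>a b. (\<lambda>\<omega>. a * f \<omega> + b * g \<omega>) \<in> V) \<and>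
     (\<forall>f\<in>L2 M (sets M). (\<forall>\<epsilon>>0. \<exists>g\<in>V. l2_dist M f g < \<epsilon>) \<longrightarrow> f \<in> V)"

lemma closed_subspaceI:
  assumes "V \<subseteq> L2 M (sets M)" "(\<lambda>_. 0) \<in> V"
    "\<And>f g a b. f \<in> V \<Longrightarrow> g \<in> V \<Longrightarrow> (\<lambda>\<omega>. a * f \<omega> + b * g \<omega>) \<in> V"
    "\<And>f. f \<in> L2 M (sets M) \<Longrightarrow> (\<And>\<epsilon>. \<epsilon> > 0 \<Longrightarrow> \<exists>g\<in>V. l2_dist M f g < \<epsilon>) \<Longrightarrow> f \<in> V"
  shows "closed_subspace M V"
  using assms unfolding closed_subspace_def by blast

lemma closed_subspaceD:
  assumes "closed_subspace M V"
  shows closed_subspace_L2: "f \<in> V \<Longrightarrow> f \<in> L2 M (sets M)"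
    and closed_subspace_zero: "(\<lambda>_. 0) \<in> V"
    and closed_subspace_lincomb: "f \<in> V \<Longrightarrow> g \<in> V \<Longrightarrow> (\<lambda>\<omega>. a * f \<omega> + b * g \<omega>) \<in> V"
    and closed_subspace_limit:
      "f \<in> L2 M (sets M) \<Longrightarrow> (\<And>\<epsilon>. \<epsilon> > 0 \<Longrightarrow> \<exists>g\<in>V. l2_dist M f g < \<epsilon>) \<Longrightarrow> f \<in> V"
  using assms unfolding closed_subspace_def by blast+

lemma closed_subspace_cmult:
  assumes "closed_subspace M V" "f \<in> V"
  shows "(\<lambda>\<omega>. c * f \<omega>) \<in> V"
  using closed_subspace_lincomb[OF assms(1,2,2), of c 0] by simp

lemma closed_subspace_diff:
  assumes "closed_subspace M V" "f \<in> V" "g \<in> V"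
  shows "(\<lambda>\<omega>. f \<omega> - g \<omega>) \<in> V"
  using closed_subspace_lincomb[OF assms, of 1 "-1"] by simp

lemma closed_subspace_AE:
  assumes "closed_subspace M V" "f \<in> V" "g \<in> L2 M (sets M)" "AE \<omega> in M. f \<omega> = g \<omega>"
  shows "g \<in> V"
proof (rule closed_subspace_limit[OF assms(1,3)])
  fix \<epsilon> :: real assume "\<epsilon> > 0"
  have "l2_dist M f g = 0"
    using l2_dist_zero_iff[OF closed_subspace_L2[OF assms(1,2)] assms(3)] assms(4) by simp
  then have "l2_dist M g f = 0" by (simp only: l2_dist_commute[of M g f])
  with \<open>\<epsilon> > 0\<close> assms(2) show "\<exists>g'\<in>V. l2_dist M g g' < \<epsilon>" by (intro bexI[of _ f]) simp_all
qed

lemma closed_subspace_sum: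
  assumes "closed_subspace M V" "finite F" "\<And>i. i \<in> F \<Longrightarrow> f i \<in> V"
  shows "(\<lambda>\<omega>. \<Sum>i\<in>F. f i \<omega>) \<in> V"
  using assms(2,3)
proof (induction F)
  case (insert i F)
  then have "(\<lambda>\<omega>. 1 * f i \<omega> + 1 * (\<Sum>i\<in>F. f i \<omega>)) \<in> V"
    by (intro closed_subspace_lincomb[OF assms(1)]) auto
  then show ?case using insert by simp
qed (simp add: closed_subspace_zero[OF assms(1)])

lemma lin_span_subset_closed_subspace:
  assumes "closed_subspace M V" "T \<subseteq> V"
  shows "lin_span T \<subseteq> V"
proof
  fix f assume "f \<in> lin_span T"
  then obtain F c where F: "finite F" "F \<subseteq> T" "f = (\<lambda>\<omega>. \<Sum>g\<in>F. c g * g \<omega>)"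
    by (auto simp: lin_span_def)
  show "f \<in> V" unfolding F(3)
    using F(1,2) assms(2) by (intro closed_subspace_sum[OF assms(1)] closed_subspace_cmult[OF assms(1)]) auto
qed

lemma closed_span_subset_closed_subspace:
  assumes "closed_subspace M V" "T \<subseteq> V"
  shows "closed_span M T \<subseteq> V"
proof
  fix f assume "f \<in> closed_span M T"
  then show "f \<in> V"
    using lin_span_subset_closed_subspace[OF assms]
    by (intro closed_subspace_limit[OF assms(1)]) (auto simp: closed_span_def l2_dist_def, blast)
qed

lemma lin_span_lincomb:
  assumes "f \<in> lin_span T" "g \<in> lin_span T"
  shows "(\<lambda>\<omega>. a * f \<omega> + b * g \<omega>) \<in> lin_span T"
proof -
  obtain F c where F: "finite F" "F \<subseteq> T" "f = (\<lambda>\<omega>. \<Sum>h\<in>F. c h * h \<omega>)"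
    using assms(1) by (auto simp: lin_span_def)
  obtain G d where G: "finite G" "G \<subseteq> T" "g = (\<lambda>\<omega>. \<Sum>h\<in>G. d h * h \<omega>)"
    using assms(2) by (auto simp: lin_span_def)
  define e where "e h = a * (if h \<in> F then c h else 0) + b * (if h \<in> G then d h else 0)" for h
  have "a * f \<omega> + b * g \<omega> = (\<Sum>h\<in>F\<union>G. e h * h \<omega>)" for \<omega>
  proof -
    have "f \<omega> = (\<Sum>h\<in>F\<union>G. (if h \<in> F then c h else 0) * h \<omega>)"
      unfolding F(3) using F(1) G(1) by (intro sum.mono_neutral_cong_left) auto
    moreover have "g \<omega> = (\<Sum>h\<in>F\<union>G. (if h \<in> G then d h else 0) * h \<omega>)"
      unfolding G(3) using F(1) G(1) by (intro sum.mono_neutral_cong_left) auto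
    ultimately show ?thesis
      by (simp only: e_def sum_distrib_left sum.distrib[symmetric]) (simp add: algebra_simps)
  qed
  then show ?thesis using F G by (auto simp: lin_span_def intro!: exI[of _ "F \<union> G"] exI[of _ e])
qed

lemma lin_span_base: "f \<in> T \<Longrightarrow> f \<in> lin_span T"
  by (auto simp: lin_span_def intro!: exI[of _ "{f}"] exI[of _ "\<lambda>_. 1"])

lemma lin_span_mono: "S \<subseteq> T \<Longrightarrow> lin_span S \<subseteq> lin_span T"
  unfolding lin_span_def by blast

lemma lin_span_L2: "T \<subseteq> L2 M (sets M) \<Longrightarrow> lin_span T \<subseteq> L2 M (sets M)"
  by (auto simp: lin_span_def intro!: L2_sum L2_cmult)

lemma closed_span_closed_subspace:
  assumes "T \<subseteq> L2 M (sets M)"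
  shows "closed_subspace M (closed_span M T)"
proof (rule closed_subspaceI)
  show "closed_span M T \<subseteq> L2 M (sets M)" by (auto simp: closed_span_def)
  have "(\<lambda>_. 0) \<in> lin_span T" by (auto simp: lin_span_def intro!: exI[of _ "{}"])
  then show "(\<lambda>_. 0) \<in> closed_span M T"
    by (auto simp: closed_span_def L2_top_iff intro!: bexI[of _ "\<lambda>_. 0"]) (simp add: l2_norm_def)
next
  fix f g and a b :: real assume fg: "f \<in> closed_span M T" "g \<in> closed_span M T"
  then have L: "f \<in> L2 M (sets M)" "g \<in> L2 M (sets M)" by (auto simp: closed_span_def)
  show "(\<lambda>\<omega>. a * f \<omega> + b * g \<omega>) \<in> closed_span M T"
    unfolding closed_span_def
  proof (intro CollectI conjI allI impI L2_lincomb L)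
    fix \<epsilon> :: real assume "\<epsilon> > 0"
    define \<delta> where "\<delta> = \<epsilon> / (\<bar>a\<bar> + \<bar>b\<bar> + 1)"
    have \<delta>: "\<delta> > 0" using \<open>\<epsilon> > 0\<close> by (auto simp: \<delta>_def)
    obtain f' where f': "f' \<in> lin_span T" "l2_dist M f f' < \<delta>"
      using fg(1) \<delta> by (auto simp: closed_span_def l2_dist_def)
    obtain g' where g': "g' \<in> lin_span T" "l2_dist M g g' < \<delta>"
      using fg(2) \<delta> by (auto simp: closed_span_def l2_dist_def)
    have "l2_dist M (\<lambda>\<omega>. a * f \<omega> + b * g \<omega>) (\<lambda>\<omega>. a * f' \<omega> + b * g' \<omega>)
        \<le> \<bar>a\<bar> * l2_dist M f f' + \<bar>b\<bar> * l2_dist M g g'"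
      using L f' g' lin_span_L2[OF assms] by (intro l2_dist_lincomb) auto
    also have "\<dots> \<le> \<bar>a\<bar> * \<delta> + \<bar>b\<bar> * \<delta>"
      using f' g' by (intro add_mono mult_left_mono) auto
    also have "\<dots> < (\<bar>a\<bar> + \<bar>b\<bar> + 1) * \<delta>" using \<delta> by (simp add: algebra_simps)
    also have "\<dots> = \<epsilon>" by (simp add: \<delta>_def add_nonneg_eq_0_iff)
    finally show "\<exists>h\<in>lin_span T. l2_norm M (\<lambda>\<omega>. a * f \<omega> + b * g \<omega> - h \<omega>) < \<epsilon>"
      using lin_span_lincomb[OF f'(1) g'(1), of a b] by (auto simp: l2_dist_def)
  qed
next
  fix f assume f: "f \<in> L2 M (sets M)" and ap: "\<And>\<epsilon>. \<epsilon> > 0 \<Longrightarrow> \<exists>g\<in>closed_span M T. l2_dist M f g < \<epsilon>"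
  show "f \<in> closed_span M T"
    unfolding closed_span_def
  proof (intro CollectI conjI allI impI f)
    fix \<epsilon> :: real assume "\<epsilon> > 0"
    then obtain g where g: "g \<in> closed_span M T" "l2_dist M f g < \<epsilon> / 2" using ap[of "\<epsilon>/2"] by auto
    then obtain h where h: "h \<in> lin_span T" "l2_dist M g h < \<epsilon> / 2"
      using \<open>\<epsilon> > 0\<close> unfolding closed_span_def l2_dist_def by (auto dest: spec[of _ "\<epsilon>/2"])
    have "l2_dist M f h \<le> l2_dist M f g + l2_dist M g h"
      using f g h lin_span_L2[OF assms] by (intro l2_dist_triangle) (auto simp: closed_span_def)
    with g h have "l2_dist M f h < \<epsilon>" by simp
    then show "\<exists>h\<in>lin_span T. l2_norm M (\<lambda>\<omega>. f \<omega> - h \<omega>) < \<epsilon>" using h by (auto simp: l2_dist_def)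
  qed
qed

lemma closed_span_base: "T \<subseteq> L2 M (sets M) \<Longrightarrow> f \<in> T \<Longrightarrow> f \<in> closed_span M T"
  by (auto simp: closed_span_def intro!: bexI[OF _ lin_span_base[of f]]) (simp add: l2_norm_def)

lemma closed_span_mono: "S \<subseteq> T \<Longrightarrow> closed_span M S \<subseteq> closed_span M T"
  using lin_span_mono[of S T] unfolding closed_span_def by blast

lemma closed_subspace_orth:
  assumes "k \<in> L2 M (sets M)"
  shows "closed_subspace M {h \<in> L2 M (sets M). l2_inner M k h = 0}"
proof (rule closed_subspaceI)
  fix f assume f: "f \<in> L2 M (sets M)"
    and ap: "\<And>\<epsilon>. \<epsilon> > 0 \<Longrightarrow> \<exists>g\<in>{h \<in> L2 M (sets M). l2_inner M k h = 0}. l2_dist M f g < \<epsilon>"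
  have "\<bar>l2_inner M k f\<bar> \<le> \<epsilon>" if "\<epsilon> > 0" for \<epsilon>
  proof -
    have "\<epsilon> / (l2_norm M k + 1) > 0" using that by (simp add: add_nonneg_pos)
    then obtain g where g: "g \<in> L2 M (sets M)" "l2_inner M k g = 0" "l2_dist M f g < \<epsilon> / (l2_norm M k + 1)"
      using ap by blast
    have "\<bar>l2_inner M k f\<bar> \<le> l2_dist M f g * l2_norm M k"
      using l2_inner_dist_bound[OF f g(1) assms] g(2) by (simp add: l2_inner_commute)
    also have "\<dots> \<le> \<epsilon> / (l2_norm M k + 1) * (l2_norm M k + 1)"
      using g(3) that by (intro mult_mono) auto
    also have "\<dots> = \<epsilon>" by (simp add: add_nonneg_eq_0_iff)
    finally show ?thesis .
  qed
  then have "\<bar>l2_inner M k f\<bar> \<le> 0" by (rule field_le_epsilon) simp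
  with f show "f \<in> {h \<in> L2 M (sets M). l2_inner M k h = 0}" by simp
next
  fix f g and a b :: real
  assume "f \<in> {h \<in> L2 M (sets M). l2_inner M k h = 0}" "g \<in> {h \<in> L2 M (sets M). l2_inner M k h = 0}"
  then show "(\<lambda>\<omega>. a * f \<omega> + b * g \<omega>) \<in> {h \<in> L2 M (sets M). l2_inner M k h = 0}"
    using assms l2_inner_lincomb_left[of f M g k a b] L2_lincomb
    by (auto simp: l2_inner_commute[of M k f] l2_inner_commute[of M k g]
        l2_inner_commute[of M k "\<lambda>\<omega>. a * f \<omega> + b * g \<omega>"])
qed (auto simp: L2_top_iff l2_inner_def)


section \<open>Complete sub-\<open>\<sigma>\<close>-fields and conditional expectations\<close>

context prob_space
begin

text \<open>The square-integrable functions of the whole probability space.\<close>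
abbreviation LL :: "('a \<Rightarrow> real) set" where "LL \<equiv> L2 M (sets M)"

lemma subfieldsD:
  assumes "x \<in> subfields M"
  shows subfields_sigma: "sigma_algebra (space M) x" and subfields_bot: "bot_field M \<subseteq> x"
    and subfields_events: "x \<subseteq> sets M"
  using assms by (auto simp: subfields_def)

lemma sets_subfield [simp]: "x \<in> subfields M \<Longrightarrow> sets (sigma (space M) x) = x"
  using subfields_sigma[of x] by (simp add: sigma_algebra.sets_measure_of_eq)

lemma space_sigma_space [simp]: "space (sigma (space M) x) = space M"
  by (rule space_measure_of_conv)

lemma subfield_sigma_sets: "x \<in> subfields M \<Longrightarrow> sigma_sets (space M) x = x"
  using subfields_sigma[of x] by (simp add: sigma_algebra.sigma_sets_eq)

lemma null_in_subfield: "x \<in> subfields M \<Longrightarrow> A \<in> sets M \<Longrightarrow> prob A = 0 \<Longrightarrow> A \<in> x"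
  using subfields_bot[of x] by (auto simp: bot_field_def)

lemma space_in_subfield: "x \<in> subfields M \<Longrightarrow> space M \<in> x"
  using subfields_bot[of x] by (auto simp: bot_field_def prob_space)

lemma bot_field_sigma: "sigma_algebra (space M) (bot_field M)"
proof (rule sigma_algebra.intro)
  show "algebra (space M) (bot_field M)"
    unfolding algebra_iff_Un bot_field_def
  proof (intro conjI ballI, goal_cases)
    case 1 then show ?case using sets.sets_into_space by auto
  next
    case 2 then show ?case by simp
  next
    case (3 A) then show ?case by (auto simp: prob_compl)
  next
    case (4 A C)
    then have m: "A \<in> sets M" "C \<in> sets M" by auto
    consider "prob A = 1" | "prob C = 1" | "prob A = 0" "prob C = 0" using 4 by auto
    then have "prob (A \<union> C) = 1 \<or> prob (A \<union> C) = 0"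
    proof cases
      case 1
      then have "1 \<le> prob (A \<union> C)" using finite_measure_mono[of A "A \<union> C"] m by auto
      then show ?thesis using prob_le_1[of "A \<union> C"] by linarith
    next
      case 2
      then have "1 \<le> prob (A \<union> C)" using finite_measure_mono[of C "A \<union> C"] m by auto
      then show ?thesis using prob_le_1[of "A \<union> C"] by linarith
    next
      case 3
      then show ?thesis using measure_Un_le[OF m] measure_nonneg[of M "A \<union> C"] by linarith
    qed
    then show ?case using m by auto
  qed
next
  show "sigma_algebra_axioms (bot_field M)"
  proof
    fix A :: "nat \<Rightarrow> 'a set" assume A: "range A \<subseteq> bot_field M"
    then have m: "A i \<in> sets M" for i by (auto simp: bot_field_def)
    then have um: "(\<Union>i. A i) \<in> sets M" by auto
    show "(\<Union>i. A i) \<in> bot_field M"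
    proof (cases "\<exists>i. prob (A i) = 1")
      case True
      then obtain i where "prob (A i) = 1" by auto
      then have "1 \<le> prob (\<Union>i. A i)" using finite_measure_mono[of "A i" "\<Union>i. A i"] um by auto
      then have "prob (\<Union>i. A i) = 1" using prob_le_1[of "\<Union>i. A i"] by linarith
      then show ?thesis using um by (simp add: bot_field_def)
    next
      case False
      then have "A i \<in> null_sets M" for i
        using A m[of i] by (auto simp: bot_field_def null_sets_def emeasure_eq_measure)
      then have "(\<Union>i. A i) \<in> null_sets M" by auto
      then show ?thesis using um by (simp add: bot_field_def null_sets_def emeasure_eq_measure)
    qed
  qed
qed

lemma bot_subfield: "bot_field M \<in> subfields M"
  using bot_field_sigma by (auto simp: subfields_def bot_field_def)

lemma top_subfield: "sets M \<in> subfields M"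
  using sets.sigma_algebra_axioms by (auto simp: subfields_def bot_field_def)

lemma Inter_subfield:
  assumes "E \<noteq> {}" "E \<subseteq> subfields M" shows "\<Inter>E \<in> subfields M"
proof -
  have s: "sigma_algebra (space M) y" if "y \<in> E" for y using that assms by (auto simp: subfields_def)
  have "sigma_algebra (space M) (\<Inter>E)"
    unfolding sigma_algebra_iff2
  proof (intro conjI ballI allI impI)
    obtain y where "y \<in> E" using assms(1) by blast
    with s[of y] show "\<Inter>E \<subseteq> Pow (space M)" by (auto simp: sigma_algebra_iff2)
    show "{} \<in> \<Inter>E" using s by (auto simp: sigma_algebra_iff2)
    show "space M - A \<in> \<Inter>E" if "A \<in> \<Inter>E" for A using s that by (auto simp: sigma_algebra_iff2)
    show "(\<Union>i::nat. A i) \<in> \<Inter>E" if "range A \<subseteq> \<Inter>E" for A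
    proof
      fix y assume "y \<in> E"
      with that have "range A \<subseteq> y" by blast
      with s[OF \<open>y \<in> E\<close>] show "(\<Union>i::nat. A i) \<in> y" unfolding sigma_algebra_iff2 by simp
    qed
  qed
  then show ?thesis using assms by (auto simp: subfields_def)
qed

lemma inter_subfield:
  assumes "x \<in> subfields M" "y \<in> subfields M" shows "x \<inter> y \<in> subfields M"
  using Inter_subfield[of "{x, y}"] assms by auto

lemma join_subfield:
  assumes "x \<in> subfields M" "y \<in> subfields M" shows "field_join M x y \<in> subfields M"
proof -
  have "x \<union> y \<subseteq> sets M" using assms by (auto simp: subfields_def)
  then have "sigma_sets (space M) (x \<union> y) \<subseteq> sets M" by (rule sets.sigma_sets_subset)
  moreover have "sigma_algebra (space M) (sigma_sets (space M) (x \<union> y))"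
    using \<open>x \<union> y \<subseteq> sets M\<close> sets.space_closed by (intro sigma_algebra_sigma_sets) blast
  ultimately show ?thesis
    using assms subfields_bot[OF assms(1)] by (auto simp: subfields_def field_join_def)
qed

lemma join_upper: "x \<subseteq> field_join M x y" "y \<subseteq> field_join M x y"
  by (auto simp: field_join_def)

lemma join_least:
  assumes "z \<in> subfields M" "x \<subseteq> z" "y \<subseteq> z" shows "field_join M x y \<subseteq> z"
  using sigma_algebra.sigma_sets_subset[OF subfields_sigma[OF assms(1)], of "x \<union> y"] assms
  by (simp add: field_join_def)

lemma join_absorb:
  assumes "y \<in> subfields M" "x \<subseteq> y" shows "field_join M x y = y"
  using join_least[OF assms(1) assms(2)] join_upper[of y x] by auto

lemma join_commute: "field_join M x y = field_join M y x"
  by (simp add: field_join_def Un_commute)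

lemma join_mono: "x \<subseteq> x' \<Longrightarrow> y \<subseteq> y' \<Longrightarrow> field_join M x y \<subseteq> field_join M x' y'"
  unfolding field_join_def by (intro sigma_sets_mono') blast

lemma L2_mono:
  assumes "x \<in> subfields M" "y \<in> subfields M" "x \<subseteq> y" shows "L2 M x \<subseteq> L2 M y"
proof -
  have "borel_measurable (sigma (space M) x) \<subseteq> (borel_measurable (sigma (space M) y) :: ('a \<Rightarrow> real) set)"
    using assms by (intro measurable_mono) auto
  then show ?thesis by (auto simp: L2_def)
qed

lemma L2_subset: "x \<in> subfields M \<Longrightarrow> L2 M x \<subseteq> LL"
  by (rule L2_mono[OF _ top_subfield]) (auto simp: subfields_def)

lemma L2_subsetD: "f \<in> L2 M x \<Longrightarrow> x \<in> subfields M \<Longrightarrow> f \<in> LL"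
  using L2_subset by blast

lemma L2_inter:
  assumes "x \<in> subfields M" "y \<in> subfields M" shows "L2 M x \<inter> L2 M y = L2 M (x \<inter> y)"
  using assms inter_subfield[OF assms] by (auto simp: L2_def measurable_def)

lemma bounded_LL:
  assumes "f \<in> borel_measurable M" "\<And>\<omega>. \<omega> \<in> space M \<Longrightarrow> \<bar>f \<omega>\<bar> \<le> c" shows "f \<in> LL"
  unfolding L2_top_iff
proof (intro conjI assms(1) integrable_const_bound[where B="c\<^sup>2"])
  show "AE \<omega> in M. norm ((f \<omega>)\<^sup>2) \<le> c\<^sup>2"
    using assms(2) by (intro AE_I2) (simp add: abs_le_square_iff[symmetric], meson abs_ge_self order_trans)
qed (use assms(1) in auto)

lemma LL_bound:
  assumes "f \<in> borel_measurable M" "g \<in> LL" "\<And>\<omega>. \<omega> \<in> space M \<Longrightarrow> \<bar>f \<omega>\<bar> \<le> \<bar>g \<omega>\<bar>" shows "f \<in> LL"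
  unfolding L2_top_iff
proof (intro conjI assms(1))
  show "integrable M (\<lambda>\<omega>. (f \<omega>)\<^sup>2)"
  proof (rule Bochner_Integration.integrable_bound[of M "\<lambda>\<omega>. (g \<omega>)\<^sup>2"])
    show "AE \<omega> in M. norm ((f \<omega>)\<^sup>2) \<le> norm ((g \<omega>)\<^sup>2)"
      using assms(3) by (intro AE_I2) (simp add: abs_le_square_iff[symmetric])
  qed (use assms in \<open>auto simp: L2_top_iff\<close>)
qed

lemma const_LL: "(\<lambda>_. c) \<in> LL"
  by (rule bounded_LL[of _ "\<bar>c\<bar>"]) auto

lemma const_L2: "x \<in> subfields M \<Longrightarrow> (\<lambda>_. c) \<in> L2 M x"
  using const_LL[of c] by (auto simp: L2_def)

lemma indicator_LL: "A \<in> sets M \<Longrightarrow> indicat_real A \<in> LL"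
  by (rule bounded_LL[of _ 1]) (auto simp: indicator_def)

lemma indicator_L2: "x \<in> subfields M \<Longrightarrow> A \<in> x \<Longrightarrow> indicat_real A \<in> L2 M x"
  using indicator_LL[of A] subfields_events[of x] by (auto simp: L2_def intro!: borel_measurable_indicator)

lemma indicator_L2_mem:
  assumes "x \<in> subfields M" "A \<in> sets M" "indicat_real A \<in> L2 M x" shows "A \<in> x"
proof -
  have "indicat_real A -` {1} \<inter> space (sigma (space M) x) \<in> sets (sigma (space M) x)"
    using assms(3) by (intro measurable_sets[where A=borel]) (auto simp: L2_def)
  moreover have "indicat_real A -` {1} \<inter> space M = A"
    using sets.sets_into_space[OF assms(2)] by (auto simp: indicator_def split: if_splits)
  ultimately show ?thesis using assms(1) by simp
qed

lemma mult_indicator_LL: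
  assumes "f \<in> LL" "A \<in> sets M" shows "(\<lambda>\<omega>. f \<omega> * indicat_real A \<omega>) \<in> LL"
  using assms by (intro LL_bound[OF _ assms(1)]) (auto simp: L2_top_iff indicator_def)

lemma mult_indicator_L2:
  assumes "x \<in> subfields M" "f \<in> L2 M x" "A \<in> x" shows "(\<lambda>\<omega>. f \<omega> * indicat_real A \<omega>) \<in> L2 M x"
  using mult_indicator_LL[OF L2_subsetD[OF assms(2,1)], of A] subfields_events[OF assms(1)] assms
  by (auto simp: L2_def intro!: borel_measurable_times borel_measurable_indicator)

text \<open>The spaces \<open>L2 M x\<close> are saturated because \<open>x\<close> contains the null sets.\<close>
lemma L2_AE:
  assumes x: "x \<in> subfields M" and f: "f \<in> L2 M x" and g: "g \<in> LL" and ae: "AE \<omega> in M. f \<omega> = g \<omega>"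
  shows "g \<in> L2 M x"
proof -
  have fm: "f \<in> borel_measurable M" and gm: "g \<in> borel_measurable M"
    using L2_subsetD[OF f x] g by (auto simp: L2_top_iff)
  interpret x: sigma_algebra "space M" x by (rule subfields_sigma[OF x])
  define D where "D = {\<omega> \<in> space M. f \<omega> \<noteq> g \<omega>}"
  have D: "D \<in> sets M" "prob D = 0"
    using fm gm ae by (auto simp: D_def prob_eq_0)
  then have Dx: "D \<in> x" using null_in_subfield[OF x] by blast
  have "g \<in> borel_measurable (sigma (space M) x)"
  proof (rule measurableI)
    fix A :: "real set" assume A: "A \<in> sets borel"
    have fA: "f -` A \<inter> space M \<in> x"
      using f A measurable_sets[of f "sigma (space M) x" borel A] x by (auto simp: L2_def)
    have gD: "g -` A \<inter> space M \<inter> D \<in> sets M" using gm A D by auto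
    have "prob (g -` A \<inter> space M \<inter> D) \<le> prob D" using D by (intro finite_measure_mono) auto
    then have "prob (g -` A \<inter> space M \<inter> D) = 0"
      using D measure_nonneg[of M "g -` A \<inter> space M \<inter> D"] by linarith
    then have "g -` A \<inter> space M \<inter> D \<in> x" using null_in_subfield[OF x gD] by blast
    moreover have "g -` A \<inter> space M = ((f -` A \<inter> space M) - D) \<union> (g -` A \<inter> space M \<inter> D)"
      by (auto simp: D_def)
    ultimately have "g -` A \<inter> space M \<in> x" using fA Dx by (metis x.Diff x.Un)
    then show "g -` A \<inter> space (sigma (space M) x) \<in> sets (sigma (space M) x)" using x by simp
  qed simp
  then show ?thesis using g by (auto simp: L2_def)
qed

lemma subalgebra_subfield: "x \<in> subfields M \<Longrightarrow> subalgebra M (sigma (space M) x)"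
  by (auto simp: subalgebra_def subfields_def)

lemma sigma_finite_subalgebra_subfield:
  assumes "x \<in> subfields M" shows "sigma_finite_subalgebra M (sigma (space M) x)"
proof -
  interpret finite_measure_subalgebra M "sigma (space M) x"
    by unfold_locales (rule subalgebra_subfield[OF assms])
  show ?thesis by unfold_locales
qed

lemma LL_integrable: "f \<in> LL \<Longrightarrow> integrable M f"
  using L2_mult_integrable[OF _ const_LL[of 1], of f] by simp

lemma LL_measurable: "f \<in> LL \<Longrightarrow> f \<in> borel_measurable M"
  by (simp add: L2_top_iff)

lemma cexp_L2:
  assumes x: "x \<in> subfields M" and f: "f \<in> LL" shows "cexp M x f \<in> L2 M x"
proof -
  interpret sigma_finite_subalgebra M "sigma (space M) x" by (rule sigma_finite_subalgebra_subfield[OF x])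
  have "integrable M (\<lambda>\<omega>. (real_cond_exp M (sigma (space M) x) f \<omega>)\<^sup>2)"
    using f convex_power2 LL_integrable[OF f]
    by (intro integrable_convex_cond_exp[where I=UNIV and q="\<lambda>x. x\<^sup>2"]) (auto simp: L2_top_iff)
  then show ?thesis by (auto simp: L2_def cexp_def)
qed

lemma cexp_LL: "x \<in> subfields M \<Longrightarrow> f \<in> LL \<Longrightarrow> cexp M x f \<in> LL"
  using cexp_L2 L2_subsetD by blast

lemma cexp_inner:
  assumes x: "x \<in> subfields M" and f: "f \<in> LL" and k: "k \<in> L2 M x"
  shows "l2_inner M (cexp M x f) k = l2_inner M f k"
proof -
  interpret sigma_finite_subalgebra M "sigma (space M) x" by (rule sigma_finite_subalgebra_subfield[OF x])
  have "(\<integral>\<omega>. k \<omega> * cexp M x f \<omega> \<partial>M) = (\<integral>\<omega>. k \<omega> * f \<omega> \<partial>M)"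
    unfolding cexp_def using f k L2_mult_integrable[OF L2_subsetD[OF k x] f]
    by (intro real_cond_exp_intg(2)) (auto simp: L2_def)
  then show ?thesis by (simp add: l2_inner_real mult.commute)
qed

text \<open>The projection characterization of conditional expectation.\<close>
lemma cexp_eqI:
  assumes x: "x \<in> subfields M" and f: "f \<in> LL" and p: "p \<in> L2 M x"
    and orth: "\<And>h. h \<in> L2 M x \<Longrightarrow> l2_inner M f h = l2_inner M p h"
  shows "AE \<omega> in M. cexp M x f \<omega> = p \<omega>"
proof -
  let ?d = "\<lambda>\<omega>. cexp M x f \<omega> - p \<omega>"
  have pL: "p \<in> LL" using L2_subsetD[OF p x] .
  have d: "?d \<in> L2 M x"
    using cexp_L2[OF x f] p L2_diff[OF cexp_LL[OF x f] pL] by (auto simp: L2_def)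
  have "l2_inner M ?d ?d = 0"
    using cexp_inner[OF x f d] orth[OF d]
      l2_inner_diff_left[OF cexp_LL[OF x f] pL L2_subsetD[OF d x]] by simp
  then have "AE \<omega> in M. ?d \<omega> = 0" by (rule l2_orth_self_zero[OF L2_subsetD[OF d x]])
  then show ?thesis by simp
qed

lemma cexp_fixed:
  assumes "x \<in> subfields M" "f \<in> L2 M x" shows "AE \<omega> in M. cexp M x f \<omega> = f \<omega>"
  by (rule cexp_eqI[OF assms(1) L2_subsetD[OF assms(2,1)] assms(2) refl])

lemma cexp_AE_cong:
  assumes x: "x \<in> subfields M" and "f \<in> LL" "g \<in> LL" "AE \<omega> in M. f \<omega> = g \<omega>"
  shows "AE \<omega> in M. cexp M x f \<omega> = cexp M x g \<omega>"
proof -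
  interpret sigma_finite_subalgebra M "sigma (space M) x" by (rule sigma_finite_subalgebra_subfield[OF x])
  show ?thesis using assms unfolding cexp_def by (intro real_cond_exp_cong) (auto simp: L2_top_iff)
qed

lemma cexp_lincomb:
  assumes x: "x \<in> subfields M" and f: "f \<in> LL" and g: "g \<in> LL"
  shows "AE \<omega> in M. cexp M x (\<lambda>\<omega>. a * f \<omega> + b * g \<omega>) \<omega> = a * cexp M x f \<omega> + b * cexp M x g \<omega>"
proof (rule cexp_eqI[OF x])
  show "(\<lambda>\<omega>. a * f \<omega> + b * g \<omega>) \<in> LL" by (intro L2_lincomb f g)
  have L: "(\<lambda>\<omega>. a * cexp M x f \<omega> + b * cexp M x g \<omega>) \<in> LL" by (intro L2_lincomb cexp_LL x f g)
  then show "(\<lambda>\<omega>. a * cexp M x f \<omega> + b * cexp M x g \<omega>) \<in> L2 M x"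
    using cexp_L2[OF x f] cexp_L2[OF x g] by (auto simp: L2_def)
  fix h assume h: "h \<in> L2 M x"
  then show "l2_inner M (\<lambda>\<omega>. a * f \<omega> + b * g \<omega>) h
      = l2_inner M (\<lambda>\<omega>. a * cexp M x f \<omega> + b * cexp M x g \<omega>) h"
    using l2_inner_lincomb_left[OF f g L2_subsetD[OF h x]]
      l2_inner_lincomb_left[OF cexp_LL[OF x f] cexp_LL[OF x g] L2_subsetD[OF h x]]
      cexp_inner[OF x f h] cexp_inner[OF x g h] by simp
qed

lemma cexp_norm_le:
  assumes x: "x \<in> subfields M" and f: "f \<in> LL" shows "l2_norm M (cexp M x f) \<le> l2_norm M f"
proof -
  have "(l2_norm M (cexp M x f))\<^sup>2 = l2_inner M f (cexp M x f)"
    unfolding l2_norm_power2 by (rule cexp_inner[OF x f cexp_L2[OF x f]])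
  also have "\<dots> \<le> l2_norm M f * l2_norm M (cexp M x f)"
    using l2_Cauchy_Schwarz[OF f cexp_LL[OF x f]] by simp
  finally have "l2_norm M (cexp M x f) * l2_norm M (cexp M x f) \<le> l2_norm M f * l2_norm M (cexp M x f)"
    by (simp add: power2_eq_square)
  then show ?thesis
    using l2_norm_nonneg[of M "cexp M x f"] l2_norm_nonneg[of M f] by (cases "l2_norm M (cexp M x f) = 0") auto
qed

lemma cexp_bounded_ops: "x \<in> subfields M \<Longrightarrow> cexp M x \<in> bounded_ops M"
  unfolding bounded_ops_def using cexp_LL cexp_lincomb cexp_norm_le
  by (auto intro!: exI[of _ 1])

lemma cexp_dist_le:
  assumes x: "x \<in> subfields M" and f: "f \<in> LL" and g: "g \<in> LL"
  shows "l2_dist M (cexp M x f) (cexp M x g) \<le> l2_dist M f g"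
proof -
  have "AE \<omega> in M. cexp M x f \<omega> - cexp M x g \<omega> = cexp M x (\<lambda>\<omega>. f \<omega> - g \<omega>) \<omega>"
    using cexp_lincomb[OF x f g, of 1 "-1"] by eventually_elim simp
  then have "l2_dist M (cexp M x f) (cexp M x g) = l2_norm M (cexp M x (\<lambda>\<omega>. f \<omega> - g \<omega>))"
    unfolding l2_dist_def
    by (rule l2_norm_AE_cong)
      (use LL_measurable cexp_LL[OF x] L2_diff[OF f g] f g in \<open>auto intro!: borel_measurable_diff\<close>)
  then show ?thesis using cexp_norm_le[OF x L2_diff[OF f g]] by (simp add: l2_dist_def)
qed

lemma cexp_tower:
  assumes x: "x \<in> subfields M" and y: "y \<in> subfields M" and "x \<subseteq> y" and f: "f \<in> LL"
  shows "AE \<omega> in M. cexp M x (cexp M y f) \<omega> = cexp M x f \<omega>"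
proof (rule cexp_eqI[OF x cexp_LL[OF y f] cexp_L2[OF x f]])
  fix h assume h: "h \<in> L2 M x"
  then have "h \<in> L2 M y" using L2_mono[OF x y \<open>x \<subseteq> y\<close>] by auto
  then show "l2_inner M (cexp M y f) h = l2_inner M (cexp M x f) h"
    using cexp_inner[OF x f h] cexp_inner[OF y f] by simp
qed

text \<open>Conditional expectation is best approximation, up to the factor two that suffices here.\<close>
lemma cexp_dist_approx:
  assumes x: "x \<in> subfields M" and f: "f \<in> LL" and g: "g \<in> L2 M x"
  shows "l2_dist M (cexp M x f) f \<le> 2 * l2_dist M f g"
proof -
  have gL: "g \<in> LL" using L2_subsetD[OF g x] .
  have "l2_dist M (cexp M x f) f \<le> l2_dist M (cexp M x f) g + l2_dist M g f"
    by (intro l2_dist_triangle cexp_LL x f gL)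
  also have "l2_dist M (cexp M x f) g = l2_dist M (cexp M x f) (cexp M x g)"
    using cexp_fixed[OF x g] by (intro l2_dist_AE_cong cexp_LL x f gL) auto
  also have "\<dots> \<le> l2_dist M f g" by (rule cexp_dist_le[OF x f gL])
  finally show ?thesis by (simp add: l2_dist_commute[of M g f])
qed

lemma L2_cexp_iff:
  assumes x: "x \<in> subfields M" and f: "f \<in> LL"
  shows "f \<in> L2 M x \<longleftrightarrow> (AE \<omega> in M. cexp M x f \<omega> = f \<omega>)"
  using cexp_fixed[OF x] L2_AE[OF x cexp_L2[OF x f] f] by blast

lemma closed_subspace_L2M:
  assumes x: "x \<in> subfields M" shows "closed_subspace M (L2 M x)"
proof (rule closed_subspaceI)
  show "L2 M x \<subseteq> LL" by (rule L2_subset[OF x])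
  show "(\<lambda>_. 0) \<in> L2 M x" by (rule const_L2[OF x])
next
  fix f g and a b :: real assume fg: "f \<in> L2 M x" "g \<in> L2 M x"
  have "(\<lambda>\<omega>. a * f \<omega> + b * g \<omega>) \<in> LL" by (intro L2_lincomb L2_subsetD[OF _ x] fg)
  then show "(\<lambda>\<omega>. a * f \<omega> + b * g \<omega>) \<in> L2 M x" using fg by (auto simp: L2_def)
next
  fix f assume f: "f \<in> LL" and ap: "\<And>\<epsilon>. \<epsilon> > 0 \<Longrightarrow> \<exists>g\<in>L2 M x. l2_dist M f g < \<epsilon>"
  have "l2_dist M (cexp M x f) f \<le> 0"
  proof (rule field_le_epsilon)
    fix \<epsilon> :: real assume "\<epsilon> > 0"
    then obtain g where "g \<in> L2 M x" "l2_dist M f g < \<epsilon> / 2" using ap[of "\<epsilon>/2"] by auto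
    then show "l2_dist M (cexp M x f) f \<le> 0 + \<epsilon>" using cexp_dist_approx[OF x f, of g] by simp
  qed
  then have "l2_dist M (cexp M x f) f = 0" using l2_dist_nonneg[of M "cexp M x f" f] by linarith
  then show "f \<in> L2 M x" using l2_dist_zero_iff[OF cexp_LL[OF x f] f] L2_cexp_iff[OF x f] by simp
qed

lemma bounded_opsD:
  assumes "T \<in> bounded_ops M"
  shows bounded_ops_LL: "f \<in> LL \<Longrightarrow> T f \<in> LL"
    and bounded_ops_lincomb: "f \<in> LL \<Longrightarrow> g \<in> LL \<Longrightarrow>
      AE \<omega> in M. T (\<lambda>\<omega>. a * f \<omega> + b * g \<omega>) \<omega> = a * T f \<omega> + b * T g \<omega>"
  using assms by (auto simp: bounded_ops_def)

lemma bounded_ops_zero: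
  assumes "T \<in> bounded_ops M" shows "AE \<omega> in M. T (\<lambda>_. 0) \<omega> = 0"
  using bounded_ops_lincomb[OF assms const_LL[of 0] const_LL[of 0], of 0 0] by simp

lemma bounded_ops_dist:
  assumes T: "T \<in> bounded_ops M"
  obtains K where "K > 0" "\<And>f g. f \<in> LL \<Longrightarrow> g \<in> LL \<Longrightarrow> l2_dist M (T f) (T g) \<le> K * l2_dist M f g"
proof -
  obtain K where K: "\<And>f. f \<in> LL \<Longrightarrow> l2_norm M (T f) \<le> K * l2_norm M f"
    using T unfolding bounded_ops_def by blast
  have "l2_dist M (T f) (T g) \<le> (\<bar>K\<bar> + 1) * l2_dist M f g" if f: "f \<in> LL" and g: "g \<in> LL" for f g
  proof -
    have "AE \<omega> in M. T f \<omega> - T g \<omega> = T (\<lambda>\<omega>. f \<omega> - g \<omega>) \<omega>"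
      using bounded_ops_lincomb[OF T f g, of 1 "-1"] by eventually_elim simp
    then have "l2_dist M (T f) (T g) = l2_norm M (T (\<lambda>\<omega>. f \<omega> - g \<omega>))"
      unfolding l2_dist_def
      by (rule l2_norm_AE_cong)
        (use LL_measurable bounded_ops_LL[OF T] L2_diff[OF f g] f g in \<open>auto intro!: borel_measurable_diff\<close>)
    also have "\<dots> \<le> K * l2_dist M f g" unfolding l2_dist_def by (rule K[OF L2_diff[OF f g]])
    also have "\<dots> \<le> (\<bar>K\<bar> + 1) * l2_dist M f g" by (intro mult_right_mono) auto
    finally show ?thesis .
  qed
  then show ?thesis using that[of "\<bar>K\<bar> + 1"] by auto
qed

text \<open>Preimages of closed subspaces under bounded operators are closed subspaces.\<close>
lemma closed_subspace_vimage:
  assumes T: "T \<in> bounded_ops M" and V: "closed_subspace M V"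
  shows "closed_subspace M {f \<in> LL. T f \<in> V}"
proof (rule closed_subspaceI)
  show "(\<lambda>_. 0) \<in> {f \<in> LL. T f \<in> V}"
    using closed_subspace_AE[OF V closed_subspace_zero[OF V], of "T (\<lambda>_. 0)"] bounded_ops_zero[OF T]
      const_LL[of 0] bounded_ops_LL[OF T const_LL[of 0]] by simp
next
  fix f g and a b :: real assume "f \<in> {f \<in> LL. T f \<in> V}" "g \<in> {f \<in> LL. T f \<in> V}"
  then have fg: "f \<in> LL" "g \<in> LL" "T f \<in> V" "T g \<in> V" by auto
  have "AE \<omega> in M. a * T f \<omega> + b * T g \<omega> = T (\<lambda>\<omega>. a * f \<omega> + b * g \<omega>) \<omega>"
    using bounded_ops_lincomb[OF T fg(1,2), of a b] by eventually_elim simp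
  then have "T (\<lambda>\<omega>. a * f \<omega> + b * g \<omega>) \<in> V"
    by (rule closed_subspace_AE[OF V closed_subspace_lincomb[OF V fg(3,4)] bounded_ops_LL[OF T L2_lincomb[OF fg(1,2)]]])
  then show "(\<lambda>\<omega>. a * f \<omega> + b * g \<omega>) \<in> {f \<in> LL. T f \<in> V}" using L2_lincomb[OF fg(1,2)] by simp
next
  fix f assume f: "f \<in> LL" and ap: "\<And>\<epsilon>. \<epsilon> > 0 \<Longrightarrow> \<exists>g\<in>{f \<in> LL. T f \<in> V}. l2_dist M f g < \<epsilon>"
  obtain K where K: "K > 0" "\<And>f g. f \<in> LL \<Longrightarrow> g \<in> LL \<Longrightarrow> l2_dist M (T f) (T g) \<le> K * l2_dist M f g"
    using bounded_ops_dist[OF T] by blast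
  have "T f \<in> V"
  proof (rule closed_subspace_limit[OF V bounded_ops_LL[OF T f]])
    fix \<epsilon> :: real assume "\<epsilon> > 0"
    then obtain g where g: "g \<in> LL" "T g \<in> V" "l2_dist M f g < \<epsilon> / K"
      using ap[of "\<epsilon> / K"] K(1) by auto
    have "l2_dist M (T f) (T g) \<le> K * l2_dist M f g" by (rule K(2)[OF f g(1)])
    also have "\<dots> < \<epsilon>" using g(3) K(1) by (simp add: field_simps)
    finally show "\<exists>g\<in>V. l2_dist M (T f) g < \<epsilon>" using g(2) by blast
  qed
  then show "f \<in> {f \<in> LL. T f \<in> V}" using f by simp
qed auto

text \<open>The set of functions along which a sequence of conditional expectations converges strongly.\<close>
lemma closed_subspace_convergence:
  assumes z: "\<And>n. z n \<in> subfields M" and x: "x \<in> subfields M"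
  shows "closed_subspace M {f \<in> LL. (\<lambda>n. l2_dist M (cexp M (z n) f) (cexp M x f)) \<longlonglongrightarrow> 0}"
    (is "closed_subspace M ?V")
proof (rule closed_subspaceI)
  have "l2_dist M (cexp M (z n) (\<lambda>_. 0)) (cexp M x (\<lambda>_. 0)) = l2_dist M (\<lambda>_. 0) (\<lambda>_. 0)" for n
    by (intro l2_dist_AE_cong cexp_fixed const_L2 cexp_LL const_LL z x)
  then show "(\<lambda>_. 0) \<in> ?V" using const_LL by simp
next
  fix f g and a b :: real assume fg: "f \<in> ?V" "g \<in> ?V"
  then have L: "f \<in> LL" "g \<in> LL" by auto
  let ?h = "\<lambda>\<omega>. a * f \<omega> + b * g \<omega>"
  have h: "?h \<in> LL" by (rule L2_lincomb[OF L])
  have "l2_dist M (cexp M (z n) ?h) (cexp M x ?h)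
      \<le> \<bar>a\<bar> * l2_dist M (cexp M (z n) f) (cexp M x f) + \<bar>b\<bar> * l2_dist M (cexp M (z n) g) (cexp M x g)" for n
  proof -
    have "l2_dist M (cexp M (z n) ?h) (cexp M x ?h) =
        l2_dist M (\<lambda>\<omega>. a * cexp M (z n) f \<omega> + b * cexp M (z n) g \<omega>) (\<lambda>\<omega>. a * cexp M x f \<omega> + b * cexp M x g \<omega>)"
      by (intro l2_dist_AE_cong cexp_lincomb L2_lincomb cexp_LL z x L h)
    also have "\<dots> \<le> \<bar>a\<bar> * l2_dist M (cexp M (z n) f) (cexp M x f) + \<bar>b\<bar> * l2_dist M (cexp M (z n) g) (cexp M x g)"
      by (intro l2_dist_lincomb cexp_LL z x L)
    finally show ?thesis .
  qed
  moreover have "(\<lambda>n. \<bar>a\<bar> * l2_dist M (cexp M (z n) f) (cexp M x f) + \<bar>b\<bar> * l2_dist M (cexp M (z n) g) (cexp M x g))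
      \<longlonglongrightarrow> \<bar>a\<bar> * 0 + \<bar>b\<bar> * 0"
    using fg by (intro tendsto_intros) auto
  ultimately have "(\<lambda>n. l2_dist M (cexp M (z n) ?h) (cexp M x ?h)) \<longlonglongrightarrow> 0"
    by (intro tendsto_sandwich[of "\<lambda>_. 0" "\<lambda>n. l2_dist M (cexp M (z n) ?h) (cexp M x ?h)" _ _ 0]) auto
  then show "?h \<in> ?V" using h by simp
next
  fix f assume f: "f \<in> LL" and ap: "\<And>\<epsilon>. \<epsilon> > 0 \<Longrightarrow> \<exists>g\<in>?V. l2_dist M f g < \<epsilon>"
  have "(\<lambda>n. l2_dist M (cexp M (z n) f) (cexp M x f)) \<longlonglongrightarrow> 0"
    unfolding tendsto_iff
  proof (intro allI impI)
    fix e :: real assume e: "e > 0"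
    then obtain g where g: "g \<in> ?V" "l2_dist M f g < e / 3" using ap[of "e/3"] by auto
    then have gL: "g \<in> LL" by simp
    have "\<forall>\<^sub>F n in sequentially. dist (l2_dist M (cexp M (z n) g) (cexp M x g)) 0 < e / 3"
      using g(1) e by (intro tendstoD) auto
    then show "\<forall>\<^sub>F n in sequentially. dist (l2_dist M (cexp M (z n) f) (cexp M x f)) 0 < e"
    proof eventually_elim
      case (elim n)
      have "l2_dist M (cexp M (z n) f) (cexp M x f)
          \<le> l2_dist M (cexp M (z n) f) (cexp M (z n) g) + l2_dist M (cexp M (z n) g) (cexp M x f)"
        by (intro l2_dist_triangle cexp_LL z x f gL)
      also have "l2_dist M (cexp M (z n) g) (cexp M x f)
          \<le> l2_dist M (cexp M (z n) g) (cexp M x g) + l2_dist M (cexp M x g) (cexp M x f)"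
        by (intro l2_dist_triangle cexp_LL z x f gL)
      also have "l2_dist M (cexp M (z n) f) (cexp M (z n) g) \<le> l2_dist M f g"
        by (rule cexp_dist_le[OF z f gL])
      also have "l2_dist M (cexp M x g) (cexp M x f) \<le> l2_dist M f g"
        using cexp_dist_le[OF x f gL] by (simp only: l2_dist_commute[of M "cexp M x g"])
      finally show ?case using elim g(2) by simp
    qed
  qed
  then show "f \<in> ?V" using f by simp
qed auto

text \<open>A closed subspace containing the indicators of a generating \<open>\<pi>\<close>-system of \<open>x\<close> contains
  \<open>L2 M x\<close>.\<close>
lemma L2_subset_closed_subspace:
  assumes V: "closed_subspace M V" and x: "x \<in> subfields M"
    and P: "Int_stable P" "x = sigma_sets (space M) P" "space M \<in> P"
    and ind: "\<And>A. A \<in> P \<Longrightarrow> indicat_real A \<in> V"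
  shows "L2 M x \<subseteq> V"
proof -
  have xM: "A \<in> sets M" if "A \<in> x" for A using that subfields_events[OF x] by blast
  have Psub: "P \<subseteq> Pow (space M)"
    using P(2) xM sets.sets_into_space by (metis PowI sigma_sets.Basic subsetI)
  have indx: "indicat_real A \<in> V" if "A \<in> x" for A
    using P(1) Psub that[unfolded P(2)]
  proof (induction rule: sigma_sets_induct_disjoint)
    case (basic A)
    then show ?case by (rule ind)
  next
    case empty
    then show ?case using closed_subspace_zero[OF V] by (simp add: indicator_def)
  next
    case (compl A)
    have "indicat_real (space M - A) \<omega> = indicat_real (space M) \<omega> - indicat_real A \<omega>" for \<omega>
      using compl(1) xM[of A] sets.sets_into_space[of A M] P(2) by (auto simp: indicator_def)
    then have "indicat_real (space M - A) = (\<lambda>\<omega>. indicat_real (space M) \<omega> - indicat_real A \<omega>)" by auto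
    then show ?case using closed_subspace_diff[OF V ind[OF P(3)] compl(2)] by simp
  next
    case (union A)
    define U where "U n = (\<Union>i<n. A i)" for n
    have Am: "A i \<in> sets M" for i using union(2) P(2) xM by auto
    have Um: "U n \<in> sets M" for n unfolding U_def using Am by auto
    have UV: "indicat_real (U n) \<in> V" for n
    proof -
      have "indicat_real (U n) = (\<lambda>\<omega>. \<Sum>i\<in>{..<n}. indicat_real (A i) \<omega>)"
        unfolding U_def using union(1)
        by (intro ext indicator_UN_disjoint) (auto simp: disjoint_family_on_def)
      then show ?thesis using closed_subspace_sum[OF V, of "{..<n}" "\<lambda>i. indicat_real (A i)"] union(3) by simp
    qed
    have inc: "incseq U" unfolding U_def incseq_def by (auto intro: less_le_trans)
    have UU: "(\<Union>n. U n) = (\<Union>i. A i)" unfolding U_def by auto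
    have lim: "(\<lambda>n. prob (U n)) \<longlonglongrightarrow> prob (\<Union>i. A i)"
      using finite_Lim_measure_incseq[of U] Um inc UU by auto
    have dist: "l2_dist M (indicat_real (\<Union>i. A i)) (indicat_real (U n)) = sqrt (prob (\<Union>i. A i) - prob (U n))" for n
    proof -
      have sub: "U n \<subseteq> (\<Union>i. A i)" by (auto simp: U_def)
      have "(norm (indicat_real (\<Union>i. A i) \<omega> - indicat_real (U n) \<omega>))\<^sup>2 = indicat_real ((\<Union>i. A i) - U n) \<omega>" for \<omega>
        using sub by (auto simp: indicator_def)
      then have "l2_dist M (indicat_real (\<Union>i. A i)) (indicat_real (U n)) = sqrt (prob ((\<Union>i. A i) - U n))"
        unfolding l2_dist_def l2_norm_def using Um Am
        by (simp add: Int_absorb2 sets.sets_into_space[THEN subsetD] Diff_subset subset_iff)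
      also have "prob ((\<Union>i. A i) - U n) = prob (\<Union>i. A i) - prob (U n)"
        using Am Um sub by (intro finite_measure_Diff) auto
      finally show ?thesis .
    qed
    show ?case
    proof (rule closed_subspace_limit[OF V indicator_LL])
      show "(\<Union>i. A i) \<in> sets M" using Am by auto
      fix \<epsilon> :: real assume \<epsilon>: "\<epsilon> > 0"
      have "(\<lambda>n. sqrt (prob (\<Union>i. A i) - prob (U n))) \<longlonglongrightarrow> sqrt (prob (\<Union>i. A i) - prob (\<Union>i. A i))"
        by (intro tendsto_intros lim)
      then have "\<forall>\<^sub>F n in sequentially. sqrt (prob (\<Union>i. A i) - prob (U n)) < \<epsilon>"
        using \<epsilon> by (intro order_tendstoD) auto
      then obtain n where "sqrt (prob (\<Union>i. A i) - prob (U n)) < \<epsilon>"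
        by (meson eventually_sequentially order_refl)
      then show "\<exists>g\<in>V. l2_dist M (indicat_real (\<Union>i. A i)) g < \<epsilon>"
        using UV dist by (intro bexI[of _ "indicat_real (U n)"]) auto
    qed
  qed
  \<comment> \<open>Monotone approximation by simple functions handles non-negative functions.  The premise
    \<open>u \<in> LL\<close> is part of the induction because the steps of the approximation are bounded by \<open>u\<close>.\<close>
  have pos: "u \<in> LL \<longrightarrow> u \<in> V" if "u \<in> borel_measurable (sigma (space M) x)" "\<And>\<omega>. 0 \<le> u \<omega>" for u
    using that
  proof (induction rule: borel_measurable_induct_real)
    case (set A)
    then show ?case using indx x by simp
  next
    case (mult u c)
    show ?case
    proof
      assume cu: "(\<lambda>\<omega>. c * u \<omega>) \<in> LL"
      show "(\<lambda>\<omega>. c * u \<omega>) \<in> V"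
      proof (cases "c = 0")
        case True
        then show ?thesis using closed_subspace_zero[OF V] by simp
      next
        case False
        then have "u \<in> LL" using L2_cmult[OF cu, of "1/c"] by simp
        then show ?thesis using mult closed_subspace_cmult[OF V] by blast
      qed
    qed
  next
    case (add u v)
    have m: "w \<in> borel_measurable M" if "w \<in> borel_measurable (sigma (space M) x)" for w :: "'a \<Rightarrow> real"
      using that measurable_from_subalg[OF subalgebra_subfield[OF x]] by blast
    show ?case
    proof
      assume uv: "(\<lambda>\<omega>. v \<omega> + u \<omega>) \<in> LL"
      have "u \<in> LL" "v \<in> LL"
        using add by (auto intro!: LL_bound[OF m uv] simp: abs_of_nonneg add_nonneg_nonneg)
      then show "(\<lambda>\<omega>. v \<omega> + u \<omega>) \<in> V"
        using add closed_subspace_lincomb[OF V, of v u 1 1] by simp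
    qed
  next
    case (seq U)
    show ?case
    proof
      assume u: "u \<in> LL"
      have m: "U i \<in> borel_measurable M" for i
        using seq(1) measurable_from_subalg[OF subalgebra_subfield[OF x]] by blast
      have le: "U i \<omega> \<le> u \<omega>" if "\<omega> \<in> space M" for i \<omega>
        using seq(3) seq(4)[of \<omega>] that
        by (intro incseq_le[of "\<lambda>i. U i \<omega>"]) (auto simp: incseq_def le_fun_def)
      have UL: "U i \<in> LL" for i
        using le seq(2) by (intro LL_bound[OF m u]) (auto simp: abs_of_nonneg intro: order_trans[OF _ abs_ge_self])
      have "(\<lambda>i. \<integral>\<omega>. (u \<omega> - U i \<omega>)\<^sup>2 \<partial>M) \<longlonglongrightarrow> (\<integral>\<omega>. 0 \<partial>M)"
      proof (rule integral_dominated_convergence[where w="\<lambda>\<omega>. (u \<omega>)\<^sup>2"])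
        show "AE \<omega> in M. (\<lambda>i. (u \<omega> - U i \<omega>)\<^sup>2) \<longlonglongrightarrow> 0"
        proof (intro AE_I2)
          fix \<omega> assume "\<omega> \<in> space M"
          then have "(\<lambda>i. U i \<omega>) \<longlonglongrightarrow> u \<omega>" using seq(4)[of \<omega>] by simp
          then have "(\<lambda>i. (u \<omega> - U i \<omega>)\<^sup>2) \<longlonglongrightarrow> (u \<omega> - u \<omega>)\<^sup>2" by (intro tendsto_intros)
          then show "(\<lambda>i. (u \<omega> - U i \<omega>)\<^sup>2) \<longlonglongrightarrow> 0" by simp
        qed
        show "AE \<omega> in M. norm ((u \<omega> - U i \<omega>)\<^sup>2) \<le> (u \<omega>)\<^sup>2" for i
          using le seq(2) by (intro AE_I2) (auto intro!: power_mono)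
      qed (use u m in \<open>auto simp: L2_top_iff\<close>)
      then have "(\<lambda>i. sqrt (\<integral>\<omega>. (u \<omega> - U i \<omega>)\<^sup>2 \<partial>M)) \<longlonglongrightarrow> sqrt 0"
        by (intro tendsto_real_sqrt) simp
      then have lim: "(\<lambda>i. l2_dist M u (U i)) \<longlonglongrightarrow> 0"
        by (simp add: l2_dist_def l2_norm_def)
      show "u \<in> V"
      proof (rule closed_subspace_limit[OF V u])
        fix \<epsilon> :: real assume "\<epsilon> > 0"
        then have "\<forall>\<^sub>F i in sequentially. l2_dist M u (U i) < \<epsilon>" using lim by (intro order_tendstoD)
        then obtain i where "l2_dist M u (U i) < \<epsilon>" by (meson eventually_sequentially order_refl)
        then show "\<exists>g\<in>V. l2_dist M u g < \<epsilon>" using seq(5) UL by blast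
      qed
    qed
  qed
  show ?thesis
  proof
    fix f assume f: "f \<in> L2 M x"
    then have fL: "f \<in> LL" and fm: "f \<in> borel_measurable (sigma (space M) x)"
      using L2_subsetD[OF f x] by (auto simp: L2_def)
    have m: "f \<in> borel_measurable M" using fL by (simp add: L2_top_iff)
    have "(\<lambda>\<omega>. max 0 (f \<omega>)) \<in> V" "(\<lambda>\<omega>. max 0 (- f \<omega>)) \<in> V"
      using fm m by (auto intro!: pos[rule_format] LL_bound[OF _ fL])
    then have "(\<lambda>\<omega>. max 0 (f \<omega>) - max 0 (- f \<omega>)) \<in> V" by (rule closed_subspace_diff[OF V])
    moreover have "(\<lambda>\<omega>. max 0 (f \<omega>) - max 0 (- f \<omega>)) = f" by (auto simp: max_def)
    ultimately show "f \<in> V" by simp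
  qed
qed

lemma L2_subset_closed_subspace_self:
  assumes "closed_subspace M V" "x \<in> subfields M" "\<And>A. A \<in> x \<Longrightarrow> indicat_real A \<in> V"
  shows "L2 M x \<subseteq> V"
proof (rule L2_subset_closed_subspace[OF assms(1,2) _ subfield_sigma_sets[OF assms(2), symmetric] _ assms(3)])
  interpret sigma_algebra "space M" x by (rule subfields_sigma[OF assms(2)])
  show "Int_stable x" by (auto simp: Int_stable_def)
qed (use space_in_subfield[OF assms(2)] in auto)

text \<open>The products of indicators of sets in \<open>x\<close> and in \<open>y\<close> are total in \<open>L2 M (x \<or> y)\<close>.\<close>
lemma L2_join_subset_closed_subspace:
  assumes V: "closed_subspace M V" and x: "x \<in> subfields M" and y: "y \<in> subfields M"
    and ind: "\<And>A C. A \<in> x \<Longrightarrow> C \<in> y \<Longrightarrow> (\<lambda>\<omega>. indicat_real A \<omega> * indicat_real C \<omega>) \<in> V"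
  shows "L2 M (field_join M x y) \<subseteq> V"
proof (rule L2_subset_closed_subspace[OF V join_subfield[OF x y], where P="{A \<inter> C | A C. A \<in> x \<and> C \<in> y}"])
  interpret x: sigma_algebra "space M" x by (rule subfields_sigma[OF x])
  interpret y: sigma_algebra "space M" y by (rule subfields_sigma[OF y])
  have sp: "A \<subseteq> space M" if "A \<in> x \<union> y" for A using that x.space_closed y.space_closed by auto
  show "Int_stable {A \<inter> C | A C. A \<in> x \<and> C \<in> y}"
  proof (rule Int_stableI)
    fix a b assume "a \<in> {A \<inter> C | A C. A \<in> x \<and> C \<in> y}" "b \<in> {A \<inter> C | A C. A \<in> x \<and> C \<in> y}"
    then obtain A C A' C' where *: "a = A \<inter> C" "b = A' \<inter> C'" "A \<in> x" "C \<in> y" "A' \<in> x" "C' \<in> y" by auto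
    then have "a \<inter> b = (A \<inter> A') \<inter> (C \<inter> C')" "A \<inter> A' \<in> x" "C \<inter> C' \<in> y" by auto
    then show "a \<inter> b \<in> {A \<inter> C | A C. A \<in> x \<and> C \<in> y}" by blast
  qed
  show "field_join M x y = sigma_sets (space M) {A \<inter> C | A C. A \<in> x \<and> C \<in> y}"
    unfolding field_join_def
  proof (rule sigma_sets_eqI)
    fix a assume "a \<in> x \<union> y"
    then have "a = a \<inter> space M" "a = space M \<inter> a" using sp[of a] by auto
    with \<open>a \<in> x \<union> y\<close> have "a \<in> {A \<inter> C | A C. A \<in> x \<and> C \<in> y}" using x.top y.top by blast
    then show "a \<in> sigma_sets (space M) {A \<inter> C | A C. A \<in> x \<and> C \<in> y}" by (rule sigma_sets.Basic)
  next
    interpret j: sigma_algebra "space M" "sigma_sets (space M) (x \<union> y)"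
      using sp by (intro sigma_algebra_sigma_sets) auto
    fix b assume "b \<in> {A \<inter> C | A C. A \<in> x \<and> C \<in> y}"
    then show "b \<in> sigma_sets (space M) (x \<union> y)" by auto
  qed
  show "space M \<in> {A \<inter> C | A C. A \<in> x \<and> C \<in> y}" using x.top y.top by blast
  fix a assume "a \<in> {A \<inter> C | A C. A \<in> x \<and> C \<in> y}"
  then obtain A C where a: "a = A \<inter> C" "A \<in> x" "C \<in> y" by auto
  have "indicat_real a = (\<lambda>\<omega>. indicat_real A \<omega> * indicat_real C \<omega>)"
    by (auto simp: a(1) indicator_def)
  then show "indicat_real a \<in> V" using ind[OF a(2,3)] by simp
qed

end


section \<open>Independence\<close>

context prob_space
begin

lemma indep_subset:
  assumes "indep_set u v" "a \<subseteq> u" "b \<subseteq> v" shows "indep_set a b"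
proof (rule indep_setI)
  show "a \<subseteq> events" "b \<subseteq> events"
    using assms indep_setD_ev1[OF assms(1)] indep_setD_ev2[OF assms(1)] by auto
  show "prob (A \<inter> C) = prob A * prob C" if "A \<in> a" "C \<in> b" for A C
    using that assms(2,3) indep_setD[OF assms(1)] by blast
qed

lemma indep_commute:
  assumes "indep_set u v" shows "indep_set v u"
proof (rule indep_setI)
  show "v \<subseteq> events" "u \<subseteq> events" using indep_setD_ev1[OF assms] indep_setD_ev2[OF assms] by auto
  show "prob (A \<inter> C) = prob A * prob C" if "A \<in> v" "C \<in> u" for A C
    using that indep_setD[OF assms, of C A] by (simp add: Int_commute mult.commute)
qed

lemma indep_inter_bot:
  assumes u: "u \<in> subfields M" and v: "v \<in> subfields M" and i: "indep_set u v"
  shows "u \<inter> v = bot_field M"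
proof
  show "bot_field M \<subseteq> u \<inter> v" using subfields_bot u v by auto
  show "u \<inter> v \<subseteq> bot_field M"
  proof
    fix A assume A: "A \<in> u \<inter> v"
    then have "prob A = prob A * prob A" using indep_setD[OF i, of A A] by auto
    then have "prob A = 0 \<or> prob A = 1" by simp
    then show "A \<in> bot_field M" using A subfields_events[OF u] by (auto simp: bot_field_def)
  qed
qed

lemma indep_expectation:
  fixes f g :: "'a \<Rightarrow> real"
  assumes u: "u \<in> subfields M" and v: "v \<in> subfields M" and i: "indep_set u v"
    and f: "f \<in> borel_measurable (sigma (space M) u)" "integrable M f"
    and g: "g \<in> borel_measurable (sigma (space M) v)" "integrable M g"
  shows "integrable M (\<lambda>\<omega>. f \<omega> * g \<omega>)" "expectation (\<lambda>\<omega>. f \<omega> * g \<omega>) = expectation f * expectation g"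
proof -
  have sub: "sigma_sets (space M) {h -` A \<inter> space M | A. A \<in> sets borel} \<subseteq> w"
    if "w \<in> subfields M" "h \<in> borel_measurable (sigma (space M) w)" for w and h :: "'a \<Rightarrow> real"
  proof (rule sigma_algebra.sigma_sets_subset[OF subfields_sigma[OF that(1)]])
    show "{h -` A \<inter> space M | A. A \<in> sets borel} \<subseteq> w"
      using measurable_sets[OF that(2)] that(1) by auto
  qed
  have "indep_var borel f borel g"
    unfolding indep_var_eq using f(2) g(2) indep_subset[OF i sub[OF u f(1)] sub[OF v g(1)]] by auto
  then show "integrable M (\<lambda>\<omega>. f \<omega> * g \<omega>)" "expectation (\<lambda>\<omega>. f \<omega> * g \<omega>) = expectation f * expectation g"
    using f(2) g(2) by (auto intro: indep_var_integrable indep_var_lebesgue_integral)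
qed

lemma indep_mult:
  assumes u: "u \<in> subfields M" and v: "v \<in> subfields M" and i: "indep_set u v"
    and f: "f \<in> L2 M u" and g: "g \<in> L2 M v"
  shows indep_mult_LL: "(\<lambda>\<omega>. f \<omega> * g \<omega>) \<in> LL"
    and indep_mult_expectation: "expectation (\<lambda>\<omega>. f \<omega> * g \<omega>) = expectation f * expectation g"
    and indep_mult_norm: "l2_norm M (\<lambda>\<omega>. f \<omega> * g \<omega>) = l2_norm M f * l2_norm M g"
proof -
  have m: "f \<in> borel_measurable (sigma (space M) u)" "g \<in> borel_measurable (sigma (space M) v)"
    and I: "integrable M (\<lambda>\<omega>. (f \<omega>)\<^sup>2)" "integrable M (\<lambda>\<omega>. (g \<omega>)\<^sup>2)"
    using f g by (auto simp: L2_def)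
  have L: "f \<in> LL" "g \<in> LL" using L2_subsetD f g u v by auto
  show "expectation (\<lambda>\<omega>. f \<omega> * g \<omega>) = expectation f * expectation g"
    by (rule indep_expectation(2)[OF u v i m(1) LL_integrable[OF L(1)] m(2) LL_integrable[OF L(2)]])
  have sq: "(\<lambda>\<omega>. (f \<omega>)\<^sup>2) \<in> borel_measurable (sigma (space M) u)"
    "(\<lambda>\<omega>. (g \<omega>)\<^sup>2) \<in> borel_measurable (sigma (space M) v)"
    using m by auto
  note * = indep_expectation[OF u v i sq(1) I(1) sq(2) I(2)]
  show "(\<lambda>\<omega>. f \<omega> * g \<omega>) \<in> LL"
    using *(1) L by (auto simp: L2_top_iff power_mult_distrib)
  show "l2_norm M (\<lambda>\<omega>. f \<omega> * g \<omega>) = l2_norm M f * l2_norm M g"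
    using *(2) by (simp add: l2_norm_def power_mult_distrib real_sqrt_mult)
qed

lemma L2_join_mult:
  assumes u: "u \<in> subfields M" and v: "v \<in> subfields M" and i: "indep_set u v"
    and f: "f \<in> L2 M u" and g: "g \<in> L2 M v"
  shows "(\<lambda>\<omega>. f \<omega> * g \<omega>) \<in> L2 M (field_join M u v)"
proof -
  note j = join_subfield[OF u v]
  have "f \<in> L2 M (field_join M u v)" "g \<in> L2 M (field_join M u v)"
    using L2_mono[OF u j join_upper(1)] L2_mono[OF v j join_upper(2)] f g by auto
  then show ?thesis using indep_mult_LL[OF assms] by (auto simp: L2_def)
qed

lemma indep_mult_dist:
  assumes u: "u \<in> subfields M" and v: "v \<in> subfields M" and i: "indep_set u v"
    and f: "f \<in> L2 M u" "f' \<in> L2 M u" and g: "g \<in> L2 M v" "g' \<in> L2 M v"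
  shows "l2_dist M (\<lambda>\<omega>. f \<omega> * g \<omega>) (\<lambda>\<omega>. f' \<omega> * g' \<omega>)
    \<le> l2_dist M f f' * l2_norm M g + l2_norm M f' * l2_dist M g g'"
proof -
  have d: "(\<lambda>\<omega>. f \<omega> - f' \<omega>) \<in> L2 M u" "(\<lambda>\<omega>. g \<omega> - g' \<omega>) \<in> L2 M v"
    using closed_subspace_diff[OF closed_subspace_L2M] u v f g by auto
  have "l2_dist M (\<lambda>\<omega>. f \<omega> * g \<omega>) (\<lambda>\<omega>. f' \<omega> * g' \<omega>)
      \<le> l2_dist M (\<lambda>\<omega>. f \<omega> * g \<omega>) (\<lambda>\<omega>. f' \<omega> * g \<omega>) + l2_dist M (\<lambda>\<omega>. f' \<omega> * g \<omega>) (\<lambda>\<omega>. f' \<omega> * g' \<omega>)"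
    by (intro l2_dist_triangle indep_mult_LL[OF u v i] f g)
  also have "l2_dist M (\<lambda>\<omega>. f \<omega> * g \<omega>) (\<lambda>\<omega>. f' \<omega> * g \<omega>) = l2_dist M f f' * l2_norm M g"
    using indep_mult_norm[OF u v i d(1) g(1)] by (simp add: l2_dist_def left_diff_distrib)
  also have "l2_dist M (\<lambda>\<omega>. f' \<omega> * g \<omega>) (\<lambda>\<omega>. f' \<omega> * g' \<omega>) = l2_norm M f' * l2_dist M g g'"
    using indep_mult_norm[OF u v i f(2) d(2)] by (simp add: l2_dist_def right_diff_distrib)
  finally show ?thesis .
qed

text \<open>On the tensor product \<open>L2 M u \<otimes> L2 M v\<close> of independent \<open>\<sigma>\<close>-fields, the conditional expectation
  given \<open>a \<or> b\<close>, where \<open>a \<subseteq> u\<close> and \<open>b \<subseteq> v\<close>, is a tensor product.\<close>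
lemma cexp_join_mult:
  assumes u: "u \<in> subfields M" and v: "v \<in> subfields M" and i: "indep_set u v"
    and a: "a \<in> subfields M" "a \<subseteq> u" and b: "b \<in> subfields M" "b \<subseteq> v"
    and f: "f \<in> L2 M u" and g: "g \<in> L2 M v"
  shows "AE \<omega> in M. cexp M (field_join M a b) (\<lambda>\<omega>. f \<omega> * g \<omega>) \<omega> = cexp M a f \<omega> * cexp M b g \<omega>"
proof (rule cexp_eqI)
  have fL: "f \<in> LL" "g \<in> LL" using L2_subsetD f g u v by auto
  have pf: "cexp M a f \<in> L2 M a" "cexp M b g \<in> L2 M b" by (intro cexp_L2 a b fL)+
  have iab: "indep_set a b" by (rule indep_subset[OF i a(2) b(2)])
  show j: "field_join M a b \<in> subfields M" by (rule join_subfield[OF a(1) b(1)])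
  show fg: "(\<lambda>\<omega>. f \<omega> * g \<omega>) \<in> LL" by (rule indep_mult_LL[OF u v i f g])
  show p: "(\<lambda>\<omega>. cexp M a f \<omega> * cexp M b g \<omega>) \<in> L2 M (field_join M a b)"
    by (rule L2_join_mult[OF a(1) b(1) iab pf])
  note pL = L2_subsetD[OF p j]
  let ?d = "\<lambda>\<omega>. f \<omega> * g \<omega> - cexp M a f \<omega> * cexp M b g \<omega>"
  have d: "?d \<in> LL" by (rule L2_diff[OF fg pL])
  have "L2 M (field_join M a b) \<subseteq> {h \<in> LL. l2_inner M ?d h = 0}"
  proof (rule L2_join_subset_closed_subspace[OF closed_subspace_orth[OF d] a(1) b(1)])
    fix A C assume A: "A \<in> a" and C: "C \<in> b"
    have ind: "indicat_real A \<in> L2 M a" "indicat_real C \<in> L2 M b"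
      using indicator_L2 a b A C by auto
    have h: "(\<lambda>\<omega>. indicat_real A \<omega> * indicat_real C \<omega>) \<in> LL"
      by (rule indep_mult_LL[OF a(1) b(1) iab ind])
    have *: "l2_inner M (\<lambda>\<omega>. f' \<omega> * g' \<omega>) (\<lambda>\<omega>. indicat_real A \<omega> * indicat_real C \<omega>)
        = l2_inner M f' (indicat_real A) * l2_inner M g' (indicat_real C)"
      if "f' \<in> L2 M u" "g' \<in> L2 M v" for f' g'
    proof -
      have "A \<in> u" "C \<in> v" using A C a b by auto
      then have "expectation (\<lambda>\<omega>. (f' \<omega> * indicat_real A \<omega>) * (g' \<omega> * indicat_real C \<omega>))
          = expectation (\<lambda>\<omega>. f' \<omega> * indicat_real A \<omega>) * expectation (\<lambda>\<omega>. g' \<omega> * indicat_real C \<omega>)"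
        using that by (intro indep_mult_expectation[OF u v i] mult_indicator_L2 u v) auto
      then show ?thesis by (simp add: l2_inner_real ac_simps)
    qed
    have "cexp M a f \<in> L2 M u" "cexp M b g \<in> L2 M v"
      using pf L2_mono[OF a(1) u a(2)] L2_mono[OF b(1) v b(2)] by auto
    then have "l2_inner M ?d (\<lambda>\<omega>. indicat_real A \<omega> * indicat_real C \<omega>) = 0"
      using l2_inner_diff_left[OF fg pL h] *[OF f g] *[of "cexp M a f" "cexp M b g"]
        cexp_inner[OF a(1) fL(1) ind(1)] cexp_inner[OF b(1) fL(2) ind(2)] by simp
    then show "(\<lambda>\<omega>. indicat_real A \<omega> * indicat_real C \<omega>) \<in> {h \<in> LL. l2_inner M ?d h = 0}"
      using h by simp
  qed
  then show "l2_inner M (\<lambda>\<omega>. f \<omega> * g \<omega>) h = l2_inner M (\<lambda>\<omega>. cexp M a f \<omega> * cexp M b g \<omega>) h"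
    if "h \<in> L2 M (field_join M a b)" for h
    using that l2_inner_diff_left[OF fg pL, of h] by auto
qed

lemma L2_bot_const:
  assumes f: "f \<in> L2 M (bot_field M)" shows "AE \<omega> in M. f \<omega> = expectation f"
proof -
  \<comment> \<open>The trivial \<open>\<sigma>\<close>-field is independent of itself, so its elements have variance zero.\<close>
  have i: "indep_set (bot_field M) (bot_field M)"
  proof (rule indep_setI)
    show "bot_field M \<subseteq> events" by (auto simp: bot_field_def)
    then show "bot_field M \<subseteq> events" .
    fix A C assume AC: "A \<in> bot_field M" "C \<in> bot_field M"
    then have m: "A \<in> events" "C \<in> events" by (auto simp: bot_field_def)
    consider "prob A = 0" | "prob C = 0" | "prob A = 1" "prob C = 1" using AC by (auto simp: bot_field_def)
    then show "prob (A \<inter> C) = prob A * prob C"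
    proof cases
      case 1
      have "prob (A \<inter> C) \<le> prob A" using m by (intro finite_measure_mono) auto
      then show ?thesis using 1 measure_nonneg[of M "A \<inter> C"] by simp
    next
      case 2
      have "prob (A \<inter> C) \<le> prob C" using m by (intro finite_measure_mono) auto
      then show ?thesis using 2 measure_nonneg[of M "A \<inter> C"] by simp
    next
      case 3
      then have "AE \<omega> in M. \<omega> \<in> A" "AE \<omega> in M. \<omega> \<in> C" using m by (auto simp: prob_eq_1)
      then have "AE \<omega> in M. \<omega> \<in> A \<inter> C" by eventually_elim simp
      then have "prob (A \<inter> C) = 1" using m by (subst prob_eq_1) auto
      then show ?thesis using 3 by simp
    qed
  qed
  let ?g = "\<lambda>\<omega>. f \<omega> - expectation f"
  have g: "?g \<in> L2 M (bot_field M)"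
    using closed_subspace_diff[OF closed_subspace_L2M[OF bot_subfield] f const_L2[OF bot_subfield]] .
  have "expectation ?g = 0"
    using LL_integrable[OF L2_subsetD[OF f bot_subfield]] by (simp add: prob_space)
  then have "l2_inner M ?g ?g = 0"
    using indep_mult_expectation[OF bot_subfield bot_subfield i g g] by (simp add: l2_inner_real)
  then have "AE \<omega> in M. ?g \<omega> = 0" by (rule l2_orth_self_zero[OF L2_subsetD[OF g bot_subfield]])
  then show ?thesis by simp
qed

lemma cexp_bot:
  assumes f: "f \<in> LL" shows "AE \<omega> in M. cexp M (bot_field M) f \<omega> = expectation f"
proof -
  have "expectation (cexp M (bot_field M) f) = expectation f"
    using cexp_inner[OF bot_subfield f const_L2[OF bot_subfield, of 1]] by (simp add: l2_inner_real)
  then show ?thesis using L2_bot_const[OF cexp_L2[OF bot_subfield f]] by simp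
qed

lemma cexp_indep_mult:
  assumes u: "u \<in> subfields M" and v: "v \<in> subfields M" and i: "indep_set u v"
    and f: "f \<in> L2 M u" and g: "g \<in> L2 M v"
  shows "AE \<omega> in M. cexp M u (\<lambda>\<omega>. f \<omega> * g \<omega>) \<omega> = expectation g * f \<omega>"
proof -
  have j: "field_join M u (bot_field M) = u"
    using join_absorb[OF u subfields_bot[OF u]] by (simp add: join_commute)
  show ?thesis
    using cexp_join_mult[OF u v i u order_refl bot_subfield subfields_bot[OF v] f g]
      cexp_fixed[OF u f] cexp_bot[OF L2_subsetD[OF g v]]
    unfolding j by eventually_elim simp
qed

lemma cexp_indep:
  assumes u: "u \<in> subfields M" and v: "v \<in> subfields M" and i: "indep_set u v" and g: "g \<in> L2 M v"
  shows "AE \<omega> in M. cexp M u g \<omega> = expectation g"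
  using cexp_indep_mult[OF u v i const_L2[OF u, of 1] g] by simp

text \<open>The \<open>\<sigma>\<close>-field \<open>w\<close> is compatible with the independent pair \<open>u\<close>, \<open>v\<close>: conditional
  expectation given \<open>w\<close> is multiplicative on \<open>L2 M u \<times> L2 M v\<close>.\<close>
definition splits :: "'a set set \<Rightarrow> 'a set set \<Rightarrow> 'a set set \<Rightarrow> bool" where
  "splits w u v \<longleftrightarrow> (\<forall>f\<in>L2 M u. \<forall>g\<in>L2 M v.
     AE \<omega> in M. cexp M w (\<lambda>\<omega>. f \<omega> * g \<omega>) \<omega> = cexp M w f \<omega> * cexp M w g \<omega>)"

lemma splitsD:
  assumes "splits w u v" "f \<in> L2 M u" "g \<in> L2 M v"
  shows "AE \<omega> in M. cexp M w (\<lambda>\<omega>. f \<omega> * g \<omega>) \<omega> = cexp M w f \<omega> * cexp M w g \<omega>"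
  using assms by (auto simp: splits_def)

lemma cexp_join_left:
  assumes u: "u \<in> subfields M" and v: "v \<in> subfields M" and i: "indep_set u v"
    and a: "a \<in> subfields M" "a \<subseteq> u" and b: "b \<in> subfields M" "b \<subseteq> v" and f: "f \<in> L2 M u"
  shows "AE \<omega> in M. cexp M (field_join M a b) f \<omega> = cexp M a f \<omega>"
  using cexp_join_mult[OF assms const_L2[OF v, of 1]] cexp_fixed[OF b(1) const_L2[OF b(1), of 1]]
  by (auto elim: eventually_elim2)

lemma splits_join:
  assumes u: "u \<in> subfields M" and v: "v \<in> subfields M" and i: "indep_set u v"
    and a: "a \<in> subfields M" "a \<subseteq> u" and b: "b \<in> subfields M" "b \<subseteq> v"
  shows "splits (field_join M a b) u v"
  unfolding splits_def
proof (intro ballI)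
  fix f g assume f: "f \<in> L2 M u" and g: "g \<in> L2 M v"
  have "AE \<omega> in M. cexp M (field_join M a b) g \<omega> = cexp M b g \<omega>"
    unfolding join_commute[of a] by (rule cexp_join_left[OF v u indep_commute[OF i] b a g])
  with cexp_join_left[OF assms f] cexp_join_mult[OF assms f g]
  show "AE \<omega> in M. cexp M (field_join M a b) (\<lambda>\<omega>. f \<omega> * g \<omega>) \<omega>
      = cexp M (field_join M a b) f \<omega> * cexp M (field_join M a b) g \<omega>"
    by eventually_elim simp
qed

lemma indep_complementD:
  assumes "indep_complement M u v"
  shows "indep_set u v" "field_join M u v = sets M"
  using assms by (auto simp: indep_complement_def)

lemma indep_complement_commute: "indep_complement M u v \<Longrightarrow> indep_complement M v u"
  by (auto simp: indep_complement_def join_commute indep_commute)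


section \<open>Strong convergence and the closure of a family of \<open>\<sigma>\<close>-fields\<close>

text \<open>Strong operator convergence of the conditional expectations given \<open>z n\<close> to that given \<open>x\<close>.\<close>
definition strong_conv :: "(nat \<Rightarrow> 'a set set) \<Rightarrow> 'a set set \<Rightarrow> bool" where
  "strong_conv z x \<longleftrightarrow> (\<forall>f\<in>LL. (\<lambda>n. l2_dist M (cexp M (z n) f) (cexp M x f)) \<longlonglongrightarrow> 0)"

lemma strong_convD: "strong_conv z x \<Longrightarrow> f \<in> LL \<Longrightarrow> (\<lambda>n. l2_dist M (cexp M (z n) f) (cexp M x f)) \<longlonglongrightarrow> 0"
  by (simp add: strong_conv_def)

lemma tendsto_zero_bound:
  fixes f g :: "nat \<Rightarrow> real"
  assumes "\<And>n. 0 \<le> f n" "\<And>n. f n \<le> g n" "g \<longlonglongrightarrow> 0" shows "f \<longlonglongrightarrow> 0"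
  using assms by (intro tendsto_sandwich[of "\<lambda>_. 0" f _ g 0]) auto

lemma strong_conv_apply:
  assumes z: "\<And>n. z n \<in> subfields M" and x: "x \<in> subfields M" and c: "strong_conv z x"
    and f: "\<And>n. f n \<in> LL" "f' \<in> LL" "(\<lambda>n. l2_dist M (f n) f') \<longlonglongrightarrow> 0"
  shows "(\<lambda>n. l2_dist M (cexp M (z n) (f n)) (cexp M x f')) \<longlonglongrightarrow> 0"
proof (rule tendsto_zero_bound)
  show "l2_dist M (cexp M (z n) (f n)) (cexp M x f')
      \<le> l2_dist M (f n) f' + l2_dist M (cexp M (z n) f') (cexp M x f')" for n
    using l2_dist_triangle[OF cexp_LL[OF z f(1)] cexp_LL[OF z f(2)] cexp_LL[OF x f(2)], of n n n]
      cexp_dist_le[OF z f(1) f(2), of n n] by simp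
  show "(\<lambda>n. l2_dist M (f n) f' + l2_dist M (cexp M (z n) f') (cexp M x f')) \<longlonglongrightarrow> 0"
    using tendsto_add[OF f(3) strong_convD[OF c f(2)]] by simp
qed simp

lemma l2_limit_unique:
  assumes f: "\<And>n. f n \<in> LL" "g \<in> LL" "h \<in> LL"
    and "(\<lambda>n. l2_dist M (f n) g) \<longlonglongrightarrow> 0" "(\<lambda>n. l2_dist M (f n) h) \<longlonglongrightarrow> 0"
  shows "AE \<omega> in M. g \<omega> = h \<omega>"
proof -
  have "l2_dist M g h \<le> l2_dist M (f n) g + l2_dist M (f n) h" for n
    using l2_dist_triangle[OF f(2) f(1) f(3), of n] by (simp add: l2_dist_commute[of M g])
  moreover have "(\<lambda>n. l2_dist M (f n) g + l2_dist M (f n) h) \<longlonglongrightarrow> 0 + 0" by (intro tendsto_add assms)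
  ultimately have "l2_dist M g h \<le> 0 + 0" by (intro LIMSEQ_le_const) auto
  then have "l2_dist M g h = 0" using l2_dist_nonneg[of M g h] by linarith
  then show ?thesis using l2_dist_zero_iff[OF f(2,3)] by simp
qed

text \<open>Strong convergence need only be tested on products of indicators from a generating pair.\<close>
lemma strong_conv_total:
  assumes z: "\<And>n. z n \<in> subfields M" and x: "x \<in> subfields M"
    and u: "u \<in> subfields M" and v: "v \<in> subfields M" and j: "field_join M u v = sets M"
    and lim: "\<And>A C. A \<in> u \<Longrightarrow> C \<in> v \<Longrightarrow>
      (\<lambda>n. l2_dist M (cexp M (z n) (\<lambda>\<omega>. indicat_real A \<omega> * indicat_real C \<omega>))
        (cexp M x (\<lambda>\<omega>. indicat_real A \<omega> * indicat_real C \<omega>))) \<longlonglongrightarrow> 0"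
  shows "strong_conv z x"
proof -
  have "L2 M (field_join M u v) \<subseteq> {f \<in> LL. (\<lambda>n. l2_dist M (cexp M (z n) f) (cexp M x f)) \<longlonglongrightarrow> 0}"
  proof (rule L2_join_subset_closed_subspace[OF closed_subspace_convergence[OF z x] u v])
    fix A C assume AC: "A \<in> u" "C \<in> v"
    have "(\<lambda>\<omega>. indicat_real A \<omega> * indicat_real C \<omega>) \<in> LL"
      using AC subfields_events[OF u] subfields_events[OF v]
      by (intro mult_indicator_LL indicator_LL) auto
    then show "(\<lambda>\<omega>. indicat_real A \<omega> * indicat_real C \<omega>)
        \<in> {f \<in> LL. (\<lambda>n. l2_dist M (cexp M (z n) f) (cexp M x f)) \<longlonglongrightarrow> 0}"
      using lim[OF AC] by simp
  qed
  then show ?thesis unfolding j strong_conv_def by blast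
qed

lemma topspace_subfield_topology: "topspace (subfield_topology M) = subfields M"
proof
  show "topspace (subfield_topology M) \<subseteq> subfields M"
    unfolding subfield_topology_def topology_generated_by_topspace by blast
  show "subfields M \<subseteq> topspace (subfield_topology M)"
  proof
    fix x assume x: "x \<in> subfields M"
    let ?U = "{y \<in> subfields M. l2_norm M (\<lambda>\<omega>. cexp M y (\<lambda>_. 0) \<omega> - cexp M x (\<lambda>_. 0) \<omega>) < 1}"
    have "openin (subfield_topology M) ?U"
      unfolding subfield_topology_def
      by (rule topology_generated_by_Basis)
        (rule CollectI, intro exI[of _ x] exI[of _ "\<lambda>_. 0"] exI[of _ "1::real"] conjI refl x const_LL zero_less_one)
    moreover have "x \<in> ?U"
      using x l2_dist_self[of M "cexp M x (\<lambda>_. 0)"] by (simp add: l2_dist_def del: l2_dist_self)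
    ultimately show "x \<in> topspace (subfield_topology M)" using openin_subset by blast
  qed
qed

text \<open>A neighbourhood base of \<open>x\<close> is given by finitely many test functions and a tolerance.\<close>
lemma openin_subfield_topology_base:
  assumes "openin (subfield_topology M) U" "x \<in> U"
  obtains G \<epsilon> where "finite G" "G \<subseteq> LL" "\<epsilon> > 0"
    "{y \<in> subfields M. \<forall>f\<in>G. l2_dist M (cexp M y f) (cexp M x f) < \<epsilon>} \<subseteq> U"
proof -
  define N where "N G \<epsilon> x = {y \<in> subfields M. \<forall>f\<in>G. l2_dist M (cexp M y f) (cexp M x f) < \<epsilon>}"
    for G x and \<epsilon> :: real
  have mono: "N (G \<union> G') (min \<epsilon> \<epsilon>') x \<subseteq> N G \<epsilon> x \<inter> N G' \<epsilon>' x" for G G' \<epsilon> \<epsilon>' x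
    by (auto simp: N_def)
  let ?S = "{{y \<in> subfields M. l2_norm M (\<lambda>\<omega>. cexp M y f \<omega> - cexp M x f \<omega>) < \<epsilon>} | x f \<epsilon>.
        x \<in> subfields M \<and> f \<in> LL \<and> \<epsilon> > 0}"
  have "generate_topology_on ?S U"
    using assms(1) unfolding subfield_topology_def openin_topology_generated_by_iff .
  then have "\<forall>x\<in>U. \<exists>G \<epsilon>. finite G \<and> G \<subseteq> LL \<and> \<epsilon> > 0 \<and> N G \<epsilon> x \<subseteq> U"
  proof (induction rule: generate_topology_on.induct)
    case (Int a b)
    show ?case
    proof
      fix x assume x: "x \<in> a \<inter> b"
      obtain G \<epsilon> where G: "finite G" "G \<subseteq> LL" "\<epsilon> > 0" "N G \<epsilon> x \<subseteq> a" using Int.IH(1) x by (meson IntD1)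
      obtain G' \<epsilon>' where G': "finite G'" "G' \<subseteq> LL" "\<epsilon>' > 0" "N G' \<epsilon>' x \<subseteq> b"
        using Int.IH(2) x by (meson IntD2)
      have "N (G \<union> G') (min \<epsilon> \<epsilon>') x \<subseteq> a \<inter> b" using mono[of G G' \<epsilon> \<epsilon>' x] G(4) G'(4) by blast
      then show "\<exists>G \<epsilon>. finite G \<and> G \<subseteq> LL \<and> \<epsilon> > 0 \<and> N G \<epsilon> x \<subseteq> a \<inter> b"
        using G G' by (intro exI[of _ "G \<union> G'"] exI[of _ "min \<epsilon> \<epsilon>'"]) simp
    qed
  next
    case (UN K)
    show ?case
    proof
      fix x assume "x \<in> \<Union>K"
      then obtain k where k: "k \<in> K" "x \<in> k" by blast
      then obtain G \<epsilon> where G: "finite G" "G \<subseteq> LL" "\<epsilon> > 0" "N G \<epsilon> x \<subseteq> k" using UN.IH by meson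
      then have "N G \<epsilon> x \<subseteq> \<Union>K" using k by blast
      then show "\<exists>G \<epsilon>. finite G \<and> G \<subseteq> LL \<and> \<epsilon> > 0 \<and> N G \<epsilon> x \<subseteq> \<Union>K" using G by meson
    qed
  next
    case (Basis s)
    then obtain x0 f e where s': "s = {y \<in> subfields M. l2_norm M (\<lambda>\<omega>. cexp M y f \<omega> - cexp M x0 f \<omega>) < e}"
      and s0: "x0 \<in> subfields M" "f \<in> LL" "e > 0" by (elim CollectE exE conjE) (rule that; assumption)
    note s = s'[folded l2_dist_def] s0
    show ?case
    proof
      fix x assume "x \<in> s"
      then have x: "x \<in> subfields M" "l2_dist M (cexp M x f) (cexp M x0 f) < e" using s(1) by auto
      have "N {f} (e - l2_dist M (cexp M x f) (cexp M x0 f)) x \<subseteq> s"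
      proof
        fix y assume "y \<in> N {f} (e - l2_dist M (cexp M x f) (cexp M x0 f)) x"
        then have y: "y \<in> subfields M" "l2_dist M (cexp M y f) (cexp M x f) < e - l2_dist M (cexp M x f) (cexp M x0 f)"
          by (auto simp: N_def)
        have "l2_dist M (cexp M y f) (cexp M x0 f) \<le> l2_dist M (cexp M y f) (cexp M x f) + l2_dist M (cexp M x f) (cexp M x0 f)"
          by (intro l2_dist_triangle cexp_LL y x s)
        then show "y \<in> s" using y s(1) by auto
      qed
      then show "\<exists>G \<epsilon>. finite G \<and> G \<subseteq> LL \<and> \<epsilon> > 0 \<and> N G \<epsilon> x \<subseteq> s"
        using x s(3) by (intro exI[of _ "{f}"] exI[of _ "e - l2_dist M (cexp M x f) (cexp M x0 f)"]) simp
    qed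
  qed simp
  then obtain G \<epsilon> where "finite G" "G \<subseteq> LL" "\<epsilon> > 0" "N G \<epsilon> x \<subseteq> U" using assms(2) by meson
  then show ?thesis using that unfolding N_def by simp
qed

lemma Cl_iff:
  assumes B: "B \<subseteq> subfields M"
  shows "x \<in> Cl M B \<longleftrightarrow> x \<in> subfields M \<and>
    (\<forall>G \<epsilon>. finite G \<and> G \<subseteq> LL \<and> \<epsilon> > 0 \<longrightarrow> (\<exists>y\<in>B. \<forall>f\<in>G. l2_dist M (cexp M y f) (cexp M x f) < \<epsilon>))"
proof (intro iffI conjI allI impI)
  assume x: "x \<in> Cl M B"
  then show xs: "x \<in> subfields M"
    unfolding Cl_def using closure_of_subset_topspace[of "subfield_topology M"] topspace_subfield_topology by blast
  fix G and \<epsilon> :: real assume G: "finite G \<and> G \<subseteq> LL \<and> \<epsilon> > 0"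
  have op: "openin (subfield_topology M) {y \<in> subfields M. l2_dist M (cexp M y f) (cexp M x f) < \<epsilon>}" if "f \<in> G" for f
    unfolding subfield_topology_def l2_dist_def
    using that G xs by (intro topology_generated_by_Basis) blast
  have "openin (subfield_topology M) (\<Inter>f\<in>G. {y \<in> subfields M. l2_dist M (cexp M y f) (cexp M x f) < \<epsilon>})"
    if "G \<noteq> {}"
    using op G that by (intro openin_Inter) auto
  moreover have "x \<in> (\<Inter>f\<in>G. {y \<in> subfields M. l2_dist M (cexp M y f) (cexp M x f) < \<epsilon>})"
    using xs G by auto
  ultimately have "\<exists>y\<in>B. y \<in> (\<Inter>f\<in>G. {y \<in> subfields M. l2_dist M (cexp M y f) (cexp M x f) < \<epsilon>})" if "G \<noteq> {}"
    using x that unfolding Cl_def in_closure_of by blast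
  moreover have "B \<noteq> {}" using x by (auto simp: Cl_def)
  ultimately show "\<exists>y\<in>B. \<forall>f\<in>G. l2_dist M (cexp M y f) (cexp M x f) < \<epsilon>"
    by (cases "G = {}") auto
next
  assume x: "x \<in> subfields M \<and>
    (\<forall>G \<epsilon>. finite G \<and> G \<subseteq> LL \<and> \<epsilon> > 0 \<longrightarrow> (\<exists>y\<in>B. \<forall>f\<in>G. l2_dist M (cexp M y f) (cexp M x f) < \<epsilon>))"
  show "x \<in> Cl M B"
    unfolding Cl_def in_closure_of
  proof (intro conjI allI impI)
    show "x \<in> topspace (subfield_topology M)" using x topspace_subfield_topology by simp
    fix U assume U: "x \<in> U \<and> openin (subfield_topology M) U"
    obtain G \<epsilon> where G: "finite G" "G \<subseteq> LL" "\<epsilon> > 0"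
      "{y \<in> subfields M. \<forall>f\<in>G. l2_dist M (cexp M y f) (cexp M x f) < \<epsilon>} \<subseteq> U"
      using openin_subfield_topology_base[of U x] U by blast
    then obtain y where y: "y \<in> B" "\<forall>f\<in>G. l2_dist M (cexp M y f) (cexp M x f) < \<epsilon>" using x by blast
    then have "y \<in> U" using G(4) B by blast
    then show "\<exists>y. y \<in> B \<and> y \<in> U" using y by blast
  qed
qed

lemma Cl_subfield: "B \<subseteq> subfields M \<Longrightarrow> x \<in> Cl M B \<Longrightarrow> x \<in> subfields M"
  using Cl_iff by blast

lemma subset_Cl: "B \<subseteq> subfields M \<Longrightarrow> B \<subseteq> Cl M B"
  unfolding Cl_def by (rule closure_of_subset) (simp add: topspace_subfield_topology)

text \<open>The closure contains every \<open>\<sigma>\<close>-field that is approximated by elements of the closure.\<close>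
lemma Cl_I:
  assumes B: "B \<subseteq> subfields M" and x: "x \<in> subfields M"
    and ap: "\<And>G \<epsilon>. finite G \<Longrightarrow> G \<subseteq> LL \<Longrightarrow> \<epsilon> > 0 \<Longrightarrow> \<exists>z\<in>Cl M B. \<forall>f\<in>G. l2_dist M (cexp M z f) (cexp M x f) < \<epsilon>"
  shows "x \<in> Cl M B"
  unfolding Cl_iff[OF B]
proof (intro conjI x allI impI)
  fix G and \<epsilon> :: real assume G: "finite G \<and> G \<subseteq> LL \<and> \<epsilon> > 0"
  then obtain z where z: "z \<in> Cl M B" "\<And>f. f \<in> G \<Longrightarrow> l2_dist M (cexp M z f) (cexp M x f) < \<epsilon> / 2"
    using ap[of G "\<epsilon>/2"] by auto
  then obtain y where y: "y \<in> B" "\<And>f. f \<in> G \<Longrightarrow> l2_dist M (cexp M y f) (cexp M z f) < \<epsilon> / 2"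
    using G unfolding Cl_iff[OF B] by (metis half_gt_zero)
  have "l2_dist M (cexp M y f) (cexp M x f) < \<epsilon>" if f: "f \<in> G" for f
  proof -
    have "l2_dist M (cexp M y f) (cexp M x f) \<le> l2_dist M (cexp M y f) (cexp M z f) + l2_dist M (cexp M z f) (cexp M x f)"
      using f G y(1) B Cl_subfield[OF B z(1)] x by (intro l2_dist_triangle cexp_LL) auto
    then show ?thesis using y(2)[OF f] z(2)[OF f] by simp
  qed
  then show "\<exists>y\<in>B. \<forall>f\<in>G. l2_dist M (cexp M y f) (cexp M x f) < \<epsilon>" using y(1) by blast
qed

lemma Cl_limit:
  assumes B: "B \<subseteq> subfields M" and z: "\<And>n. z n \<in> Cl M B" and x: "x \<in> subfields M" and c: "strong_conv z x"
  shows "x \<in> Cl M B"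
proof (rule Cl_I[OF B x])
  fix G and \<epsilon> :: real assume G: "finite G" "G \<subseteq> LL" "\<epsilon> > 0"
  have "\<forall>f\<in>G. \<forall>\<^sub>F n in sequentially. l2_dist M (cexp M (z n) f) (cexp M x f) < \<epsilon>"
    using G strong_convD[OF c] by (auto intro!: order_tendstoD)
  then have "\<forall>\<^sub>F n in sequentially. \<forall>f\<in>G. l2_dist M (cexp M (z n) f) (cexp M x f) < \<epsilon>"
    using G(1) by (simp add: eventually_ball_finite)
  then obtain n where "\<forall>f\<in>G. l2_dist M (cexp M (z n) f) (cexp M x f) < \<epsilon>"
    using eventually_happens'[OF sequentially_bot] by blast
  then show "\<exists>z\<in>Cl M B. \<forall>f\<in>G. l2_dist M (cexp M z f) (cexp M x f) < \<epsilon>" using z by blast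
qed

text \<open>Essential separability yields a countable total set of indicators.\<close>
lemma separable_total:
  assumes "essentially_separable M"
  obtains e :: "nat \<Rightarrow> 'a \<Rightarrow> real" where "range e \<subseteq> LL"
    "\<And>V. closed_subspace M V \<Longrightarrow> range e \<subseteq> V \<Longrightarrow> LL \<subseteq> V"
proof -
  obtain C where C: "countable C" "C \<subseteq> sets M" "sets M = sigma_sets (space M) (C \<union> null_sets M)"
    using assms by (auto simp: essentially_separable_def)
  \<comment> \<open>\<open>D\<close> consists of the finite intersections of elements of \<open>C\<close>; together with the null sets it
    is a \<open>\<pi>\<close>-system.\<close>
  define D where "D = (\<lambda>F. space M \<inter> \<Inter>F) ` {F. finite F \<and> F \<subseteq> C}"
  have cD: "countable D" unfolding D_def
    using countable_Collect_finite_subset[OF C(1)] by (intro countable_image)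
  have sD: "space M \<in> D" unfolding D_def by (auto intro!: image_eqI[of _ _ "{}"])
  have DM: "D \<subseteq> sets M"
  proof
    fix d assume "d \<in> D"
    then obtain F where F: "d = space M \<inter> \<Inter>F" "finite F" "F \<subseteq> C" by (auto simp: D_def)
    show "d \<in> sets M" unfolding F(1) using F(2,3)
    proof (induction F)
      case (insert c F)
      have "space M \<inter> \<Inter>(insert c F) = c \<inter> (space M \<inter> \<Inter>F)" by auto
      then show ?case using insert C(2) by auto
    qed simp
  qed
  have DI: "a \<inter> b \<in> D" if "a \<in> D" "b \<in> D" for a b
  proof -
    obtain F F' where "a = space M \<inter> \<Inter>F" "finite F" "F \<subseteq> C" "b = space M \<inter> \<Inter>F'" "finite F'" "F' \<subseteq> C"
      using \<open>a \<in> D\<close> \<open>b \<in> D\<close> by (auto simp: D_def)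
    then show ?thesis unfolding D_def by (intro image_eqI[of _ _ "F \<union> F'"]) auto
  qed
  define e where "e n = indicat_real (from_nat_into D n)" for n
  have re: "range e = indicat_real ` D"
    unfolding e_def using range_from_nat_into[OF _ cD] sD by (metis empty_iff image_image)
  show ?thesis
  proof (rule that[of e])
    show "range e \<subseteq> LL" unfolding re using DM indicator_LL by auto
    fix V assume V: "closed_subspace M V" and eV: "range e \<subseteq> V"
    show "LL \<subseteq> V"
    proof (rule L2_subset_closed_subspace[OF V top_subfield, of "D \<union> null_sets M"])
      show "Int_stable (D \<union> null_sets M)"
        using DI DM by (auto simp: Int_stable_def intro: null_sets.Int null_set_Int1 null_set_Int2)
      show "sets M = sigma_sets (space M) (D \<union> null_sets M)"
      proof (rule antisym)
        have "C \<subseteq> D"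
        proof
          fix c assume "c \<in> C"
          then show "c \<in> D" unfolding D_def using C(2) sets.sets_into_space
            by (intro image_eqI[of _ _ "{c}"]) auto
        qed
        then show "sets M \<subseteq> sigma_sets (space M) (D \<union> null_sets M)"
          unfolding C(3) by (intro sigma_sets_mono') auto
        show "sigma_sets (space M) (D \<union> null_sets M) \<subseteq> sets M"
          using DM by (intro sets.sigma_sets_subset) auto
      qed
      show "space M \<in> D \<union> null_sets M" using sD by simp
      fix A assume "A \<in> D \<union> null_sets M"
      then consider "A \<in> D" | "A \<in> null_sets M" by blast
      then show "indicat_real A \<in> V"
      proof cases
        case 1
        then show ?thesis using eV re by auto
      next
        case 2
        have "AE \<omega> in M. 0 = indicat_real A \<omega>"
          using AE_not_in[OF 2] by eventually_elim simp
        then show ?thesis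
          using 2 by (intro closed_subspace_AE[OF V closed_subspace_zero[OF V]] indicator_LL) auto
      qed
    qed
  qed
qed

text \<open>By separability, points of the closure are limits of sequences.\<close>
lemma Cl_sequence:
  assumes sep: "essentially_separable M" and B: "B \<subseteq> subfields M" and x: "x \<in> Cl M B"
  obtains z where "\<And>n. z n \<in> B" "strong_conv z x"
proof -
  obtain e :: "nat \<Rightarrow> 'a \<Rightarrow> real" where e: "range e \<subseteq> LL"
    "\<And>V. closed_subspace M V \<Longrightarrow> range e \<subseteq> V \<Longrightarrow> LL \<subseteq> V"
    using separable_total[OF sep] by blast
  have "\<exists>y\<in>B. \<forall>f\<in>e ` {..n}. l2_dist M (cexp M y f) (cexp M x f) < 1 / real (Suc n)" for n
    by (rule x[unfolded Cl_iff[OF B], THEN conjunct2, rule_format]) (use e(1) in auto)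
  then obtain z where z: "\<And>n. z n \<in> B" "\<And>n i. i \<le> n \<Longrightarrow> l2_dist M (cexp M (z n) (e i)) (cexp M x (e i)) < 1 / real (Suc n)"
    by (metis atMost_iff image_eqI)
  have zs: "z n \<in> subfields M" for n using z B by blast
  have "(\<lambda>n. l2_dist M (cexp M (z n) (e i)) (cexp M x (e i))) \<longlonglongrightarrow> 0" for i
  proof (rule tendsto_sandwich[of "\<lambda>_. 0" _ _ "\<lambda>n. 1 / real (Suc n)"])
    show "\<forall>\<^sub>F n in sequentially. l2_dist M (cexp M (z n) (e i)) (cexp M x (e i)) \<le> 1 / real (Suc n)"
      using z(2) by (intro eventually_sequentiallyI[of i]) (auto intro: less_imp_le)
    show "(\<lambda>n. 1 / real (Suc n)) \<longlonglongrightarrow> 0" using LIMSEQ_inverse_real_of_nat by (simp add: inverse_eq_divide)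
  qed auto
  then have "LL \<subseteq> {f \<in> LL. (\<lambda>n. l2_dist M (cexp M (z n) f) (cexp M x f)) \<longlonglongrightarrow> 0}"
    using e(1) by (intro e(2) closed_subspace_convergence[OF zs Cl_subfield[OF B x]]) auto
  then have "strong_conv z x" by (auto simp: strong_conv_def)
  then show ?thesis using that z(1) by blast
qed

end


section \<open>Noise Boolean algebras and their closures\<close>

context prob_space
begin

lemma l2_tendsto_AE_cong:
  assumes "(\<lambda>n. l2_dist M (f n) g) \<longlonglongrightarrow> 0" "\<And>n. AE \<omega> in M. f n \<omega> = f' n \<omega>" "AE \<omega> in M. g \<omega> = g' \<omega>"
    "\<And>n. f n \<in> LL" "\<And>n. f' n \<in> LL" "g \<in> LL" "g' \<in> LL"
  shows "(\<lambda>n. l2_dist M (f' n) g') \<longlonglongrightarrow> 0"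
proof -
  have "l2_dist M (f n) g = l2_dist M (f' n) g'" for n
    using assms by (intro l2_dist_AE_cong) auto
  then show ?thesis using assms(1) by simp
qed

lemma indep_mult_tendsto:
  assumes u: "u \<in> subfields M" and v: "v \<in> subfields M" and i: "indep_set u v"
    and f: "\<And>n. f n \<in> L2 M u" "f' \<in> L2 M u" "(\<lambda>n. l2_dist M (f n) f') \<longlonglongrightarrow> 0"
    and g: "\<And>n. g n \<in> L2 M v" "g' \<in> L2 M v" "(\<lambda>n. l2_dist M (g n) g') \<longlonglongrightarrow> 0"
  shows "(\<lambda>n. l2_dist M (\<lambda>\<omega>. f n \<omega> * g n \<omega>) (\<lambda>\<omega>. f' \<omega> * g' \<omega>)) \<longlonglongrightarrow> 0"
proof (rule tendsto_zero_bound)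
  fix n
  have gL: "g n \<in> LL" "g' \<in> LL" using L2_subsetD g v by auto
  have "l2_norm M (g n) \<le> l2_dist M (g n) g' + l2_norm M g'"
    using l2_norm_triangle[OF L2_diff[OF gL] gL(2)] by (simp add: l2_dist_def)
  then have "l2_dist M (f n) f' * l2_norm M (g n) \<le> l2_dist M (f n) f' * (l2_dist M (g n) g' + l2_norm M g')"
    by (intro mult_left_mono) auto
  then show "l2_dist M (\<lambda>\<omega>. f n \<omega> * g n \<omega>) (\<lambda>\<omega>. f' \<omega> * g' \<omega>)
      \<le> l2_dist M (f n) f' * (l2_dist M (g n) g' + l2_norm M g') + l2_norm M f' * l2_dist M (g n) g'"
    using indep_mult_dist[OF u v i f(1) f(2) g(1) g(2), of n n] by linarith
next
  have "(\<lambda>n. l2_dist M (f n) f' * (l2_dist M (g n) g' + l2_norm M g') + l2_norm M f' * l2_dist M (g n) g')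
      \<longlonglongrightarrow> 0 * (0 + l2_norm M g') + l2_norm M f' * 0"
    by (intro tendsto_intros f g)
  then show "(\<lambda>n. l2_dist M (f n) f' * (l2_dist M (g n) g' + l2_norm M g') + l2_norm M f' * l2_dist M (g n) g')
      \<longlonglongrightarrow> 0" by simp
qed simp

end

text \<open>A noise Boolean algebra \<open>B\<close> under the essentially separable probability measure \<open>M\<close>.\<close>
locale noise_algebra = prob_space M for M :: "'a measure" +
  fixes B :: "'a set set set"
  assumes sep: "essentially_separable M" and nba: "noise_boolean_algebra M B"
begin

lemma B_sub: "B \<subseteq> subfields M"
  and B_inter: "x \<in> B \<Longrightarrow> y \<in> B \<Longrightarrow> x \<inter> y \<in> B"
  and B_join: "x \<in> B \<Longrightarrow> y \<in> B \<Longrightarrow> field_join M x y \<in> B"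
  and B_distrib: "x \<in> B \<Longrightarrow> y \<in> B \<Longrightarrow> z \<in> B \<Longrightarrow>
    x \<inter> field_join M y z = field_join M (x \<inter> y) (x \<inter> z)"
  using nba unfolding noise_boolean_algebra_def by blast+

lemma B_subfield: "x \<in> B \<Longrightarrow> x \<in> subfields M"
  using B_sub by blast

lemma B_compl:
  assumes "x \<in> B" obtains x' where "x' \<in> B" "indep_complement M x x'"
proof -
  have "\<forall>x\<in>B. \<exists>x'\<in>B. indep_complement M x x'"
    using nba unfolding noise_boolean_algebra_def by (elim conjE)
  then show ?thesis using assms that by blast
qed

lemma bot_B: "bot_field M \<in> B"
proof -
  have "B \<noteq> {}" using nba unfolding noise_boolean_algebra_def by (elim conjE)
  then obtain x where x: "x \<in> B" by blast
  obtain x' where x': "x' \<in> B" "indep_complement M x x'" using B_compl[OF x] by blast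
  have "x \<inter> x' = bot_field M"
    using indep_inter_bot B_subfield x x' indep_complementD by blast
  then show ?thesis using B_inter[OF x x'(1)] by simp
qed

lemma top_B: "sets M \<in> B"
proof -
  obtain x' where x': "x' \<in> B" "indep_complement M (bot_field M) x'" using B_compl[OF bot_B] by blast
  then show ?thesis using B_join[OF bot_B x'(1)] indep_complementD(2) by simp
qed

lemma Cl_subfields: "x \<in> Cl M B \<Longrightarrow> x \<in> subfields M"
  by (rule Cl_subfield[OF B_sub])

lemma B_Cl: "x \<in> B \<Longrightarrow> x \<in> Cl M B"
  using subset_Cl[OF B_sub] by blast

lemma B_split:
  assumes "x \<in> B" "u \<in> B" "u' \<in> B" "indep_complement M u u'"
  shows "x = field_join M (x \<inter> u) (x \<inter> u')"
  using B_distrib[OF assms(1,2,3)] indep_complementD(2)[OF assms(4)]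
    subfields_events[OF B_subfield[OF assms(1)]] by auto

text \<open>The part of \<open>x\<close> outside of \<open>y\<close> lies below the complement of \<open>y\<close> and is averaged out by
  \<open>cexp M y\<close>; hence \<open>cexp M y\<close> maps \<open>L2 M x\<close> into \<open>L2 M (x \<inter> y)\<close>.\<close>
lemma cexp_commute_B:
  assumes x: "x \<in> B" and y: "y \<in> B" and f: "f \<in> LL"
  shows "AE \<omega> in M. cexp M y (cexp M x f) \<omega> = cexp M (x \<inter> y) f \<omega>"
proof -
  obtain y' where y': "y' \<in> B" "indep_complement M y y'" using B_compl[OF y] by blast
  note i = indep_complementD(1)[OF y'(2)]
  note s = B_subfield[OF x] B_subfield[OF y] B_subfield[OF y'(1)]
  have xy: "x \<inter> y \<in> subfields M" "x \<inter> y' \<in> subfields M" using inter_subfield s by auto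
  have "L2 M x \<subseteq> {h \<in> LL. cexp M y h \<in> L2 M (x \<inter> y)}"
    unfolding B_split[OF x y y'(1,2), THEN arg_cong[where f="L2 M"]]
  proof (rule L2_join_subset_closed_subspace[OF closed_subspace_vimage[OF cexp_bounded_ops[OF s(2)] closed_subspace_L2M[OF xy(1)]] xy])
    fix A C assume A: "A \<in> x \<inter> y" and C: "C \<in> x \<inter> y'"
    have ind: "indicat_real A \<in> L2 M y" "indicat_real C \<in> L2 M y'" "indicat_real A \<in> L2 M (x \<inter> y)"
      using indicator_L2 A C s xy by auto
    have "(\<lambda>\<omega>. indicat_real A \<omega> * indicat_real C \<omega>) \<in> LL" by (rule indep_mult_LL[OF s(2,3) i ind(1,2)])
    moreover have "AE \<omega> in M. expectation (indicat_real C) * indicat_real A \<omega>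
        = cexp M y (\<lambda>\<omega>. indicat_real A \<omega> * indicat_real C \<omega>) \<omega>"
      using cexp_indep_mult[OF s(2,3) i ind(1,2)] by eventually_elim simp
    ultimately show "(\<lambda>\<omega>. indicat_real A \<omega> * indicat_real C \<omega>) \<in> {h \<in> LL. cexp M y h \<in> L2 M (x \<inter> y)}"
      using L2_AE[OF xy(1) closed_subspace_cmult[OF closed_subspace_L2M[OF xy(1)] ind(3)]] cexp_LL[OF s(2)] by simp
  qed
  then have "cexp M y (cexp M x f) \<in> L2 M (x \<inter> y)" using cexp_L2[OF s(1) f] by blast
  then have "AE \<omega> in M. cexp M (x \<inter> y) (cexp M y (cexp M x f)) \<omega> = cexp M y (cexp M x f) \<omega>"
    by (rule cexp_fixed[OF xy(1)])
  moreover have "AE \<omega> in M. cexp M (x \<inter> y) (cexp M y (cexp M x f)) \<omega> = cexp M (x \<inter> y) (cexp M x f) \<omega>"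
    by (rule cexp_tower[OF xy(1) s(2) _ cexp_LL[OF s(1) f]]) auto
  moreover have "AE \<omega> in M. cexp M (x \<inter> y) (cexp M x f) \<omega> = cexp M (x \<inter> y) f \<omega>"
    by (rule cexp_tower[OF xy(1) s(1) _ f]) auto
  ultimately show ?thesis by eventually_elim simp
qed

lemma Cl_seq:
  assumes "x \<in> Cl M B" obtains z where "\<And>n. z n \<in> B" "strong_conv z x"
  using Cl_sequence[OF sep B_sub assms] by blast

text \<open>Commutation persists in the strong closure, and the product of two commuting projections
  projects onto the intersection of their ranges.\<close>
lemma
  assumes x: "x \<in> Cl M B" and y: "y \<in> Cl M B"
  shows Cl_inter: "x \<inter> y \<in> Cl M B"
    and Cl_cexp: "f \<in> LL \<Longrightarrow> AE \<omega> in M. cexp M x (cexp M y f) \<omega> = cexp M (x \<inter> y) f \<omega>"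
proof -
  obtain xs where xs: "\<And>n. xs n \<in> B" "strong_conv xs x" using Cl_seq[OF x] by blast
  obtain ys where ys: "\<And>n. ys n \<in> B" "strong_conv ys y" using Cl_seq[OF y] by blast
  note sx = Cl_subfields[OF x] and sy = Cl_subfields[OF y]
  note sxs = B_subfield[OF xs(1)] and sys = B_subfield[OF ys(1)]
  note sxy = inter_subfield[OF sx sy]
  have lim: "(\<lambda>n. l2_dist M (cexp M (xs n) (cexp M (ys n) f)) (cexp M x (cexp M y f))) \<longlonglongrightarrow> 0"
    "(\<lambda>n. l2_dist M (cexp M (ys n) (cexp M (xs n) f)) (cexp M y (cexp M x f))) \<longlonglongrightarrow> 0" if f: "f \<in> LL" for f
    using strong_convD[OF xs(2) f] strong_convD[OF ys(2) f]
    by (intro strong_conv_apply sxs sys sx sy xs ys cexp_LL f; simp)+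
  have comm: "AE \<omega> in M. cexp M x (cexp M y f) \<omega> = cexp M y (cexp M x f) \<omega>" if f: "f \<in> LL" for f
  proof (rule l2_limit_unique[OF _ _ _ lim(1)[OF f]])
    show "(\<lambda>n. l2_dist M (cexp M (xs n) (cexp M (ys n) f)) (cexp M y (cexp M x f))) \<longlonglongrightarrow> 0"
    proof (rule l2_tendsto_AE_cong[OF lim(2)[OF f]])
      fix n
      show "AE \<omega> in M. cexp M (ys n) (cexp M (xs n) f) \<omega> = cexp M (xs n) (cexp M (ys n) f) \<omega>"
        using cexp_commute_B[OF xs(1) ys(1) f, of n n] cexp_commute_B[OF ys(1) xs(1) f, of n n]
        unfolding Int_commute[of "ys n"] by eventually_elim simp
    qed (auto intro!: cexp_LL sx sy sxs sys f)
  qed (auto intro!: cexp_LL sx sy sxs sys f)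
  have meet: "AE \<omega> in M. cexp M x (cexp M y f) \<omega> = cexp M (x \<inter> y) f \<omega>" if f: "f \<in> LL" for f
  proof -
    let ?p = "cexp M x (cexp M y f)"
    have px: "?p \<in> L2 M x" by (intro cexp_L2 cexp_LL sx sy f)
    have "cexp M y (cexp M x f) \<in> L2 M y" by (intro cexp_L2 cexp_LL sx sy f)
    moreover have "AE \<omega> in M. cexp M y (cexp M x f) \<omega> = ?p \<omega>"
      using comm[OF f] by eventually_elim simp
    ultimately have "?p \<in> L2 M y" by (rule L2_AE[OF sy _ cexp_LL[OF sx cexp_LL[OF sy f]]])
    then have "?p \<in> L2 M (x \<inter> y)" using px L2_inter[OF sx sy] by blast
    then have "AE \<omega> in M. cexp M (x \<inter> y) ?p \<omega> = ?p \<omega>" by (rule cexp_fixed[OF sxy])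
    moreover have "AE \<omega> in M. cexp M (x \<inter> y) ?p \<omega> = cexp M (x \<inter> y) (cexp M y f) \<omega>"
      by (rule cexp_tower[OF sxy sx _ cexp_LL[OF sy f]]) auto
    moreover have "AE \<omega> in M. cexp M (x \<inter> y) (cexp M y f) \<omega> = cexp M (x \<inter> y) f \<omega>"
      by (rule cexp_tower[OF sxy sy _ f]) auto
    ultimately show ?thesis by eventually_elim simp
  qed
  then show "f \<in> LL \<Longrightarrow> AE \<omega> in M. cexp M x (cexp M y f) \<omega> = cexp M (x \<inter> y) f \<omega>" .
  have "strong_conv (\<lambda>n. xs n \<inter> ys n) (x \<inter> y)"
    unfolding strong_conv_def
  proof
    fix f assume f: "f \<in> LL"
    show "(\<lambda>n. l2_dist M (cexp M (xs n \<inter> ys n) f) (cexp M (x \<inter> y) f)) \<longlonglongrightarrow> 0"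
    proof (rule l2_tendsto_AE_cong[OF lim(1)[OF f]])
      fix n
      show "AE \<omega> in M. cexp M (xs n) (cexp M (ys n) f) \<omega> = cexp M (xs n \<inter> ys n) f \<omega>"
        using cexp_commute_B[OF ys(1) xs(1) f, of n n] unfolding Int_commute[of "ys n"] .
    qed (auto intro!: cexp_LL sx sy sxs sys f meet inter_subfield)
  qed
  then show "x \<inter> y \<in> Cl M B"
    using xs(1) ys(1) by (intro Cl_limit[OF B_sub _ sxy, of "\<lambda>n. xs n \<inter> ys n"] B_Cl B_inter) auto
qed

lemma Cl_cexp_L2:
  assumes x: "x \<in> Cl M B" and y: "y \<in> Cl M B" and f: "f \<in> L2 M y"
  shows "AE \<omega> in M. cexp M x f \<omega> = cexp M (x \<inter> y) f \<omega>" "cexp M x f \<in> L2 M (x \<inter> y)"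
    "cexp M x f \<in> L2 M y"
proof -
  note sx = Cl_subfields[OF x] and sy = Cl_subfields[OF y]
  note fL = L2_subsetD[OF f sy]
  note sxy = inter_subfield[OF sx sy]
  have "AE \<omega> in M. cexp M x (cexp M y f) \<omega> = cexp M x f \<omega>"
    by (rule cexp_AE_cong[OF sx cexp_LL[OF sy fL] fL cexp_fixed[OF sy f]])
  with Cl_cexp[OF x y fL] show *: "AE \<omega> in M. cexp M x f \<omega> = cexp M (x \<inter> y) f \<omega>"
    by eventually_elim simp
  then have "AE \<omega> in M. cexp M (x \<inter> y) f \<omega> = cexp M x f \<omega>" by eventually_elim simp
  then show "cexp M x f \<in> L2 M (x \<inter> y)"
    by (rule L2_AE[OF sxy cexp_L2[OF sxy fL] cexp_LL[OF sx fL]])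
  then show "cexp M x f \<in> L2 M y" using L2_mono[OF sxy sy] by blast
qed

text \<open>Compatibility with a fixed independent pair is preserved under strong limits.\<close>
lemma splits_limit:
  assumes u: "u \<in> Cl M B" and v: "v \<in> Cl M B" and i: "indep_set u v"
    and z: "\<And>n. z n \<in> Cl M B" "\<And>n. splits (z n) u v" and w: "w \<in> Cl M B" and c: "strong_conv z w"
  shows "splits w u v"
  unfolding splits_def
proof (intro ballI)
  fix f g assume f: "f \<in> L2 M u" and g: "g \<in> L2 M v"
  note s = Cl_subfields[OF u] Cl_subfields[OF v] and sz = Cl_subfields[OF z(1)] and sw = Cl_subfields[OF w]
  note fL = L2_subsetD[OF f s(1)] and gL = L2_subsetD[OF g s(2)]
  have fg: "(\<lambda>\<omega>. f \<omega> * g \<omega>) \<in> LL" by (rule indep_mult_LL[OF s i f g])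
  note pf = Cl_cexp_L2(3)[OF z(1) u f] Cl_cexp_L2(3)[OF w u f]
  note pg = Cl_cexp_L2(3)[OF z(1) v g] Cl_cexp_L2(3)[OF w v g]
  have m: "(\<lambda>\<omega>. cexp M (z n) f \<omega> * cexp M (z n) g \<omega>) \<in> LL" for n by (rule indep_mult_LL[OF s i pf(1) pg(1)])
  have "(\<lambda>n. l2_dist M (\<lambda>\<omega>. cexp M (z n) f \<omega> * cexp M (z n) g \<omega>) (cexp M w (\<lambda>\<omega>. f \<omega> * g \<omega>))) \<longlonglongrightarrow> 0"
    by (rule l2_tendsto_AE_cong[OF strong_convD[OF c fg] splitsD[OF z(2) f g]]) (auto intro!: cexp_LL sz sw fg m)
  moreover have "(\<lambda>n. l2_dist M (\<lambda>\<omega>. cexp M (z n) f \<omega> * cexp M (z n) g \<omega>) (\<lambda>\<omega>. cexp M w f \<omega> * cexp M w g \<omega>)) \<longlonglongrightarrow> 0"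
    by (rule indep_mult_tendsto[OF s i pf strong_convD[OF c fL] pg strong_convD[OF c gL]])
  ultimately show "AE \<omega> in M. cexp M w (\<lambda>\<omega>. f \<omega> * g \<omega>) \<omega> = cexp M w f \<omega> * cexp M w g \<omega>"
    by (intro l2_limit_unique[OF m cexp_LL[OF sw fg] indep_mult_LL[OF s i pf(2) pg(2)]])
qed

lemma splits_B:
  assumes w: "w \<in> B" and u: "u \<in> B" "u' \<in> B" "indep_complement M u u'"
  shows "splits w u u'"
proof -
  note s = B_subfield[OF w] B_subfield[OF u(1)] B_subfield[OF u(2)]
  have "splits (field_join M (w \<inter> u) (w \<inter> u')) u u'"
    by (rule splits_join[OF s(2,3) indep_complementD(1)[OF u(3)] inter_subfield[OF s(1,2)] _ inter_subfield[OF s(1,3)]]) auto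
  then show ?thesis using B_split[OF w u] by simp
qed

lemma splits_Cl_B:
  assumes v: "v \<in> Cl M B" and w: "w \<in> B" "w' \<in> B" "indep_complement M w w'"
  shows "splits v w w'"
proof -
  obtain z where z: "\<And>n. z n \<in> B" "strong_conv z v" using Cl_seq[OF v] by blast
  show ?thesis
    by (rule splits_limit[OF B_Cl[OF w(1)] B_Cl[OF w(2)] indep_complementD(1)[OF w(3)] B_Cl[OF z(1)] splits_B[OF z(1) w] v z(2)])
qed

text \<open>A multiplicative conditional expectation splits its \<open>\<sigma>\<close>-field along the independent pair.\<close>
lemma split_Cl:
  assumes v: "v \<in> Cl M B" and w: "w \<in> Cl M B" "w' \<in> Cl M B" "indep_complement M w w'" and sp: "splits v w w'"
  shows "v = field_join M (v \<inter> w) (v \<inter> w')"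
proof
  note sv = Cl_subfields[OF v] and s = Cl_subfields[OF w(1)] Cl_subfields[OF w(2)]
  note i = indep_complementD(1)[OF w(3)]
  note svw = inter_subfield[OF sv s(1)] inter_subfield[OF sv s(2)]
  let ?j = "field_join M (v \<inter> w) (v \<inter> w')"
  have sj: "?j \<in> subfields M" by (rule join_subfield[OF svw])
  show "?j \<subseteq> v" by (rule join_least[OF sv]) auto
  have "L2 M (field_join M w w') \<subseteq> {f \<in> LL. cexp M v f \<in> L2 M ?j}"
  proof (rule L2_join_subset_closed_subspace[OF closed_subspace_vimage[OF cexp_bounded_ops[OF sv] closed_subspace_L2M[OF sj]] s])
    fix A C assume A: "A \<in> w" and C: "C \<in> w'"
    note ind = indicator_L2[OF s(1) A] indicator_L2[OF s(2) C]
    have L: "(\<lambda>\<omega>. indicat_real A \<omega> * indicat_real C \<omega>) \<in> LL" by (rule indep_mult_LL[OF s i ind])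
    have "(\<lambda>\<omega>. cexp M v (indicat_real A) \<omega> * cexp M v (indicat_real C) \<omega>) \<in> L2 M ?j"
      by (intro L2_join_mult svw Cl_cexp_L2(2) v w ind indep_subset[OF i]) auto
    moreover have "AE \<omega> in M. cexp M v (indicat_real A) \<omega> * cexp M v (indicat_real C) \<omega>
        = cexp M v (\<lambda>\<omega>. indicat_real A \<omega> * indicat_real C \<omega>) \<omega>"
      using splitsD[OF sp ind] by eventually_elim simp
    ultimately have "cexp M v (\<lambda>\<omega>. indicat_real A \<omega> * indicat_real C \<omega>) \<in> L2 M ?j"
      by (rule L2_AE[OF sj _ cexp_LL[OF sv L]])
    then show "(\<lambda>\<omega>. indicat_real A \<omega> * indicat_real C \<omega>) \<in> {f \<in> LL. cexp M v f \<in> L2 M ?j}" using L by simp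
  qed
  then have *: "cexp M v f \<in> L2 M ?j" if "f \<in> LL" for f
    using that unfolding indep_complementD(2)[OF w(3)] by blast
  show "v \<subseteq> ?j"
  proof
    fix A assume A: "A \<in> v"
    then have Am: "A \<in> sets M" using subfields_events[OF sv] by blast
    have "indicat_real A \<in> L2 M ?j"
      by (rule L2_AE[OF sj *[OF indicator_LL[OF Am]] indicator_LL[OF Am] cexp_fixed[OF sv indicator_L2[OF sv A]]])
    then show "A \<in> ?j" by (rule indicator_L2_mem[OF sj Am])
  qed
qed

text \<open>Splitting along a complemented pair \<open>u\<close>, \<open>u'\<close> of the closure: an element \<open>w\<close> of \<open>B\<close> and
  its complement split both \<open>u\<close> and \<open>u'\<close>, and the four pieces reassemble to \<open>w\<close>.\<close>
lemma splits_compl: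
  assumes w: "w \<in> Cl M B" and u: "u \<in> Cl M B" "u' \<in> Cl M B" "indep_complement M u u'"
  shows "splits w u u'"
proof -
  note s = Cl_subfields[OF u(1)] Cl_subfields[OF u(2)]
  note iu = indep_complementD[OF u(3)]
  have inB: "splits w u u'" if w: "w \<in> B" for w
  proof -
    obtain w' where w': "w' \<in> B" "indep_complement M w w'" using B_compl[OF w] by blast
    note sw = B_subfield[OF w] B_subfield[OF w'(1)]
    note i = indep_complementD(1)[OF w'(2)]
    have *: "x = field_join M (x \<inter> w) (x \<inter> w')" if "x \<in> Cl M B" for x
      by (rule split_Cl[OF that B_Cl[OF w] B_Cl[OF w'(1)] w'(2) splits_Cl_B[OF that w w']])
    \<comment> \<open>The pieces below \<open>w\<close> and those below \<open>w'\<close>; it will turn out that \<open>p = w\<close>.\<close>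
    define p where "p = field_join M (u \<inter> w) (u' \<inter> w)"
    define q where "q = field_join M (u \<inter> w') (u' \<inter> w')"
    have sp: "p \<in> subfields M" "q \<in> subfields M"
      unfolding p_def q_def by (intro join_subfield inter_subfield s sw)+
    have pw: "p \<subseteq> w" "q \<subseteq> w'" unfolding p_def q_def by (intro join_least sw; auto)+
    have sj: "field_join M p q \<in> subfields M" by (rule join_subfield[OF sp])
    have up: "u \<inter> w \<subseteq> p" "u' \<inter> w \<subseteq> p" "u \<inter> w' \<subseteq> q" "u' \<inter> w' \<subseteq> q"
      unfolding p_def q_def by (rule join_upper)+
    have "u \<subseteq> field_join M p q"
      using *[OF u(1)] join_mono[OF up(1) up(3)] by simp
    moreover have "u' \<subseteq> field_join M p q"
      using *[OF u(2)] join_mono[OF up(2) up(4)] by simp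
    ultimately have "sets M \<subseteq> field_join M p q"
      using join_least[OF sj, of u u'] iu(2) by simp
    then have jpq: "field_join M p q = sets M" using subfields_events[OF sj] by auto
    have "L2 M (field_join M p q) \<subseteq> {f \<in> LL. cexp M w f \<in> L2 M p}"
    proof (rule L2_join_subset_closed_subspace[OF closed_subspace_vimage[OF cexp_bounded_ops[OF sw(1)] closed_subspace_L2M[OF sp(1)]] sp])
      fix A C assume A: "A \<in> p" and C: "C \<in> q"
      have ind: "indicat_real A \<in> L2 M w" "indicat_real C \<in> L2 M w'" "indicat_real A \<in> L2 M p"
        using indicator_L2 A C sp sw pw by auto
      have L: "(\<lambda>\<omega>. indicat_real A \<omega> * indicat_real C \<omega>) \<in> LL" by (rule indep_mult_LL[OF sw i ind(1,2)])
      have "AE \<omega> in M. expectation (indicat_real C) * indicat_real A \<omega>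
          = cexp M w (\<lambda>\<omega>. indicat_real A \<omega> * indicat_real C \<omega>) \<omega>"
        using cexp_indep_mult[OF sw i ind(1,2)] by eventually_elim simp
      then have "cexp M w (\<lambda>\<omega>. indicat_real A \<omega> * indicat_real C \<omega>) \<in> L2 M p"
        by (rule L2_AE[OF sp(1) closed_subspace_cmult[OF closed_subspace_L2M[OF sp(1)] ind(3)] cexp_LL[OF sw(1) L]])
      then show "(\<lambda>\<omega>. indicat_real A \<omega> * indicat_real C \<omega>) \<in> {f \<in> LL. cexp M w f \<in> L2 M p}" using L by simp
    qed
    then have **: "cexp M w f \<in> L2 M p" if "f \<in> LL" for f using that unfolding jpq by blast
    have "w \<subseteq> p"
    proof
      fix A assume A: "A \<in> w"
      then have Am: "A \<in> sets M" using subfields_events[OF sw(1)] by blast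
      have "indicat_real A \<in> L2 M p"
        by (rule L2_AE[OF sp(1) **[OF indicator_LL[OF Am]] indicator_LL[OF Am] cexp_fixed[OF sw(1) indicator_L2[OF sw(1) A]]])
      then show "A \<in> p" by (rule indicator_L2_mem[OF sp(1) Am])
    qed
    with pw have "w = p" by auto
    then show ?thesis
      using splits_join[OF s iu(1) inter_subfield[OF s(1) sw(1)] _ inter_subfield[OF s(2) sw(1)]] unfolding p_def by auto
  qed
  obtain z where z: "\<And>n. z n \<in> B" "strong_conv z w" using Cl_seq[OF w] by blast
  show ?thesis
    by (rule splits_limit[OF u(1,2) iu(1) B_Cl[OF z(1)] inB[OF z(1)] w z(2)])
qed

lemma indep_subset_complement:
  assumes v: "v \<in> Cl M B" and u: "u \<in> Cl M B" "u' \<in> Cl M B" "indep_complement M u u'" and i: "indep_set u v"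
  shows "v \<subseteq> u'"
proof -
  note s = Cl_subfields[OF v] Cl_subfields[OF u(1)] Cl_subfields[OF u(2)]
  have "v = field_join M (v \<inter> u) (v \<inter> u')"
    by (rule split_Cl[OF v u splits_compl[OF v u]])
  also have "v \<inter> u = bot_field M"
    using indep_inter_bot[OF s(2) s(1) i] by (simp add: Int_commute)
  also have "field_join M (bot_field M) (v \<inter> u') = v \<inter> u'"
    by (rule join_absorb[OF inter_subfield[OF s(1,3)] subfields_bot[OF inter_subfield[OF s(1,3)]]])
  finally show ?thesis by auto
qed

text \<open>Joins are not continuous in general, but joining with a fixed element of \<open>B\<close> is, since that
  element has a complement.  With \<open>X\<close>, \<open>Y\<close> in \<open>B\<close> fixed and \<open>a k\<close>, \<open>b k\<close> approximating a complemented
  pair \<open>u\<close>, \<open>u'\<close>, the conditional expectation given \<open>(X \<inter> a k) \<or> (Y \<inter> b k)\<close> acts on \<open>L2 M u\<close> in the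
  limit as that given \<open>X\<close>, because \<open>Y \<inter> b k\<close> becomes trivial on \<open>u\<close>.\<close>
lemma frozen_join_limit:
  assumes u: "u \<in> Cl M B" "u' \<in> Cl M B" "indep_complement M u u'"
    and X: "X \<in> B" and Y: "Y \<in> B" and a: "\<And>k. a k \<in> B" "strong_conv a u" and b: "\<And>k. b k \<in> B" "strong_conv b u'"
    and f: "f \<in> L2 M u"
  shows "(\<lambda>k. l2_dist M (cexp M (field_join M (X \<inter> a k) (Y \<inter> b k)) f) (cexp M X f)) \<longlonglongrightarrow> 0"
proof -
  obtain X' where X': "X' \<in> B" "indep_complement M X X'" using B_compl[OF X] by blast
  define z where "z k = field_join M (X \<inter> a k) (Y \<inter> b k)" for k
  have zB: "z k \<in> B" for k unfolding z_def by (intro B_join B_inter X Y a b)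
  note su = Cl_subfields[OF u(1)] Cl_subfields[OF u(2)]
  note sX = B_subfield[OF X] B_subfield[OF X'(1)] B_subfield[OF Y]
  note sz = B_subfield[OF zB] and sa = B_subfield[OF a(1)] and sb = B_subfield[OF b(1)]
  note iX = indep_complementD(1)[OF X'(2)]
  note suX = inter_subfield[OF su(1) sX(1)] inter_subfield[OF su(1) sX(2)]
  have usplit: "u = field_join M (u \<inter> X) (u \<inter> X')"
    by (rule split_Cl[OF u(1) B_Cl[OF X] B_Cl[OF X'(1)] X'(2) splits_Cl_B[OF u(1) X X']])
  have zX': "z k \<inter> X' = (Y \<inter> X') \<inter> b k" for k
  proof -
    have "X' \<inter> z k = field_join M (X' \<inter> (X \<inter> a k)) (X' \<inter> (Y \<inter> b k))"
      unfolding z_def by (intro B_distrib B_inter X X' Y a b)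
    also have "\<dots> = X' \<inter> (Y \<inter> b k)"
    proof (rule join_absorb)
      show s: "X' \<inter> (Y \<inter> b k) \<in> subfields M" by (intro inter_subfield sX sb)
      have "X' \<inter> (X \<inter> a k) \<subseteq> bot_field M" using indep_inter_bot[OF sX(1,2) iX] by auto
      then show "X' \<inter> (X \<inter> a k) \<subseteq> X' \<inter> (Y \<inter> b k)" using subfields_bot[OF s] by blast
    qed
    finally show ?thesis by (simp add: Int_ac)
  qed
  have "L2 M (field_join M (u \<inter> X) (u \<inter> X')) \<subseteq> {h \<in> LL. (\<lambda>k. l2_dist M (cexp M (z k) h) (cexp M X h)) \<longlonglongrightarrow> 0}"
  proof (rule L2_join_subset_closed_subspace[OF closed_subspace_convergence[OF sz sX(1)] suX])
    fix A C assume A: "A \<in> u \<inter> X" and C: "C \<in> u \<inter> X'"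
    define p q where "p = indicat_real A" and "q = indicat_real C"
    have p: "p \<in> L2 M u" "p \<in> L2 M X" and q: "q \<in> L2 M u" "q \<in> L2 M X'"
      unfolding p_def q_def using indicator_L2 A C su sX by auto
    note pL = L2_subsetD[OF p(2) sX(1)] and qL = L2_subsetD[OF q(2) sX(2)]
    have pq: "(\<lambda>\<omega>. p \<omega> * q \<omega>) \<in> LL" by (rule indep_mult_LL[OF sX(1,2) iX p(2) q(2)])
    have limp: "(\<lambda>k. l2_dist M (cexp M (z k) p) (cexp M X p)) \<longlonglongrightarrow> 0"
    proof -
      have sXa: "X \<inter> a k \<in> subfields M" for k by (intro inter_subfield sX sa)
      have le: "l2_dist M (cexp M (z k) p) p \<le> 2 * l2_dist M p (cexp M (X \<inter> a k) p)" for k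
      proof (rule cexp_dist_approx[OF sz pL])
        show "cexp M (X \<inter> a k) p \<in> L2 M (z k)"
          using cexp_L2[OF sXa pL] L2_mono[OF sXa sz] join_upper(1)[of "X \<inter> a k"] unfolding z_def by blast
      qed
      have "(\<lambda>k. l2_dist M (cexp M (X \<inter> a k) p) p) \<longlonglongrightarrow> 0"
      proof (rule l2_tendsto_AE_cong[OF strong_convD[OF a(2) pL]])
        show "AE \<omega> in M. cexp M (a k) p \<omega> = cexp M (X \<inter> a k) p \<omega>" for k
          using Cl_cexp_L2(1)[OF B_Cl[OF a(1)] B_Cl[OF X] p(2), of k] unfolding Int_commute[of X] .
      qed (auto intro!: cexp_LL sa su pL sXa cexp_fixed p)
      then have "(\<lambda>k. 2 * l2_dist M p (cexp M (X \<inter> a k) p)) \<longlonglongrightarrow> 2 * 0"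
        unfolding l2_dist_commute[of M p] by (intro tendsto_intros)
      then have "(\<lambda>k. l2_dist M (cexp M (z k) p) p) \<longlonglongrightarrow> 0"
        using le by (intro tendsto_zero_bound[of "\<lambda>k. l2_dist M (cexp M (z k) p) p" "\<lambda>k. 2 * l2_dist M p (cexp M (X \<inter> a k) p)"]) auto
      then show ?thesis
        by (rule l2_tendsto_AE_cong)
          (use cexp_fixed[OF sX(1) p(2)] in \<open>auto intro!: cexp_LL sz pL sX\<close>)
    qed
    have limq: "(\<lambda>k. l2_dist M (cexp M (z k) q) (cexp M X q)) \<longlonglongrightarrow> 0"
    proof -
      note sYX = inter_subfield[OF sX(3,2)]
      have YX: "Y \<inter> X' \<in> Cl M B" by (intro B_Cl B_inter Y X')
      have le: "l2_dist M (cexp M (Y \<inter> X') (cexp M (b k) q)) (cexp M (Y \<inter> X') (cexp M u' q))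
          \<le> l2_dist M (cexp M (b k) q) (cexp M u' q)" for k
        by (intro cexp_dist_le sYX cexp_LL sb su qL)
      have lim: "(\<lambda>k. l2_dist M (cexp M (Y \<inter> X') (cexp M (b k) q)) (cexp M (Y \<inter> X') (cexp M u' q))) \<longlonglongrightarrow> 0"
        by (rule tendsto_zero_bound[OF _ le strong_convD[OF b(2) qL]]) simp
      show ?thesis
      proof (rule l2_tendsto_AE_cong[OF lim])
        fix k
        show "AE \<omega> in M. cexp M (Y \<inter> X') (cexp M (b k) q) \<omega> = cexp M (z k) q \<omega>"
          using Cl_cexp[OF YX B_Cl[OF b(1)] qL, of k] Cl_cexp_L2(1)[OF B_Cl[OF zB] B_Cl[OF X'(1)] q(2), of k]
          unfolding zX' by eventually_elim simp
      next
        let ?c = "expectation q"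
        have 1: "AE \<omega> in M. cexp M u' q \<omega> = ?c"
          by (rule cexp_indep[OF su(2,1) indep_commute[OF indep_complementD(1)[OF u(3)]] q(1)])
        have "AE \<omega> in M. cexp M (Y \<inter> X') (cexp M u' q) \<omega> = cexp M (Y \<inter> X') (\<lambda>_. ?c) \<omega>"
          by (rule cexp_AE_cong[OF sYX cexp_LL[OF su(2) qL] const_LL 1])
        moreover have "AE \<omega> in M. cexp M X q \<omega> = ?c" by (rule cexp_indep[OF sX(1,2) iX q(2)])
        moreover have "AE \<omega> in M. cexp M (Y \<inter> X') (\<lambda>_. ?c) \<omega> = ?c"
          by (rule cexp_fixed[OF sYX const_L2[OF sYX]])
        ultimately show "AE \<omega> in M. cexp M (Y \<inter> X') (cexp M u' q) \<omega> = cexp M X q \<omega>"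
          by eventually_elim simp
      qed (auto intro!: cexp_LL sYX sb su qL sz sX)
    qed
    have "(\<lambda>k. l2_dist M (\<lambda>\<omega>. cexp M (z k) p \<omega> * cexp M (z k) q \<omega>) (\<lambda>\<omega>. cexp M X p \<omega> * cexp M X q \<omega>)) \<longlonglongrightarrow> 0"
      by (intro indep_mult_tendsto[OF sX(1,2) iX] limp limq Cl_cexp_L2(3) B_Cl zB X X' p q)
    then have "(\<lambda>k. l2_dist M (cexp M (z k) (\<lambda>\<omega>. p \<omega> * q \<omega>)) (cexp M X (\<lambda>\<omega>. p \<omega> * q \<omega>))) \<longlonglongrightarrow> 0"
    proof (rule l2_tendsto_AE_cong)
      show "AE \<omega> in M. cexp M (z k) p \<omega> * cexp M (z k) q \<omega> = cexp M (z k) (\<lambda>\<omega>. p \<omega> * q \<omega>) \<omega>" for k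
        using splitsD[OF splits_B[OF zB X X'] p(2) q(2), of k] by eventually_elim simp
      show "AE \<omega> in M. cexp M X p \<omega> * cexp M X q \<omega> = cexp M X (\<lambda>\<omega>. p \<omega> * q \<omega>) \<omega>"
        using splitsD[OF splits_B[OF X X X'] p(2) q(2)] by eventually_elim simp
    qed (intro cexp_LL sz sX pq indep_mult_LL[OF sX(1,2) iX] Cl_cexp_L2(3) B_Cl zB X X' p q)+
    then show "(\<lambda>\<omega>. indicat_real A \<omega> * indicat_real C \<omega>) \<in> {h \<in> LL. (\<lambda>k. l2_dist M (cexp M (z k) h) (cexp M X h)) \<longlonglongrightarrow> 0}"
      using pq unfolding p_def q_def by simp
  qed
  then show ?thesis using f usplit unfolding z_def by auto
qed

text \<open>Convergence separately on the two factors of a tensor product decomposition implies strong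
  convergence to the join of the two limits, which therefore belongs to the closure.\<close>
lemma tensor_strong_conv:
  assumes u: "u \<in> Cl M B" "u' \<in> Cl M B" "indep_complement M u u'"
    and z: "\<And>n. z n \<in> Cl M B" and x: "x \<in> Cl M B" "x \<subseteq> u" and y: "y \<in> Cl M B" "y \<subseteq> u'"
    and lf: "\<And>f. f \<in> L2 M u \<Longrightarrow> (\<lambda>n. l2_dist M (cexp M (z n) f) (cexp M x f)) \<longlonglongrightarrow> 0"
    and lg: "\<And>g. g \<in> L2 M u' \<Longrightarrow> (\<lambda>n. l2_dist M (cexp M (z n) g) (cexp M y g)) \<longlonglongrightarrow> 0"
  shows "field_join M x y \<in> Cl M B"
proof (rule Cl_limit[OF B_sub z])
  note su = Cl_subfields[OF u(1)] Cl_subfields[OF u(2)]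
  note sx = Cl_subfields[OF x(1)] and sy = Cl_subfields[OF y(1)] and sz = Cl_subfields[OF z]
  note i = indep_complementD[OF u(3)]
  show sj: "field_join M x y \<in> subfields M" by (rule join_subfield[OF sx sy])
  show "strong_conv z (field_join M x y)"
  proof (rule strong_conv_total[OF sz sj su i(2)])
    fix A C assume "A \<in> u" "C \<in> u'"
    then have f: "indicat_real A \<in> L2 M u" and g: "indicat_real C \<in> L2 M u'" using indicator_L2 su by auto
    let ?f = "indicat_real A" and ?g = "indicat_real C"
    have fg: "(\<lambda>\<omega>. ?f \<omega> * ?g \<omega>) \<in> LL" by (rule indep_mult_LL[OF su i(1) f g])
    note pf = Cl_cexp_L2(3)[OF z u(1) f] Cl_cexp_L2(3)[OF x(1) u(1) f]
      and pg = Cl_cexp_L2(3)[OF z u(2) g] Cl_cexp_L2(3)[OF y(1) u(2) g]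
    have "(\<lambda>n. l2_dist M (\<lambda>\<omega>. cexp M (z n) ?f \<omega> * cexp M (z n) ?g \<omega>) (\<lambda>\<omega>. cexp M x ?f \<omega> * cexp M y ?g \<omega>)) \<longlonglongrightarrow> 0"
      by (rule indep_mult_tendsto[OF su i(1) pf lf[OF f] pg lg[OF g]])
    then show "(\<lambda>n. l2_dist M (cexp M (z n) (\<lambda>\<omega>. ?f \<omega> * ?g \<omega>)) (cexp M (field_join M x y) (\<lambda>\<omega>. ?f \<omega> * ?g \<omega>))) \<longlonglongrightarrow> 0"
    proof (rule l2_tendsto_AE_cong)
      show "AE \<omega> in M. cexp M (z n) ?f \<omega> * cexp M (z n) ?g \<omega> = cexp M (z n) (\<lambda>\<omega>. ?f \<omega> * ?g \<omega>) \<omega>" for n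
        using splitsD[OF splits_compl[OF z u] f g, of n] by eventually_elim simp
      show "AE \<omega> in M. cexp M x ?f \<omega> * cexp M y ?g \<omega> = cexp M (field_join M x y) (\<lambda>\<omega>. ?f \<omega> * ?g \<omega>) \<omega>"
        using cexp_join_mult[OF su i(1) sx x(2) sy y(2) f g] by eventually_elim simp
    qed (intro cexp_LL sz sj fg indep_mult_LL[OF su i(1)] pf pg)+
  qed
qed

text \<open>The iterated limit: for \<open>X\<close>, \<open>Y\<close> in \<open>B\<close> the join of \<open>X \<inter> u\<close> and \<open>Y \<inter> u'\<close> belongs to the
  closure by \<open>frozen_join_limit\<close>; then \<open>X\<close> and \<open>Y\<close> run through sequences converging to \<open>x\<close> and \<open>y\<close>.\<close>
lemma join_Cl:
  assumes u: "u \<in> Cl M B" "u' \<in> Cl M B" "indep_complement M u u'"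
    and x: "x \<in> Cl M B" "x \<subseteq> u" and y: "y \<in> Cl M B" "y \<subseteq> u'"
  shows "field_join M x y \<in> Cl M B"
proof -
  note su = Cl_subfields[OF u(1)] Cl_subfields[OF u(2)]
  note sx = Cl_subfields[OF x(1)] and sy = Cl_subfields[OF y(1)]
  note i = indep_complementD[OF u(3)]
  have AEI: "AE \<omega> in M. cexp M X f \<omega> = cexp M (X \<inter> v) f \<omega>" if "X \<in> B" "v \<in> Cl M B" "f \<in> L2 M v" for X v f
    by (rule Cl_cexp_L2(1)[OF B_Cl[OF that(1)] that(2,3)])
  obtain a where a: "\<And>n. a n \<in> B" "strong_conv a u" using Cl_seq[OF u(1)] by blast
  obtain b where b: "\<And>n. b n \<in> B" "strong_conv b u'" using Cl_seq[OF u(2)] by blast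
  have W: "field_join M (X \<inter> u) (Y \<inter> u') \<in> Cl M B" if X: "X \<in> B" and Y: "Y \<in> B" for X Y
  proof (rule tensor_strong_conv[OF u, of "\<lambda>k. field_join M (X \<inter> a k) (Y \<inter> b k)"])
    note sXY = B_subfield[OF X] B_subfield[OF Y] and sa = B_subfield[OF a(1)] and sb = B_subfield[OF b(1)]
    fix f assume f: "f \<in> L2 M u"
    show "(\<lambda>k. l2_dist M (cexp M (field_join M (X \<inter> a k) (Y \<inter> b k)) f) (cexp M (X \<inter> u) f)) \<longlonglongrightarrow> 0"
      by (rule l2_tendsto_AE_cong[OF frozen_join_limit[OF u X Y a b f] _ AEI[OF X u(1) f]])
        (auto intro!: cexp_LL join_subfield inter_subfield sXY sa sb su L2_subsetD[OF f])
  next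
    note sXY = B_subfield[OF X] B_subfield[OF Y] and sa = B_subfield[OF a(1)] and sb = B_subfield[OF b(1)]
    fix g assume g: "g \<in> L2 M u'"
    have "(\<lambda>k. l2_dist M (cexp M (field_join M (X \<inter> a k) (Y \<inter> b k)) g) (cexp M Y g)) \<longlonglongrightarrow> 0"
      unfolding join_commute[of "X \<inter> a _"]
      by (rule frozen_join_limit[OF u(2,1) indep_complement_commute[OF u(3)] Y X b a g])
    then show "(\<lambda>k. l2_dist M (cexp M (field_join M (X \<inter> a k) (Y \<inter> b k)) g) (cexp M (Y \<inter> u') g)) \<longlonglongrightarrow> 0"
      by (rule l2_tendsto_AE_cong[OF _ _ AEI[OF Y u(2) g]])
        (auto intro!: cexp_LL join_subfield inter_subfield sXY sa sb su L2_subsetD[OF g])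
  next
    show "field_join M (X \<inter> a k) (Y \<inter> b k) \<in> Cl M B" for k by (intro B_Cl B_join B_inter X Y a b)
    show "X \<inter> u \<in> Cl M B" "Y \<inter> u' \<in> Cl M B" by (intro Cl_inter B_Cl X Y u)+
  qed auto
  obtain xs where xs: "\<And>n. xs n \<in> B" "strong_conv xs x" using Cl_seq[OF x(1)] by blast
  obtain ys where ys: "\<And>n. ys n \<in> B" "strong_conv ys y" using Cl_seq[OF y(1)] by blast
  note sxs = B_subfield[OF xs(1)] and sys = B_subfield[OF ys(1)]
  have sub: "xs n \<inter> u \<in> subfields M" "ys n \<inter> u' \<in> subfields M" for n by (intro inter_subfield sxs sys su)+
  show ?thesis
  proof (rule tensor_strong_conv[OF u W[OF xs(1) ys(1)] x y])
    fix f assume f: "f \<in> L2 M u"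
    show "(\<lambda>n. l2_dist M (cexp M (field_join M (xs n \<inter> u) (ys n \<inter> u')) f) (cexp M x f)) \<longlonglongrightarrow> 0"
    proof (rule l2_tendsto_AE_cong[OF strong_convD[OF xs(2) L2_subsetD[OF f su(1)]]])
      fix n show "AE \<omega> in M. cexp M (xs n) f \<omega> = cexp M (field_join M (xs n \<inter> u) (ys n \<inter> u')) f \<omega>"
        using AEI[OF xs(1) u(1) f, of n] cexp_join_left[OF su i(1) sub(1) _ sub(2) _ f, of n n]
        by (auto elim: eventually_elim2)
    qed (auto intro!: cexp_LL join_subfield sub sx sxs L2_subsetD[OF f] su)
  next
    fix g assume g: "g \<in> L2 M u'"
    show "(\<lambda>n. l2_dist M (cexp M (field_join M (xs n \<inter> u) (ys n \<inter> u')) g) (cexp M y g)) \<longlonglongrightarrow> 0"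
    proof (rule l2_tendsto_AE_cong[OF strong_convD[OF ys(2) L2_subsetD[OF g su(2)]]])
      fix n show "AE \<omega> in M. cexp M (ys n) g \<omega> = cexp M (field_join M (xs n \<inter> u) (ys n \<inter> u')) g \<omega>"
        using AEI[OF ys(1) u(2) g, of n] cexp_join_left[OF su(2,1) indep_commute[OF i(1)] sub(2) _ sub(1) _ g, of n n]
        unfolding join_commute[of "xs n \<inter> u"] by (auto elim: eventually_elim2)
    qed (auto intro!: cexp_LL join_subfield sub sy sys L2_subsetD[OF g] su)
  qed
qed

end


section \<open>The orthogonal pieces \<open>L2c M B x\<close>\<close>

lemma closed_span_closed_subspace_eq:
  assumes "closed_subspace M V" shows "closed_span M V = V"
proof
  show "closed_span M V \<subseteq> V" by (rule closed_span_subset_closed_subspace[OF assms order_refl])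
  show "V \<subseteq> closed_span M V"
    using closed_span_base[of V M] closed_subspace_L2[OF assms] by blast
qed

lemma closed_subspace_Inter:
  assumes "K \<noteq> {}" "\<And>V. V \<in> K \<Longrightarrow> closed_subspace M V" shows "closed_subspace M (\<Inter>K)"
proof (rule closed_subspaceI)
  show "\<Inter>K \<subseteq> L2 M (sets M)" using assms closed_subspace_L2 by blast
  show "(\<lambda>_. 0) \<in> \<Inter>K" using assms(2) closed_subspace_zero by blast
  show "(\<lambda>\<omega>. a * f \<omega> + b * g \<omega>) \<in> \<Inter>K" if "f \<in> \<Inter>K" "g \<in> \<Inter>K" for f g and a b :: real
    using that closed_subspace_lincomb[OF assms(2)] by blast
  show "f \<in> \<Inter>K" if f: "f \<in> L2 M (sets M)" "\<And>\<epsilon>. \<epsilon> > 0 \<Longrightarrow> \<exists>g\<in>\<Inter>K. l2_dist M f g < \<epsilon>" for f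
  proof
    fix V assume V: "V \<in> K"
    show "f \<in> V" using f(2) V by (intro closed_subspace_limit[OF assms(2)[OF V] f(1)]) blast
  qed
qed

context noise_algebra
begin

lemma L2c_iff:
  assumes x: "x \<in> Cl M B"
  shows "f \<in> L2c M B x \<longleftrightarrow> f \<in> L2 M x \<and> (\<forall>y\<in>Cl M B. y \<subset> x \<longrightarrow> (\<forall>g\<in>L2 M y. l2_inner M f g = 0))"
proof (cases "f \<in> L2 M x")
  case True
  then have fL: "f \<in> LL" using L2_subsetD Cl_subfields[OF x] by blast
  let ?T = "\<Union>y\<in>{y \<in> Cl M B. y \<subset> x}. L2 M y"
  have TL: "?T \<subseteq> LL" using L2_subset Cl_subfields by blast
  have "(\<forall>g\<in>closed_span M ?T. l2_inner M f g = 0) \<longleftrightarrow> (\<forall>g\<in>?T. l2_inner M f g = 0)"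
  proof
    assume "\<forall>g\<in>?T. l2_inner M f g = 0"
    then have "?T \<subseteq> {h \<in> LL. l2_inner M f h = 0}" using TL by blast
    from closed_span_subset_closed_subspace[OF closed_subspace_orth[OF fL] this]
    show "\<forall>g\<in>closed_span M ?T. l2_inner M f g = 0" by blast
  qed (use closed_span_base[OF TL] in blast)
  then show ?thesis using True by (auto simp: L2c_def)
qed (simp add: L2c_def)

lemma L2c_L2: "f \<in> L2c M B x \<Longrightarrow> f \<in> L2 M x"
  by (simp add: L2c_def)

lemma L2c_LL: "x \<in> Cl M B \<Longrightarrow> f \<in> L2c M B x \<Longrightarrow> f \<in> LL"
  using L2c_L2 L2_subsetD Cl_subfields by blast

lemma closed_subspace_L2c:
  assumes x: "x \<in> Cl M B" shows "closed_subspace M (L2c M B x)"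
proof -
  let ?K = "insert (L2 M x) {{h \<in> LL. l2_inner M g h = 0} | g. \<exists>y\<in>Cl M B. y \<subset> x \<and> g \<in> L2 M y}"
  have "L2c M B x = \<Inter>?K"
  proof (intro set_eqI iffI)
    fix f assume f: "f \<in> L2c M B x"
    then show "f \<in> \<Inter>?K" using L2c_iff[OF x] L2c_LL[OF x f] by (auto simp: l2_inner_commute[of M f])
  next
    fix f assume f: "f \<in> \<Inter>?K"
    have "l2_inner M f g = 0" if "y \<in> Cl M B" "y \<subset> x" "g \<in> L2 M y" for y g
    proof -
      have "{h \<in> LL. l2_inner M g h = 0} \<in> ?K" using that by blast
      then show ?thesis using f by (auto simp: l2_inner_commute[of M f])
    qed
    then show "f \<in> L2c M B x" using f L2c_iff[OF x] by blast
  qed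
  moreover have "closed_subspace M (\<Inter>?K)"
  proof (rule closed_subspace_Inter)
    fix V assume "V \<in> ?K"
    then consider "V = L2 M x" | y g where "y \<in> Cl M B" "g \<in> L2 M y" "V = {h \<in> LL. l2_inner M g h = 0}" by blast
    then show "closed_subspace M V"
    proof cases
      case 1
      then show ?thesis using closed_subspace_L2M[OF Cl_subfields[OF x]] by simp
    next
      case 2
      show ?thesis unfolding 2(3)
        by (rule closed_subspace_orth[OF L2_subsetD[OF 2(2) Cl_subfields[OF 2(1)]]])
    qed
  qed simp
  ultimately show ?thesis by simp
qed

lemma L2c_bot: "L2c M B (bot_field M) = {f \<in> LL. \<exists>c. AE \<omega> in M. f \<omega> = c}"
proof -
  note b = B_Cl[OF bot_B]
  have "\<not> y \<subset> bot_field M" if "y \<in> Cl M B" for y using subfields_bot[OF Cl_subfields[OF that]] by blast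
  then have "L2c M B (bot_field M) = L2 M (bot_field M)" using L2c_iff[OF b] by blast
  also have "\<dots> = {f \<in> LL. \<exists>c. AE \<omega> in M. f \<omega> = c}"
  proof (intro set_eqI iffI)
    fix f assume "f \<in> L2 M (bot_field M)"
    then show "f \<in> {f \<in> LL. \<exists>c. AE \<omega> in M. f \<omega> = c}" using L2_bot_const L2_subsetD[OF _ bot_subfield] by blast
  next
    fix f assume "f \<in> {f \<in> LL. \<exists>c. AE \<omega> in M. f \<omega> = c}"
    then obtain c where f: "f \<in> LL" "AE \<omega> in M. f \<omega> = c" by blast
    from f(2) have "AE \<omega> in M. c = f \<omega>" by eventually_elim simp
    then show "f \<in> L2 M (bot_field M)" by (rule L2_AE[OF bot_subfield const_L2[OF bot_subfield] f(1)])
  qed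
  finally show ?thesis .
qed

lemma bot_Bc: "bot_field M \<in> Bc M B"
proof -
  have "(\<lambda>_. 1) \<in> L2c M B (bot_field M)" unfolding L2c_bot using const_LL by auto
  moreover have "\<not> (AE \<omega> in M. (1::real) = 0)" by simp
  ultimately show ?thesis
    using bot_B B_Cl[OF bot_B] unfolding Bc_def Clc_def by (intro IntI CollectI conjI bexI[of _ "\<lambda>_. 1"])
qed

text \<open>On the pieces \<open>L2c M B x\<close> every projection \<open>cexp M y\<close> acts as the identity or as zero.\<close>
lemma L2c_cexp:
  assumes x: "x \<in> Cl M B" and y: "y \<in> Cl M B" and g: "g \<in> L2c M B x"
  shows "AE \<omega> in M. cexp M y g \<omega> = cexp M (x \<inter> y) g \<omega>"
    and "x \<subseteq> y \<Longrightarrow> AE \<omega> in M. cexp M y g \<omega> = g \<omega>"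
    and "\<not> x \<subseteq> y \<Longrightarrow> AE \<omega> in M. cexp M y g \<omega> = 0"
proof -
  note s = Cl_subfields[OF x] Cl_subfields[OF y] and gL = L2c_LL[OF x g]
  show *: "AE \<omega> in M. cexp M y g \<omega> = cexp M (x \<inter> y) g \<omega>"
    using Cl_cexp_L2(1)[OF y x L2c_L2[OF g]] by (simp add: Int_commute)
  show "AE \<omega> in M. cexp M y g \<omega> = g \<omega>" if "x \<subseteq> y"
    using cexp_fixed[OF s(2)] L2c_L2[OF g] L2_mono[OF s that] by blast
  show "AE \<omega> in M. cexp M y g \<omega> = 0" if "\<not> x \<subseteq> y"
  proof -
    have sub: "x \<inter> y \<subset> x" using that by blast
    note xy = Cl_inter[OF x y] and sxy = inter_subfield[OF s]
    have "AE \<omega> in M. cexp M (x \<inter> y) g \<omega> = (\<lambda>_. 0) \<omega>"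
    proof (rule cexp_eqI[OF sxy gL const_L2[OF sxy]])
      fix h assume "h \<in> L2 M (x \<inter> y)"
      then have "l2_inner M g h = 0" using g L2c_iff[OF x] xy sub by blast
      then show "l2_inner M g h = l2_inner M (\<lambda>_. 0) h" by (simp add: l2_inner_real)
    qed
    with * show ?thesis by eventually_elim simp
  qed
qed

lemma L2c_orth:
  assumes x: "x \<in> Cl M B" and y: "y \<in> Cl M B" and "x \<noteq> y" and f: "f \<in> L2c M B x" and g: "g \<in> L2c M B y"
  shows "l2_inner M f g = 0"
proof -
  have *: "l2_inner M f g = 0" if x: "x \<in> Cl M B" and y: "y \<in> Cl M B" and n: "\<not> x \<subseteq> y"
    and f: "f \<in> L2c M B x" and g: "g \<in> L2c M B y" for x y f g
  proof -
    have "l2_inner M f g = l2_inner M (cexp M y f) g"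
      by (rule cexp_inner[OF Cl_subfields[OF y] L2c_LL[OF x f] L2c_L2[OF g], symmetric])
    also have "\<dots> = l2_inner M (\<lambda>_. 0) g"
      using L2c_cexp(3)[OF x y f n] LL_measurable L2c_LL[OF y g] cexp_LL[OF Cl_subfields[OF y] L2c_LL[OF x f]]
      by (intro l2_inner_AE_cong) auto
    finally show ?thesis by (simp add: l2_inner_real)
  qed
  show ?thesis
    using *[OF x y _ f g] *[OF y x _ g f] \<open>x \<noteq> y\<close> l2_inner_commute[of M f g] by (cases "x \<subseteq> y") auto
qed

lemma ClcD:
  assumes "x \<in> Clc M B"
  obtains f where "x \<in> Cl M B" "f \<in> L2c M B x" "\<not> (AE \<omega> in M. f \<omega> = 0)"
  using assms by (auto simp: Clc_def)

text \<open>Bessel's inequality bounds the number of pairwise orthogonal unit vectors that are not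
  almost orthogonal to a given function.\<close>
lemma Bessel:
  assumes F: "finite F" and f: "\<And>i. i \<in> F \<Longrightarrow> f i \<in> LL" "\<And>i. i \<in> F \<Longrightarrow> l2_norm M (f i) = 1"
    and o: "\<And>i j. i \<in> F \<Longrightarrow> j \<in> F \<Longrightarrow> i \<noteq> j \<Longrightarrow> l2_inner M (f i) (f j) = 0" and h: "h \<in> LL"
  shows "(\<Sum>i\<in>F. (l2_inner M (f i) h)\<^sup>2) \<le> (l2_norm M h)\<^sup>2"
proof -
  let ?a = "\<lambda>i. l2_inner M (f i) h"
  let ?s = "\<lambda>\<omega>. \<Sum>i\<in>F. ?a i * f i \<omega>"
  have sL: "?s \<in> LL" by (intro L2_sum L2_cmult f)
  have lin: "l2_inner M ?s k = (\<Sum>i\<in>F. ?a i * l2_inner M (f i) k)" if k: "k \<in> LL" for k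
  proof -
    have "l2_inner M ?s k = (\<integral>\<omega>. (\<Sum>i\<in>F. ?a i * (f i \<omega> * k \<omega>)) \<partial>M)"
      by (simp add: l2_inner_real sum_distrib_right mult.assoc)
    also have "\<dots> = (\<Sum>i\<in>F. ?a i * l2_inner M (f i) k)"
      using L2_mult_integrable[OF f(1) k] by (simp add: l2_inner_real)
    finally show ?thesis .
  qed
  have fs: "l2_inner M (f i) ?s = ?a i" if i: "i \<in> F" for i
  proof -
    have "l2_inner M (f i) ?s = (\<Sum>j\<in>F. ?a j * l2_inner M (f j) (f i))"
      using lin[OF f(1)[OF i]] by (simp add: l2_inner_commute[of M "f i"])
    also have "\<dots> = (\<Sum>j\<in>F. if j = i then ?a i else 0)"
      using i o f(2)[OF i] l2_norm_power2[of M "f i"] by (intro sum.cong) auto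
    also have "\<dots> = ?a i" using F i by simp
    finally show ?thesis .
  qed
  have ss: "l2_inner M ?s ?s = (\<Sum>i\<in>F. (?a i)\<^sup>2)"
    using lin[OF sL] fs by (simp add: power2_eq_square)
  have sh: "l2_inner M ?s h = (\<Sum>i\<in>F. (?a i)\<^sup>2)"
    using lin[OF h] by (simp add: power2_eq_square)
  let ?S = "\<Sum>i\<in>F. (?a i)\<^sup>2"
  have "?S \<le> l2_norm M ?s * l2_norm M h"
    using l2_Cauchy_Schwarz[OF sL h] sh by simp
  moreover have "l2_norm M ?s = sqrt ?S"
    using ss l2_norm_power2[of M ?s] by (simp add: real_sqrt_unique)
  moreover have S0: "0 \<le> ?S" by (simp add: sum_nonneg)
  ultimately have ts: "sqrt ?S * sqrt ?S \<le> sqrt ?S * l2_norm M h" by simp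
  have tn: "t \<le> n" if "t * t \<le> t * n" "0 \<le> t" "0 \<le> n" for t n :: real
    using that by (cases "t = 0") (auto simp: mult_le_cancel_left)
  have "sqrt ?S \<le> l2_norm M h"
    by (rule tn[OF ts]) (use S0 in auto)
  then have "(sqrt ?S)\<^sup>2 \<le> (l2_norm M h)\<^sup>2" using S0 by (intro power_mono) auto
  then show ?thesis using S0 by simp
qed

text \<open>The unit vectors chosen from the non-trivial spaces \<open>L2c M B x\<close> are orthonormal, and none of
  them is orthogonal to all members of a total sequence.\<close>
lemma countable_Clc: "countable (Clc M B)"
proof -
  obtain e :: "nat \<Rightarrow> 'a \<Rightarrow> real" where e: "range e \<subseteq> LL"
    "\<And>V. closed_subspace M V \<Longrightarrow> range e \<subseteq> V \<Longrightarrow> LL \<subseteq> V"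
    using separable_total[OF sep] by blast
  have "\<exists>f. f \<in> L2c M B x \<and> l2_norm M f = 1" if xC: "x \<in> Clc M B" for x
  proof -
    obtain f where f: "x \<in> Cl M B" "f \<in> L2c M B x" "\<not> (AE \<omega> in M. f \<omega> = 0)" using ClcD[OF xC] by blast
    have n: "l2_norm M f \<noteq> 0" using f(3) l2_norm_zero_iff[OF L2c_LL[OF f(1,2)]] by simp
    have "(\<lambda>\<omega>. (1 / l2_norm M f) * f \<omega>) \<in> L2c M B x"
      by (rule closed_subspace_cmult[OF closed_subspace_L2c[OF f(1)] f(2)])
    moreover have "l2_norm M (\<lambda>\<omega>. (1 / l2_norm M f) * f \<omega>) = 1"
      unfolding l2_norm_cmult using n by simp
    ultimately show ?thesis by blast
  qed
  then obtain f where f: "\<And>x. x \<in> Clc M B \<Longrightarrow> f x \<in> L2c M B x" "\<And>x. x \<in> Clc M B \<Longrightarrow> l2_norm M (f x) = 1"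
    by metis
  have Cl: "x \<in> Cl M B" if "x \<in> Clc M B" for x using that by (simp add: Clc_def)
  have fL: "f x \<in> LL" if "x \<in> Clc M B" for x using L2c_LL[OF Cl f(1)] that by blast
  define A where "A n m = {x \<in> Clc M B. 1 / real (Suc m) \<le> (l2_inner M (f x) (e n))\<^sup>2}" for n m
  have fin: "finite (A n m)" for n m
  proof (rule ccontr)
    assume inf: "infinite (A n m)"
    have en: "e n \<in> LL" using e(1) by auto
    obtain k :: nat where k: "real k > real (Suc m) * (l2_norm M (e n))\<^sup>2" using reals_Archimedean2 by blast
    obtain F where F: "finite F" "card F = k" "F \<subseteq> A n m" using infinite_arbitrarily_large[OF inf] by blast
    have FC: "F \<subseteq> Clc M B" using F(3) by (auto simp: A_def)
    have "real k * (1 / real (Suc m)) = (\<Sum>x\<in>F. 1 / real (Suc m))" using F(2) by simp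
    also have "\<dots> \<le> (\<Sum>x\<in>F. (l2_inner M (f x) (e n))\<^sup>2)" using F(3) by (intro sum_mono) (auto simp: A_def)
    also have "\<dots> \<le> (l2_norm M (e n))\<^sup>2"
    proof (rule Bessel[OF F(1) _ _ _ en])
      fix x y assume "x \<in> F" "y \<in> F" "x \<noteq> y"
      then show "l2_inner M (f x) (f y) = 0" using FC by (intro L2c_orth[of x y] Cl f) auto
    qed (use FC f fL in auto)
    finally show False using k by (simp add: field_simps)
  qed
  have "Clc M B \<subseteq> (\<Union>n m. A n m)"
  proof
    fix x assume x: "x \<in> Clc M B"
    have "\<exists>n. l2_inner M (f x) (e n) \<noteq> 0"
    proof (rule ccontr)
      assume "\<not> (\<exists>n. l2_inner M (f x) (e n) \<noteq> 0)"
      then have "range e \<subseteq> {h \<in> LL. l2_inner M (f x) h = 0}" using e(1) by auto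
      from e(2)[OF closed_subspace_orth[OF fL[OF x]] this]
      have "l2_inner M (f x) (f x) = 0" using fL[OF x] by blast
      then show False using f(2)[OF x] l2_norm_power2[of M "f x"] by simp
    qed
    then obtain n where "(l2_inner M (f x) (e n))\<^sup>2 > 0" by auto
    then obtain m where "1 / real (Suc m) < (l2_inner M (f x) (e n))\<^sup>2"
      using nat_approx_posE by blast
    then have "x \<in> A n m" using x by (simp add: A_def)
    then show "x \<in> (\<Union>n m. A n m)" by blast
  qed
  moreover have "countable (\<Union>n m. A n m)" by (intro countable_UN[OF countableI_type] countable_finite fin)
  ultimately show ?thesis by (rule countable_subset)
qed

text \<open>Every projection \<open>cexp M y\<close> with \<open>y \<in> B\<close> acts on \<open>L2c M B x\<close> as \<open>0\<close> or \<open>1\<close>, depending only on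
  whether \<open>x \<subseteq> y\<close>; hence linear combinations of these projections and their strong limits act by
  scalars.\<close>
lemma noise_operators_scalar:
  assumes T: "T \<in> noise_operators M B" and x: "x \<in> Cl M B"
  obtains c where "\<And>g. g \<in> L2c M B x \<Longrightarrow> AE \<omega> in M. T g \<omega> = c * g \<omega>"
proof (cases "\<exists>g\<in>L2c M B x. \<not> (AE \<omega> in M. g \<omega> = 0)")
  case False
  have Tb: "T \<in> bounded_ops M" using T by (simp add: noise_operators_def)
  have "AE \<omega> in M. T g \<omega> = 0 * g \<omega>" if g: "g \<in> L2c M B x" for g
  proof -
    have gL: "g \<in> LL" by (rule L2c_LL[OF x g])
    have g0: "l2_dist M g (\<lambda>_. 0) = 0" using False g l2_dist_zero_iff[OF gL const_LL[of 0]] by blast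
    obtain K where K: "K > 0" "\<And>f g. f \<in> LL \<Longrightarrow> g \<in> LL \<Longrightarrow> l2_dist M (T f) (T g) \<le> K * l2_dist M f g"
      using bounded_ops_dist[OF Tb] by blast
    have "l2_dist M (T g) (T (\<lambda>_. 0)) = 0"
      using K(2)[OF gL const_LL[of 0]] g0 l2_dist_nonneg[of M "T g" "T (\<lambda>_. 0)"] by simp
    then have "AE \<omega> in M. T g \<omega> = T (\<lambda>_. 0) \<omega>"
      using l2_dist_zero_iff[OF bounded_ops_LL[OF Tb gL] bounded_ops_LL[OF Tb const_LL]] by simp
    with bounded_ops_zero[OF Tb] show ?thesis by eventually_elim simp
  qed
  then show ?thesis using that by blast
next
  case True
  then obtain g0 where g0: "g0 \<in> L2c M B x" "\<not> (AE \<omega> in M. g0 \<omega> = 0)" by blast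
  have Tb: "T \<in> bounded_ops M" using T by (simp add: noise_operators_def)
  have g0L: "g0 \<in> LL" by (rule L2c_LL[OF x g0(1)])
  define N where "N = l2_inner M g0 g0"
  have N: "N > 0"
    using l2_norm_zero_iff[OF g0L] g0(2) l2_norm_power2[of M g0] l2_norm_nonneg[of M g0]
    unfolding N_def by (metis zero_less_power2)
  \<comment> \<open>The only possible scalar is the Rayleigh quotient of \<open>T\<close> at \<open>g0\<close>.\<close>
  define c where "c = l2_inner M (T g0) g0 / N"
  have "AE \<omega> in M. T g \<omega> = c * g \<omega>" if g: "g \<in> L2c M B x" for g
  proof -
    have gL: "g \<in> LL" by (rule L2c_LL[OF x g])
    let ?K = "1 + l2_norm M g0 * l2_norm M g / N"
    have K: "?K > 0" using N by (intro add_pos_nonneg) auto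
    have "l2_dist M (T g) (\<lambda>\<omega>. c * g \<omega>) \<le> 0"
    proof (rule field_le_epsilon)
      fix e :: real assume e: "e > 0"
      define \<epsilon> where "\<epsilon> = e / ?K"
      have \<epsilon>: "\<epsilon> > 0" using e K by (simp add: \<epsilon>_def)
      have "finite {g0, g} \<and> {g0, g} \<subseteq> LL \<and> \<epsilon> > 0" using g0L gL \<epsilon> by simp
      then obtain F a where F: "finite F" "F \<subseteq> B"
        "\<forall>f\<in>{g0, g}. l2_norm M (\<lambda>\<omega>. T f \<omega> - (\<Sum>y\<in>F. a y * cexp M y f \<omega>)) < \<epsilon>"
        using T unfolding noise_operators_def mem_Collect_eq by meson
      \<comment> \<open>The scalar by which the approximating linear combination acts on \<open>L2c M B x\<close>.\<close>
      define d where "d = (\<Sum>y\<in>F. if x \<subseteq> y then a y else 0)"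
      have ap: "l2_dist M (T f) (\<lambda>\<omega>. d * f \<omega>) < \<epsilon>" if f: "f \<in> L2c M B x" "f \<in> {g0, g}" for f
      proof -
        have fL: "f \<in> LL" by (rule L2c_LL[OF x f(1)])
        have "AE \<omega> in M. \<forall>y\<in>F. cexp M y f \<omega> = (if x \<subseteq> y then 1 else 0) * f \<omega>"
        proof (rule AE_finite_allI[OF F(1)])
          fix y assume "y \<in> F"
          then have y: "y \<in> Cl M B" using F(2) B_Cl by blast
          show "AE \<omega> in M. cexp M y f \<omega> = (if x \<subseteq> y then 1 else 0) * f \<omega>"
            using L2c_cexp(2,3)[OF x y f(1)] by (cases "x \<subseteq> y") auto
        qed
        then have "AE \<omega> in M. d * f \<omega> = (\<Sum>y\<in>F. a y * cexp M y f \<omega>)"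
        proof eventually_elim
          case (elim \<omega>)
          have "(\<Sum>y\<in>F. a y * cexp M y f \<omega>) = (\<Sum>y\<in>F. (if x \<subseteq> y then a y else 0) * f \<omega>)"
            using elim by (intro sum.cong) auto
          then show ?case by (simp add: d_def sum_distrib_right)
        qed
        then have "l2_dist M (T f) (\<lambda>\<omega>. d * f \<omega>) = l2_dist M (T f) (\<lambda>\<omega>. \<Sum>y\<in>F. a y * cexp M y f \<omega>)"
          using F(2) B_subfield fL
          by (intro l2_dist_AE_cong bounded_ops_LL[OF Tb] L2_cmult L2_sum cexp_LL) auto
        then show ?thesis using F(3) f(2) unfolding l2_dist_def by auto
      qed
      have dg: "(\<lambda>\<omega>. d * f \<omega>) \<in> LL" "(\<lambda>\<omega>. c * f \<omega>) \<in> LL" if "f \<in> LL" for f using L2_cmult[OF that] by auto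
      have "\<bar>c * N - d * N\<bar> = \<bar>l2_inner M (T g0) g0 - l2_inner M (\<lambda>\<omega>. d * g0 \<omega>) g0\<bar>"
        using l2_inner_lincomb_left[OF g0L g0L g0L, of d 0] N by (simp add: c_def N_def)
      also have "\<dots> \<le> l2_dist M (T g0) (\<lambda>\<omega>. d * g0 \<omega>) * l2_norm M g0"
        by (rule l2_inner_dist_bound[OF bounded_ops_LL[OF Tb g0L] dg(1)[OF g0L] g0L])
      also have "\<dots> \<le> \<epsilon> * l2_norm M g0" using ap[OF g0(1)] by (intro mult_right_mono) auto
      finally have "\<bar>d - c\<bar> * N \<le> \<epsilon> * l2_norm M g0"
        using N by (simp add: left_diff_distrib[symmetric] abs_mult abs_minus_commute)
      then have dc: "\<bar>d - c\<bar> \<le> \<epsilon> * l2_norm M g0 / N" using N by (simp add: field_simps)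
      have "l2_dist M (T g) (\<lambda>\<omega>. c * g \<omega>) \<le> l2_dist M (T g) (\<lambda>\<omega>. d * g \<omega>) + l2_dist M (\<lambda>\<omega>. d * g \<omega>) (\<lambda>\<omega>. c * g \<omega>)"
        by (rule l2_dist_triangle[OF bounded_ops_LL[OF Tb gL] dg[OF gL]])
      also have "l2_dist M (\<lambda>\<omega>. d * g \<omega>) (\<lambda>\<omega>. c * g \<omega>) = \<bar>d - c\<bar> * l2_norm M g"
        using l2_norm_cmult[of M "d - c" g] by (simp add: l2_dist_def left_diff_distrib)
      also have "l2_dist M (T g) (\<lambda>\<omega>. d * g \<omega>) + \<bar>d - c\<bar> * l2_norm M g
          \<le> \<epsilon> + \<epsilon> * l2_norm M g0 / N * l2_norm M g"
        using ap[OF g] dc by (intro add_mono mult_right_mono) auto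
      also have "\<dots> = \<epsilon> * ?K" by (simp add: algebra_simps)
      also have "\<dots> = e" using K by (simp add: \<epsilon>_def)
      finally show "l2_dist M (T g) (\<lambda>\<omega>. c * g \<omega>) \<le> 0 + e" by simp
    qed
    then have "l2_dist M (T g) (\<lambda>\<omega>. c * g \<omega>) = 0" using l2_dist_nonneg[of M "T g"] by (simp add: order_antisym)
    then show ?thesis using l2_dist_zero_iff[OF bounded_ops_LL[OF Tb gL] L2_cmult[OF gL]] by blast
  qed
  then show ?thesis using that by blast
qed

lemma cexp_noise_operators:
  assumes x: "x \<in> Cl M B" shows "cexp M x \<in> noise_operators M B"
  unfolding noise_operators_def
proof (intro CollectI conjI allI impI)
  show "cexp M x \<in> bounded_ops M" by (rule cexp_bounded_ops[OF Cl_subfields[OF x]])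
  fix G and \<epsilon> :: real assume G: "finite G \<and> G \<subseteq> LL \<and> \<epsilon> > 0"
  then obtain y where y: "y \<in> B" "\<forall>f\<in>G. l2_dist M (cexp M y f) (cexp M x f) < \<epsilon>"
    using x unfolding Cl_iff[OF B_sub] by blast
  have "l2_norm M (\<lambda>\<omega>. cexp M x f \<omega> - (\<Sum>x\<in>{y}. 1 * cexp M x f \<omega>)) < \<epsilon>" if "f \<in> G" for f
    using y(2) that by (simp add: l2_dist_def[symmetric] l2_dist_commute[of M "cexp M x f"])
  then show "\<exists>F c. finite F \<and> F \<subseteq> B \<and> (\<forall>f\<in>G. l2_norm M (\<lambda>\<omega>. cexp M x f \<omega> - (\<Sum>x\<in>F. c x * cexp M x f \<omega>)) < \<epsilon>)"
    using y(1) by (intro exI[of _ "{y}"] exI[of _ "\<lambda>_. 1"]) auto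
qed

end


section \<open>The spectral resolution\<close>

text \<open>A noise Boolean algebra with a spectral resolution.\<close>
locale spectral_noise_algebra = noise_algebra M B for M :: "'a measure" and B +
  fixes \<mu> :: "'s measure" and H :: "'s \<Rightarrow> 'h::real_inner set" and \<SS> :: "('s \<Rightarrow> 'h) set"
    and \<Psi> :: "('a \<Rightarrow> real) \<Rightarrow> 's \<Rightarrow> 'h"
  assumes spectral: "spectral_resolution M B \<mu> H \<SS> \<Psi>"
begin

lemma standard: "standard_measure_space \<mu>"
  and field: "measurable_field \<mu> H \<SS>"
  and fibres_nonzero: "AE s in \<mu>. H s \<noteq> {0}"
  and unitary: "unitary_iso M \<mu> \<SS> \<Psi>"
  and diagonal: "\<forall>T\<in>bounded_ops M. T \<in> noise_operators M B \<longleftrightarrow>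
        (\<exists>h\<in>Linfty \<mu>. \<forall>f\<in>LL. AE s in \<mu>. \<Psi> (T f) s = h s *\<^sub>R \<Psi> f s)"
proof -
  note * = spectral[unfolded spectral_resolution_def]
  show "standard_measure_space \<mu>" by (rule *[THEN conjunct1])
  show "measurable_field \<mu> H \<SS>" by (rule *[THEN conjunct2, THEN conjunct1])
  show "AE s in \<mu>. H s \<noteq> {0}" by (rule *[THEN conjunct2, THEN conjunct2, THEN conjunct1])
  show "unitary_iso M \<mu> \<SS> \<Psi>" by (rule *[THEN conjunct2, THEN conjunct2, THEN conjunct2, THEN conjunct1])
  show "\<forall>T\<in>bounded_ops M. T \<in> noise_operators M B \<longleftrightarrow>
        (\<exists>h\<in>Linfty \<mu>. \<forall>f\<in>LL. AE s in \<mu>. \<Psi> (T f) s = h s *\<^sub>R \<Psi> f s)"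
    by (rule *[THEN conjunct2, THEN conjunct2, THEN conjunct2, THEN conjunct2])
qed

lemma section_fibre: "\<xi> \<in> \<SS> \<Longrightarrow> s \<in> space \<mu> \<Longrightarrow> \<xi> s \<in> H s"
  and fibre_subspace: "s \<in> space \<mu> \<Longrightarrow> subspace (H s)"
  and section_lincomb: "\<xi> \<in> \<SS> \<Longrightarrow> \<eta> \<in> \<SS> \<Longrightarrow> (\<lambda>s. a *\<^sub>R \<xi> s + b *\<^sub>R \<eta> s) \<in> \<SS>"
  and section_norm_measurable: "\<xi> \<in> \<SS> \<Longrightarrow> (\<lambda>s. norm (\<xi> s)) \<in> borel_measurable \<mu>"
proof -
  note * = field[unfolded measurable_field_def]
  show "\<xi> \<in> \<SS> \<Longrightarrow> s \<in> space \<mu> \<Longrightarrow> \<xi> s \<in> H s"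
    using *[THEN conjunct2, THEN conjunct1] by blast
  show "s \<in> space \<mu> \<Longrightarrow> subspace (H s)" using *[THEN conjunct1] by blast
  show "\<xi> \<in> \<SS> \<Longrightarrow> \<eta> \<in> \<SS> \<Longrightarrow> (\<lambda>s. a *\<^sub>R \<xi> s + b *\<^sub>R \<eta> s) \<in> \<SS>"
    using *[THEN conjunct2, THEN conjunct2, THEN conjunct1] by blast
  show "\<xi> \<in> \<SS> \<Longrightarrow> (\<lambda>s. norm (\<xi> s)) \<in> borel_measurable \<mu>"
    using *[THEN conjunct2, THEN conjunct2, THEN conjunct2, THEN conjunct1] by blast
qed

lemma section_complete:
  assumes "\<And>s. s \<in> space \<mu> \<Longrightarrow> \<eta> s \<in> H s" "\<And>\<xi>. \<xi> \<in> \<SS> \<Longrightarrow> (\<lambda>s. \<xi> s \<bullet> \<eta> s) \<in> borel_measurable \<mu>"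
  shows "\<eta> \<in> \<SS>"
  using field[unfolded measurable_field_def, THEN conjunct2, THEN conjunct2, THEN conjunct2,
      THEN conjunct2, THEN conjunct1] assms by blast

lemma section_total:
  "\<exists>e::nat \<Rightarrow> 's \<Rightarrow> 'h. (\<forall>n. e n \<in> \<SS>) \<and> (\<forall>s\<in>space \<mu>. H s = closure (span (range (\<lambda>n. e n s))))"
  by (rule field[unfolded measurable_field_def, THEN conjunct2, THEN conjunct2, THEN conjunct2,
        THEN conjunct2, THEN conjunct2])

lemma section_inner_measurable:
  assumes "\<xi> \<in> \<SS>" "\<eta> \<in> \<SS>" shows "(\<lambda>s. \<xi> s \<bullet> \<eta> s) \<in> borel_measurable \<mu>"
proof -
  have "(\<lambda>s. norm (\<xi> s + \<eta> s)) \<in> borel_measurable \<mu>"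
    using section_norm_measurable[OF section_lincomb[OF assms, of 1 1]] by simp
  then show ?thesis
    unfolding dot_norm using assms section_norm_measurable by simp
qed

lemma section_indicator:
  assumes "\<xi> \<in> \<SS>" "E \<in> sets \<mu>" shows "(\<lambda>s. indicat_real E s *\<^sub>R \<xi> s) \<in> \<SS>"
proof (rule section_complete)
  show "indicat_real E s *\<^sub>R \<xi> s \<in> H s" if "s \<in> space \<mu>" for s
    using subspace_scale[OF fibre_subspace[OF that] section_fibre[OF assms(1) that]] .
  show "(\<lambda>s. \<eta> s \<bullet> (indicat_real E s *\<^sub>R \<xi> s)) \<in> borel_measurable \<mu>" if "\<eta> \<in> \<SS>" for \<eta>
    using section_inner_measurable[OF that assms(1)] assms(2) by simp
qed

lemma Psi_DI: "f \<in> LL \<Longrightarrow> \<Psi> f \<in> direct_integral \<mu> \<SS>"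
  and Psi_lincomb: "f \<in> LL \<Longrightarrow> g \<in> LL \<Longrightarrow>
      AE s in \<mu>. \<Psi> (\<lambda>\<omega>. a * f \<omega> + b * g \<omega>) s = a *\<^sub>R \<Psi> f s + b *\<^sub>R \<Psi> g s"
  and Psi_inner: "f \<in> LL \<Longrightarrow> g \<in> LL \<Longrightarrow> l2_inner \<mu> (\<Psi> f) (\<Psi> g) = l2_inner M f g"
  and Psi_surj: "\<xi> \<in> direct_integral \<mu> \<SS> \<Longrightarrow> \<exists>f\<in>LL. AE s in \<mu>. \<Psi> f s = \<xi> s"
proof -
  note * = unitary[unfolded unitary_iso_def]
  show "f \<in> LL \<Longrightarrow> \<Psi> f \<in> direct_integral \<mu> \<SS>" using *[THEN conjunct1] by blast
  show "f \<in> LL \<Longrightarrow> g \<in> LL \<Longrightarrow> AE s in \<mu>. \<Psi> (\<lambda>\<omega>. a * f \<omega> + b * g \<omega>) s = a *\<^sub>R \<Psi> f s + b *\<^sub>R \<Psi> g s"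
    using *[THEN conjunct2, THEN conjunct1] by blast
  show "f \<in> LL \<Longrightarrow> g \<in> LL \<Longrightarrow> l2_inner \<mu> (\<Psi> f) (\<Psi> g) = l2_inner M f g"
    using *[THEN conjunct2, THEN conjunct2, THEN conjunct1] by blast
  show "\<xi> \<in> direct_integral \<mu> \<SS> \<Longrightarrow> \<exists>f\<in>LL. AE s in \<mu>. \<Psi> f s = \<xi> s"
    using *[THEN conjunct2, THEN conjunct2, THEN conjunct2] by blast
qed

lemma Psi_section: "f \<in> LL \<Longrightarrow> \<Psi> f \<in> \<SS>"
  and Psi_integrable: "f \<in> LL \<Longrightarrow> integrable \<mu> (\<lambda>s. (norm (\<Psi> f s))\<^sup>2)"
  using Psi_DI by (auto simp: direct_integral_def)

lemma Psi_norm: "f \<in> LL \<Longrightarrow> (\<integral>s. (norm (\<Psi> f s))\<^sup>2 \<partial>\<mu>) = (l2_norm M f)\<^sup>2"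
  using Psi_inner[of f f] l2_norm_power2[of M f] by (simp add: l2_inner_def power2_norm_eq_inner)

lemma Psi_zero_iff:
  assumes "f \<in> LL" shows "(AE \<omega> in M. f \<omega> = 0) \<longleftrightarrow> (AE s in \<mu>. \<Psi> f s = 0)"
  using Psi_norm[OF assms] l2_norm_zero_iff[OF assms]
    integral_nonneg_eq_0_iff_AE[OF Psi_integrable[OF assms]] by simp

lemma Psi_diff:
  assumes "f \<in> LL" "g \<in> LL" shows "AE s in \<mu>. \<Psi> (\<lambda>\<omega>. f \<omega> - g \<omega>) s = \<Psi> f s - \<Psi> g s"
  using Psi_lincomb[OF assms, of 1 "-1"] by simp

lemma Psi_eq_iff:
  assumes "f \<in> LL" "g \<in> LL" shows "(AE \<omega> in M. f \<omega> = g \<omega>) \<longleftrightarrow> (AE s in \<mu>. \<Psi> f s = \<Psi> g s)"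
proof -
  have "(AE \<omega> in M. f \<omega> = g \<omega>) \<longleftrightarrow> (AE s in \<mu>. \<Psi> (\<lambda>\<omega>. f \<omega> - g \<omega>) s = 0)"
    using Psi_zero_iff[OF L2_diff[OF assms]] by simp
  also have "\<dots> \<longleftrightarrow> (AE s in \<mu>. \<Psi> f s = \<Psi> g s)"
  proof
    assume "AE s in \<mu>. \<Psi> (\<lambda>\<omega>. f \<omega> - g \<omega>) s = 0"
    with Psi_diff[OF assms] show "AE s in \<mu>. \<Psi> f s = \<Psi> g s" by eventually_elim simp
  next
    assume "AE s in \<mu>. \<Psi> f s = \<Psi> g s"
    with Psi_diff[OF assms] show "AE s in \<mu>. \<Psi> (\<lambda>\<omega>. f \<omega> - g \<omega>) s = 0" by eventually_elim simp
  qed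
  finally show ?thesis .
qed

text \<open>Functions with almost everywhere disjoint spectral supports are orthogonal.\<close>
lemma Psi_disjoint_orth:
  assumes "f \<in> LL" "g \<in> LL" "AE s in \<mu>. \<Psi> f s = 0 \<or> \<Psi> g s = 0" shows "l2_inner M f g = 0"
proof -
  have "AE s in \<mu>. \<Psi> f s \<bullet> \<Psi> g s = 0" using assms(3) by eventually_elim auto
  then have "l2_inner \<mu> (\<Psi> f) (\<Psi> g) = 0" unfolding l2_inner_def by (rule integral_eq_zero_AE)
  then show ?thesis using Psi_inner[OF assms(1,2)] by simp
qed

lemma direct_integral_indicator:
  assumes "f \<in> LL" "E \<in> sets \<mu>" shows "(\<lambda>s. indicat_real E s *\<^sub>R \<Psi> f s) \<in> direct_integral \<mu> \<SS>"
proof -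
  have "integrable \<mu> (\<lambda>s. indicat_real E s *\<^sub>R (norm (\<Psi> f s))\<^sup>2)"
    by (rule integrable_mult_indicator[OF assms(2) Psi_integrable[OF assms(1)]])
  moreover have "indicat_real E s *\<^sub>R (norm (\<Psi> f s))\<^sup>2 = (norm (indicat_real E s *\<^sub>R \<Psi> f s))\<^sup>2" for s
    by (simp add: indicator_def)
  ultimately show ?thesis
    using section_indicator[OF Psi_section[OF assms(1)] assms(2)] by (simp add: direct_integral_def)
qed

text \<open>The spectral projection onto the part of \<open>L\<^sup>2\<close> over \<open>E\<close>.  The choice of a representative
  matters only up to almost everywhere equality.\<close>
definition specproj :: "'s set \<Rightarrow> ('a \<Rightarrow> real) \<Rightarrow> ('a \<Rightarrow> real)" where
  "specproj E f = (SOME g. g \<in> LL \<and> (AE s in \<mu>. \<Psi> g s = indicat_real E s *\<^sub>R \<Psi> f s))"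

lemma
  assumes "f \<in> LL" "E \<in> sets \<mu>"
  shows specproj_LL: "specproj E f \<in> LL"
    and Psi_specproj: "AE s in \<mu>. \<Psi> (specproj E f) s = indicat_real E s *\<^sub>R \<Psi> f s"
proof -
  have "\<exists>g. g \<in> LL \<and> (AE s in \<mu>. \<Psi> g s = indicat_real E s *\<^sub>R \<Psi> f s)"
    using Psi_surj[OF direct_integral_indicator[OF assms]] by blast
  from someI_ex[OF this, folded specproj_def]
  show "specproj E f \<in> LL" "AE s in \<mu>. \<Psi> (specproj E f) s = indicat_real E s *\<^sub>R \<Psi> f s" by auto
qed

lemma specproj_bounded_ops:
  assumes E: "E \<in> sets \<mu>" shows "specproj E \<in> bounded_ops M"
  unfolding bounded_ops_def
proof (intro CollectI conjI ballI allI)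
  fix f g and a b :: real assume f: "f \<in> LL" and g: "g \<in> LL"
  note fg = L2_lincomb[OF f g, of a b] and P = specproj_LL[OF f E] specproj_LL[OF g E]
  have "AE s in \<mu>. \<Psi> (specproj E (\<lambda>\<omega>. a * f \<omega> + b * g \<omega>)) s
      = \<Psi> (\<lambda>\<omega>. a * specproj E f \<omega> + b * specproj E g \<omega>) s"
    using Psi_specproj[OF fg E] Psi_lincomb[OF f g, of a b] Psi_lincomb[OF P, of a b]
      Psi_specproj[OF f E] Psi_specproj[OF g E]
    by eventually_elim (simp add: algebra_simps)
  then show "AE \<omega> in M. specproj E (\<lambda>\<omega>. a * f \<omega> + b * g \<omega>) \<omega> = a * specproj E f \<omega> + b * specproj E g \<omega>"
    using Psi_eq_iff[OF specproj_LL[OF fg E] L2_lincomb[OF P]] by simp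
next
  have "l2_norm M (specproj E f) \<le> 1 * l2_norm M f" if f: "f \<in> LL" for f
  proof -
    note P = specproj_LL[OF f E]
    have "(l2_norm M (specproj E f))\<^sup>2 \<le> (l2_norm M f)\<^sup>2"
      unfolding Psi_norm[OF P, symmetric] Psi_norm[OF f, symmetric]
    proof (rule integral_mono_AE[OF Psi_integrable[OF P] Psi_integrable[OF f]])
      show "AE s in \<mu>. (norm (\<Psi> (specproj E f) s))\<^sup>2 \<le> (norm (\<Psi> f s))\<^sup>2"
        using Psi_specproj[OF f E] by eventually_elim (auto simp: indicator_def)
    qed
    then show ?thesis by (simp add: power_mono_iff)
  qed
  then show "\<exists>K. \<forall>f\<in>LL. l2_norm M (specproj E f) \<le> K * l2_norm M f" by blast
qed (rule specproj_LL[OF _ E])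

lemma specproj_noise_operators:
  assumes E: "E \<in> sets \<mu>" shows "specproj E \<in> noise_operators M B"
proof -
  have "indicat_real E \<in> Linfty \<mu>" using E by (auto simp: Linfty_def intro!: exI[of _ 1])
  then show ?thesis
    using diagonal specproj_bounded_ops[OF E] Psi_specproj[OF _ E] by blast
qed

text \<open>Being a diagonalizable projection, \<open>cexp M x\<close> is multiplication by an indicator.\<close>
lemma Cl_supp_ex:
  assumes x: "x \<in> Cl M B"
  shows "\<exists>S\<in>sets \<mu>. \<forall>f\<in>LL. AE s in \<mu>. \<Psi> (cexp M x f) s = indicat_real S s *\<^sub>R \<Psi> f s"
proof -
  note sx = Cl_subfields[OF x]
  obtain h where h: "h \<in> Linfty \<mu>" "\<And>f. f \<in> LL \<Longrightarrow> AE s in \<mu>. \<Psi> (cexp M x f) s = h s *\<^sub>R \<Psi> f s"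
    using diagonal cexp_bounded_ops[OF sx] cexp_noise_operators[OF x] by blast
  define S where "S = {s \<in> space \<mu>. h s = 1}"
  have [measurable]: "h \<in> borel_measurable \<mu>" using h(1) unfolding Linfty_def by blast
  have "S \<in> sets \<mu>" unfolding S_def by measurable
  moreover have "AE s in \<mu>. \<Psi> (cexp M x f) s = indicat_real S s *\<^sub>R \<Psi> f s" if f: "f \<in> LL" for f
  proof -
    note pf = cexp_LL[OF sx f]
    have "AE s in \<mu>. \<Psi> (cexp M x (cexp M x f)) s = \<Psi> (cexp M x f) s"
      using cexp_fixed[OF sx cexp_L2[OF sx f]] Psi_eq_iff[OF cexp_LL[OF sx pf] pf] by simp
    with h(2)[OF pf] h(2)[OF f] AE_space show ?thesis
    proof eventually_elim
      case (elim s)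
      then have "(h s * h s - h s) *\<^sub>R \<Psi> f s = 0" by (simp add: algebra_simps)
      then have "\<Psi> f s = 0 \<or> h s = 0 \<or> h s = 1" by (auto simp: algebra_simps)
      then show ?case using elim by (auto simp: S_def indicator_def)
    qed
  qed
  ultimately show ?thesis by blast
qed

text \<open>The spectral set of \<open>x\<close>: a measurable set, unique up to null sets, such that \<open>L2 M x\<close> is the
  spectral subspace over it (\<open>L2_supp\<close> below).\<close>
definition supp :: "'a set set \<Rightarrow> 's set" where
  "supp x = (SOME S. S \<in> sets \<mu> \<and> (\<forall>f\<in>LL. AE s in \<mu>. \<Psi> (cexp M x f) s = indicat_real S s *\<^sub>R \<Psi> f s))"

lemma
  assumes "x \<in> Cl M B"
  shows supp_sets: "supp x \<in> sets \<mu>"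
    and Psi_cexp: "f \<in> LL \<Longrightarrow> AE s in \<mu>. \<Psi> (cexp M x f) s = indicat_real (supp x) s *\<^sub>R \<Psi> f s"
proof -
  have "\<exists>S. S \<in> sets \<mu> \<and> (\<forall>f\<in>LL. AE s in \<mu>. \<Psi> (cexp M x f) s = indicat_real S s *\<^sub>R \<Psi> f s)"
    using Cl_supp_ex[OF assms] by blast
  from someI_ex[OF this, folded supp_def]
  show "supp x \<in> sets \<mu>" "f \<in> LL \<Longrightarrow> AE s in \<mu>. \<Psi> (cexp M x f) s = indicat_real (supp x) s *\<^sub>R \<Psi> f s" by auto
qed

lemma L2_supp:
  assumes x: "x \<in> Cl M B" and f: "f \<in> LL"
  shows "f \<in> L2 M x \<longleftrightarrow> (AE s in \<mu>. s \<notin> supp x \<longrightarrow> \<Psi> f s = 0)"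
proof -
  note sx = Cl_subfields[OF x]
  have "f \<in> L2 M x \<longleftrightarrow> (AE s in \<mu>. \<Psi> (cexp M x f) s = \<Psi> f s)"
    using L2_cexp_iff[OF sx f] Psi_eq_iff[OF cexp_LL[OF sx f] f] by simp
  also have "\<dots> \<longleftrightarrow> (AE s in \<mu>. s \<notin> supp x \<longrightarrow> \<Psi> f s = 0)"
  proof
    assume "AE s in \<mu>. \<Psi> (cexp M x f) s = \<Psi> f s"
    with Psi_cexp[OF x f] show "AE s in \<mu>. s \<notin> supp x \<longrightarrow> \<Psi> f s = 0" by eventually_elim auto
  next
    assume "AE s in \<mu>. s \<notin> supp x \<longrightarrow> \<Psi> f s = 0"
    with Psi_cexp[OF x f] show "AE s in \<mu>. \<Psi> (cexp M x f) s = \<Psi> f s"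
      by eventually_elim (auto simp: indicator_def)
  qed
  finally show ?thesis .
qed

lemma spectral_subspace_iff:
  "f \<in> spectral_subspace M \<mu> \<Psi> E \<longleftrightarrow> f \<in> LL \<and> (AE s in \<mu>. s \<notin> E \<longrightarrow> \<Psi> f s = 0)"
  by (simp add: spectral_subspace_def)

lemma specproj_spectral_subspace:
  assumes "f \<in> LL" "E \<in> sets \<mu>" shows "specproj E f \<in> spectral_subspace M \<mu> \<Psi> E"
  unfolding spectral_subspace_iff
proof (intro conjI specproj_LL assms)
  show "AE s in \<mu>. s \<notin> E \<longrightarrow> \<Psi> (specproj E f) s = 0"
    using Psi_specproj[OF assms] by eventually_elim auto
qed

lemma specproj_orth:
  assumes f: "f \<in> LL" and E: "E \<in> sets \<mu>" and g: "g \<in> spectral_subspace M \<mu> \<Psi> E"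
  shows "l2_inner M (\<lambda>\<omega>. f \<omega> - specproj E f \<omega>) g = 0"
proof (rule Psi_disjoint_orth)
  show "(\<lambda>\<omega>. f \<omega> - specproj E f \<omega>) \<in> LL" by (rule L2_diff[OF f specproj_LL[OF f E]])
  show "g \<in> LL" using g by (simp add: spectral_subspace_iff)
  have "AE s in \<mu>. s \<notin> E \<longrightarrow> \<Psi> g s = 0" using g by (simp add: spectral_subspace_iff)
  with Psi_diff[OF f specproj_LL[OF f E]] Psi_specproj[OF f E]
  show "AE s in \<mu>. \<Psi> (\<lambda>\<omega>. f \<omega> - specproj E f \<omega>) s = 0 \<or> \<Psi> g s = 0"
    by eventually_elim (auto simp: indicator_def)
qed


section \<open>Atoms\<close>

lemma null_set_iff_AE:
  assumes "E \<in> sets \<mu>" shows "emeasure \<mu> E = 0 \<longleftrightarrow> (AE s in \<mu>. s \<notin> E)"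
proof -
  have "{s \<in> space \<mu>. \<not> s \<notin> E} = E" using sets.sets_into_space[OF assms] by auto
  then show ?thesis using AE_iff_measurable[OF assms, of "\<lambda>s. s \<notin> E"] by simp
qed

lemma atom_sets: "measure_atom \<mu> Q \<Longrightarrow> Q \<in> sets \<mu>"
  by (simp add: measure_atom_def)

lemma atom_not_null: "measure_atom \<mu> Q \<Longrightarrow> \<not> (AE s in \<mu>. s \<notin> Q)"
  using null_set_iff_AE[of Q] by (auto simp: measure_atom_def)

lemma atom_cases:
  assumes "measure_atom \<mu> Q" "E \<in> sets \<mu>"
  shows "(AE s in \<mu>. s \<in> Q \<longrightarrow> s \<notin> E) \<or> (AE s in \<mu>. s \<in> Q \<longrightarrow> s \<in> E)"
proof -
  have Q: "Q \<in> sets \<mu>" using assms(1) by (rule atom_sets)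
  have "emeasure \<mu> (Q \<inter> E) = 0 \<or> emeasure \<mu> (Q - E) = 0"
    using assms by (auto simp: measure_atom_def)
  then have "(AE s in \<mu>. s \<notin> Q \<inter> E) \<or> (AE s in \<mu>. s \<notin> Q - E)"
    using null_set_iff_AE[of "Q \<inter> E"] null_set_iff_AE[of "Q - E"] Q assms(2) by auto
  then show ?thesis by auto
qed

lemma atoms_AE_eq:
  assumes Q: "measure_atom \<mu> Q" and Q': "measure_atom \<mu> Q'"
    and f: "f \<in> spectral_subspace M \<mu> \<Psi> Q" "f \<in> spectral_subspace M \<mu> \<Psi> Q'" "\<not> (AE \<omega> in M. f \<omega> = 0)"
  shows "AE s in \<mu>. s \<in> Q \<longleftrightarrow> s \<in> Q'"
proof -
  have fL: "f \<in> LL" and s: "AE s in \<mu>. s \<notin> Q \<longrightarrow> \<Psi> f s = 0" "AE s in \<mu>. s \<notin> Q' \<longrightarrow> \<Psi> f s = 0"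
    using f by (auto simp: spectral_subspace_iff)
  have n: "\<not> (AE s in \<mu>. s \<in> Q \<longrightarrow> s \<notin> Q')"
  proof
    assume "AE s in \<mu>. s \<in> Q \<longrightarrow> s \<notin> Q'"
    with s have "AE s in \<mu>. \<Psi> f s = 0" by eventually_elim auto
    then show False using f(3) Psi_zero_iff[OF fL] by simp
  qed
  have n': "\<not> (AE s in \<mu>. s \<in> Q' \<longrightarrow> s \<notin> Q)"
  proof
    assume "AE s in \<mu>. s \<in> Q' \<longrightarrow> s \<notin> Q"
    then have "AE s in \<mu>. s \<in> Q \<longrightarrow> s \<notin> Q'" by eventually_elim auto
    with n show False by simp
  qed
  have "AE s in \<mu>. s \<in> Q \<longrightarrow> s \<in> Q'" using atom_cases[OF Q atom_sets[OF Q']] n by blast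
  moreover have "AE s in \<mu>. s \<in> Q' \<longrightarrow> s \<in> Q" using atom_cases[OF Q' atom_sets[OF Q]] n' by blast
  ultimately show ?thesis by eventually_elim blast
qed

lemma spectral_subspace_mono_AE:
  assumes "AE s in \<mu>. s \<in> Q \<longleftrightarrow> s \<in> Q'"
  shows "spectral_subspace M \<mu> \<Psi> Q = spectral_subspace M \<mu> \<Psi> Q'"
proof -
  have "(AE s in \<mu>. s \<notin> Q \<longrightarrow> \<Psi> f s = 0) \<longleftrightarrow> (AE s in \<mu>. s \<notin> Q' \<longrightarrow> \<Psi> f s = 0)" for f
  proof
    assume "AE s in \<mu>. s \<notin> Q \<longrightarrow> \<Psi> f s = 0"
    with assms show "AE s in \<mu>. s \<notin> Q' \<longrightarrow> \<Psi> f s = 0" by eventually_elim blast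
  next
    assume "AE s in \<mu>. s \<notin> Q' \<longrightarrow> \<Psi> f s = 0"
    with assms show "AE s in \<mu>. s \<notin> Q \<longrightarrow> \<Psi> f s = 0" by eventually_elim blast
  qed
  then show ?thesis by (auto simp: spectral_subspace_iff)
qed

text \<open>The spectral support of any non-zero \<open>g\<close> in \<open>L2c M B x\<close> is an atom, since multiplication by
  indicators acts on \<open>L2c M B x\<close> by scalars; its spectral subspace is all of \<open>L2c M B x\<close>, since
  an atom lies almost inside or almost outside each spectral support \<open>supp y\<close>.\<close>
lemma L2c_atom:
  assumes xC: "x \<in> Clc M B"
  obtains Q where "measure_atom \<mu> Q" "L2c M B x = spectral_subspace M \<mu> \<Psi> Q"
proof -
  obtain g where x: "x \<in> Cl M B" and g: "g \<in> L2c M B x" "\<not> (AE \<omega> in M. g \<omega> = 0)" using ClcD[OF xC] by blast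
  have gL: "g \<in> LL" by (rule L2c_LL[OF x g(1)])
  have g0: "\<not> (AE s in \<mu>. \<Psi> g s = 0)" using g(2) Psi_zero_iff[OF gL] by simp
  define Q where "Q = {s \<in> space \<mu>. \<Psi> g s \<noteq> 0}"
  have Qm: "Q \<in> sets \<mu>"
  proof -
    have Q: "Q = {s \<in> space \<mu>. norm (\<Psi> g s) \<noteq> 0}" by (simp add: Q_def)
    note [measurable] = section_norm_measurable[OF Psi_section[OF gL]]
    show ?thesis unfolding Q by measurable
  qed
  have scal: "\<exists>c. \<forall>k\<in>L2c M B x. AE s in \<mu>. indicat_real E s *\<^sub>R \<Psi> k s = c *\<^sub>R \<Psi> k s" if E: "E \<in> sets \<mu>" for E
  proof -
    obtain c where c: "\<And>k. k \<in> L2c M B x \<Longrightarrow> AE \<omega> in M. specproj E k \<omega> = c * k \<omega>"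
      using noise_operators_scalar[OF specproj_noise_operators[OF E] x] by blast
    have "AE s in \<mu>. indicat_real E s *\<^sub>R \<Psi> k s = c *\<^sub>R \<Psi> k s" if k: "k \<in> L2c M B x" for k
    proof -
      have kL: "k \<in> LL" by (rule L2c_LL[OF x k])
      have "AE s in \<mu>. \<Psi> (specproj E k) s = \<Psi> (\<lambda>\<omega>. c * k \<omega>) s"
        using Psi_eq_iff[OF specproj_LL[OF kL E] L2_cmult[OF kL]] c[OF k] by simp
      with Psi_specproj[OF kL E] Psi_lincomb[OF kL kL, of c 0] show ?thesis
        by eventually_elim simp
    qed
    then show ?thesis by blast
  qed
  have atom: "measure_atom \<mu> Q"
    unfolding measure_atom_def
  proof (intro conjI ballI Qm)
    have "emeasure \<mu> Q \<noteq> 0"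
    proof
      assume "emeasure \<mu> Q = 0"
      then have "AE s in \<mu>. s \<notin> Q" using null_set_iff_AE[OF Qm] by simp
      with AE_space have "AE s in \<mu>. \<Psi> g s = 0" by eventually_elim (simp add: Q_def)
      with g0 show False by simp
    qed
    then show "emeasure \<mu> Q > 0" by (simp add: zero_less_iff_neq_zero)
  next
    fix E assume E: "E \<in> sets \<mu>"
    obtain c where c: "AE s in \<mu>. indicat_real E s *\<^sub>R \<Psi> g s = c *\<^sub>R \<Psi> g s" using scal[OF E] g(1) by blast
    show "emeasure \<mu> (Q \<inter> E) = 0 \<or> emeasure \<mu> (Q - E) = 0"
    proof (cases "c = 0")
      case True
      from c have "AE s in \<mu>. s \<notin> Q \<inter> E" by eventually_elim (auto simp: Q_def True)
      then show ?thesis using null_set_iff_AE[of "Q \<inter> E"] Qm E by auto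
    next
      case False
      from c have "AE s in \<mu>. s \<notin> Q - E" by eventually_elim (auto simp: Q_def False)
      then show ?thesis using null_set_iff_AE[of "Q - E"] Qm E by auto
    qed
  qed
  have "L2c M B x = spectral_subspace M \<mu> \<Psi> Q"
  proof (intro set_eqI iffI)
    fix k assume k: "k \<in> L2c M B x"
    obtain c where c: "\<And>k. k \<in> L2c M B x \<Longrightarrow> AE s in \<mu>. indicat_real Q s *\<^sub>R \<Psi> k s = c *\<^sub>R \<Psi> k s"
      using scal[OF Qm] by blast
    have "c = 1"
    proof (rule ccontr)
      assume "c \<noteq> 1"
      from c[OF g(1)] AE_space have "AE s in \<mu>. \<Psi> g s = 0"
      proof eventually_elim
        case (elim s)
        show ?case
        proof (rule ccontr)
          assume nz: "\<Psi> g s \<noteq> 0"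
          then have "1 *\<^sub>R \<Psi> g s = c *\<^sub>R \<Psi> g s" using elim by (simp add: Q_def)
          then show False using nz \<open>c \<noteq> 1\<close> by (simp only: scaleR_right_imp_eq scaleR_cancel_right) simp
        qed
      qed
      with g0 show False by simp
    qed
    from c[OF k] have "AE s in \<mu>. s \<notin> Q \<longrightarrow> \<Psi> k s = 0" by eventually_elim (auto simp: \<open>c = 1\<close>)
    then show "k \<in> spectral_subspace M \<mu> \<Psi> Q" using L2c_LL[OF x k] by (simp add: spectral_subspace_iff)
  next
    fix k assume k: "k \<in> spectral_subspace M \<mu> \<Psi> Q"
    then have kL: "k \<in> LL" and ks: "AE s in \<mu>. s \<notin> Q \<longrightarrow> \<Psi> k s = 0" by (auto simp: spectral_subspace_iff)
    show "k \<in> L2c M B x"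
      unfolding L2c_iff[OF x]
    proof (intro conjI ballI impI)
      have "AE s in \<mu>. s \<notin> supp x \<longrightarrow> \<Psi> g s = 0" using L2_supp[OF x gL] L2c_L2[OF g(1)] by simp
      with ks AE_space have "AE s in \<mu>. s \<notin> supp x \<longrightarrow> \<Psi> k s = 0"
        by eventually_elim (auto simp: Q_def)
      then show "k \<in> L2 M x" using L2_supp[OF x kL] by simp
    next
      fix y h assume y: "y \<in> Cl M B" "y \<subset> x" and h: "h \<in> L2 M y"
      note hL = L2_subsetD[OF h Cl_subfields[OF y(1)]]
      have hs: "AE s in \<mu>. s \<notin> supp y \<longrightarrow> \<Psi> h s = 0" using L2_supp[OF y(1) hL] h by simp
      have "AE \<omega> in M. cexp M y g \<omega> = 0" by (rule L2c_cexp(3)[OF x y(1) g(1)]) (use y(2) in auto)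
      then have "AE s in \<mu>. \<Psi> (cexp M y g) s = 0"
        using Psi_zero_iff[OF cexp_LL[OF Cl_subfields[OF y(1)] gL]] by simp
      with Psi_cexp[OF y(1) gL] have "AE s in \<mu>. s \<in> supp y \<longrightarrow> \<Psi> g s = 0" by eventually_elim auto
      with ks hs AE_space have "AE s in \<mu>. \<Psi> k s = 0 \<or> \<Psi> h s = 0"
        by eventually_elim (auto simp: Q_def)
      then show "l2_inner M k h = 0" by (rule Psi_disjoint_orth[OF kL hL])
    qed
  qed
  with atom that show ?thesis by blast
qed

text \<open>\<open>\<sigma>\<close>-finiteness of \<open>\<mu>\<close>, inherited from the measure of which \<open>\<mu>\<close> is the completion.\<close>
lemma exhausting_sequence:
  "\<exists>A :: nat \<Rightarrow> 's set. (\<forall>i. A i \<in> sets \<mu>) \<and> (\<forall>i. emeasure \<mu> (A i) < \<infinity>) \<and> (AE s in \<mu>. s \<in> (\<Union>i. A i))"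
proof -
  obtain \<nu> where \<nu>: "sigma_finite_measure \<nu>" "space \<nu> \<subseteq> space \<mu>"
    "sets \<mu> = {E \<union> N | E N. E \<in> sets (completion \<nu>) \<and> N \<subseteq> space \<mu> - space \<nu>}"
    "\<forall>E\<in>sets \<mu>. emeasure \<mu> E = emeasure (completion \<nu>) (E \<inter> space \<nu>)"
    using standard unfolding standard_measure_space_def by blast
  interpret sigma_finite_measure \<nu> by (rule \<nu>(1))
  obtain A :: "nat \<Rightarrow> 's set" where A: "range A \<subseteq> sets \<nu>" "(\<Union>i. A i) = space \<nu>" "\<And>i. emeasure \<nu> (A i) \<noteq> \<infinity>"
    by (rule sigma_finite) blast
  have m: "E \<in> sets \<mu>" if "E \<in> sets \<nu>" for E
  proof -
    have "E \<union> {} \<in> sets \<mu>" unfolding \<nu>(3) using that by (intro CollectI exI[of _ E] exI[of _ "{}"]) simp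
    then show ?thesis by simp
  qed
  have Am: "A i \<in> sets \<nu>" for i using A(1) by auto
  have "emeasure \<mu> (A i) < \<infinity>" for i
  proof -
    have "emeasure \<mu> (A i) = emeasure (completion \<nu>) (A i \<inter> space \<nu>)" using \<nu>(4) m[OF Am] by blast
    also have "\<dots> = emeasure \<nu> (A i)" using Am sets.sets_into_space[OF Am] by (simp add: Int_absorb2)
    finally show ?thesis using A(3)[of i] by (simp add: less_top)
  qed
  moreover have "AE s in \<mu>. s \<in> (\<Union>i. A i)"
  proof -
    let ?N = "space \<mu> - space \<nu>"
    have N: "?N \<in> sets \<mu>" unfolding \<nu>(3) by (intro CollectI exI[of _ "{}"] exI[of _ ?N]) simp
    have "emeasure \<mu> ?N = emeasure (completion \<nu>) (?N \<inter> space \<nu>)" using \<nu>(4) N by blast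
    also have "?N \<inter> space \<nu> = {}" by blast
    finally have "emeasure \<mu> ?N = 0" by simp
    then have "AE s in \<mu>. s \<notin> ?N" using null_set_iff_AE[OF N] by simp
    with AE_space show ?thesis by eventually_elim (simp add: A(2))
  qed
  ultimately show ?thesis using m[OF Am] by (intro exI[of _ A]) simp
qed

lemma spectral_subspace_nontrivial:
  assumes Q: "Q \<in> sets \<mu>" "\<not> (AE s in \<mu>. s \<notin> Q)"
  obtains f where "f \<in> spectral_subspace M \<mu> \<Psi> Q" "\<not> (AE \<omega> in M. f \<omega> = 0)"
proof -
  obtain A :: "nat \<Rightarrow> 's set" where A': "\<forall>i. A i \<in> sets \<mu>" "\<forall>i. emeasure \<mu> (A i) < \<infinity>" "AE s in \<mu>. s \<in> (\<Union>i. A i)"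
    using exhausting_sequence by (elim exE conjE) (rule that; assumption)
  note A = A'(1)[rule_format] A'(2)[rule_format] A'(3)
  obtain e :: "nat \<Rightarrow> 's \<Rightarrow> 'h" where e': "\<forall>n. e n \<in> \<SS>"
    "\<forall>s\<in>space \<mu>. H s = closure (span (range (\<lambda>n. e n s)))"
    using section_total by (elim exE conjE)
  note e = e'(1)[rule_format] e'(2)[rule_format]
  \<comment> \<open>On these sets, which cover almost all of \<open>Q\<close>, one section of a total sequence is non-zero and
    bounded, on a part of finite measure.\<close>
  define D where "D n i k = Q \<inter> A i \<inter> {s \<in> space \<mu>. norm (e n s) \<noteq> 0 \<and> norm (e n s) \<le> real k}" for n i k
  have Dm: "D n i k \<in> sets \<mu>" for n i k
  proof -
    note [measurable] = section_norm_measurable[OF e(1)] Q(1) A(1)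
    show ?thesis unfolding D_def by measurable
  qed
  have "\<exists>n i k. \<not> (AE s in \<mu>. s \<notin> D n i k)"
  proof (rule ccontr)
    assume "\<not> ?thesis"
    then have "AE s in \<mu>. s \<notin> D n i k" for n i k by blast
    then have "AE s in \<mu>. \<forall>k. s \<notin> D n i k" for n i by (subst AE_all_countable) blast
    then have "AE s in \<mu>. \<forall>i k. s \<notin> D n i k" for n by (subst AE_all_countable) blast
    then have "AE s in \<mu>. \<forall>n i k. s \<notin> D n i k" by (subst AE_all_countable) blast
    with A(3) fibres_nonzero AE_space have "AE s in \<mu>. s \<notin> Q"
    proof eventually_elim
      case (elim s)
      show ?case
      proof
        assume sQ: "s \<in> Q"
        obtain i where i: "s \<in> A i" using elim by blast
        have "\<exists>n. e n s \<noteq> 0"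
        proof (rule ccontr)
          assume "\<not> (\<exists>n. e n s \<noteq> 0)"
          then have "range (\<lambda>n. e n s) = {0}" by auto
          then have "H s = {0}" using e(2)[of s] elim by simp
          then show False using elim by simp
        qed
        then obtain n where n: "e n s \<noteq> 0" by blast
        obtain k :: nat where "norm (e n s) \<le> real k" using real_arch_simple by blast
        then have "s \<in> D n i k" using sQ i n elim by (simp add: D_def)
        then show False using elim by blast
      qed
    qed
    with Q(2) show False by simp
  qed
  then obtain n i k where D: "\<not> (AE s in \<mu>. s \<notin> D n i k)" by blast
  let ?\<xi> = "\<lambda>s. indicat_real (D n i k) s *\<^sub>R e n s"
  have \<xi>S: "?\<xi> \<in> \<SS>" by (rule section_indicator[OF e(1) Dm])
  have "integrable \<mu> (\<lambda>s. (norm (?\<xi> s))\<^sup>2)"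
  proof (rule integrableI_bounded_set[where A="A i" and B="(real k)\<^sup>2"])
    show "AE s in \<mu>. s \<in> A i \<longrightarrow> norm ((norm (?\<xi> s))\<^sup>2) \<le> (real k)\<^sup>2"
      by (intro AE_I2) (auto simp: indicator_def D_def intro!: power_mono)
    show "AE s in \<mu>. s \<notin> A i \<longrightarrow> (norm (?\<xi> s))\<^sup>2 = 0"
      by (intro AE_I2) (auto simp: indicator_def D_def)
  qed (use A section_norm_measurable[OF \<xi>S] in auto)
  then obtain f where f: "f \<in> LL" "AE s in \<mu>. \<Psi> f s = ?\<xi> s"
    using Psi_surj[of ?\<xi>] \<xi>S by (auto simp: direct_integral_def)
  from f(2) have "AE s in \<mu>. s \<notin> Q \<longrightarrow> \<Psi> f s = 0" by eventually_elim (auto simp: D_def)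
  then have "f \<in> spectral_subspace M \<mu> \<Psi> Q" using f(1) by (simp add: spectral_subspace_iff)
  moreover have "\<not> (AE \<omega> in M. f \<omega> = 0)"
  proof
    assume "AE \<omega> in M. f \<omega> = 0"
    then have "AE s in \<mu>. \<Psi> f s = 0" using Psi_zero_iff[OF f(1)] by simp
    with f(2) have "AE s in \<mu>. s \<notin> D n i k" by eventually_elim (auto simp: D_def)
    with D show False by simp
  qed
  ultimately show ?thesis using that by blast
qed

lemma Psi_dist:
  assumes f: "f \<in> LL" and g: "g \<in> LL"
  shows "(l2_dist M f g)\<^sup>2 = (\<integral>s. (norm (\<Psi> f s - \<Psi> g s))\<^sup>2 \<partial>\<mu>)"
proof -
  have fg: "\<Psi> (\<lambda>\<omega>. f \<omega> - g \<omega>) \<in> \<SS>" by (rule Psi_section[OF L2_diff[OF f g]])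
  have "(\<lambda>s. 1 *\<^sub>R \<Psi> f s + (-1) *\<^sub>R \<Psi> g s) \<in> \<SS>" by (rule section_lincomb[OF Psi_section[OF f] Psi_section[OF g]])
  then have m: "(\<lambda>s. norm (\<Psi> f s - \<Psi> g s)) \<in> borel_measurable \<mu>" using section_norm_measurable by fastforce
  have "(l2_dist M f g)\<^sup>2 = (\<integral>s. (norm (\<Psi> (\<lambda>\<omega>. f \<omega> - g \<omega>) s))\<^sup>2 \<partial>\<mu>)"
    unfolding l2_dist_def by (rule Psi_norm[OF L2_diff[OF f g], symmetric])
  also have "\<dots> = (\<integral>s. (norm (\<Psi> f s - \<Psi> g s))\<^sup>2 \<partial>\<mu>)"
    using Psi_diff[OF f g] section_norm_measurable[OF fg] m by (intro integral_cong_AE) auto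
  finally show ?thesis .
qed

text \<open>The closure is stable under arbitrary intersections of families closed under binary ones.
  The limit of \<open>cexp M (z n) f\<close> along a decreasing sequence \<open>z\<close> that minimizes the norms exists by
  dominated convergence in the direct integral and is the projection of \<open>f\<close> for the intersection.\<close>
lemma Inter_Cl:
  assumes E: "E \<subseteq> Cl M B" "E \<noteq> {}" and meet: "\<And>y z. y \<in> E \<Longrightarrow> z \<in> E \<Longrightarrow> y \<inter> z \<in> E"
  shows "\<Inter>E \<in> Cl M B"
proof -
  let ?x = "\<Inter>E"
  have EC: "y \<in> Cl M B" "y \<in> subfields M" if "y \<in> E" for y using that E(1) Cl_subfields by auto
  have sx: "?x \<in> subfields M" using E EC by (intro Inter_subfield) auto
  have L2x: "p \<in> L2 M ?x" if "\<And>y. y \<in> E \<Longrightarrow> p \<in> L2 M y" for p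
  proof -
    obtain y where "y \<in> E" using E(2) by blast
    have "p \<in> borel_measurable (sigma (space M) ?x)"
    proof (rule measurableI)
      fix A :: "real set" assume A: "A \<in> sets borel"
      have "p -` A \<inter> space M \<in> y" if "y \<in> E" for y
        using measurable_sets[of p "sigma (space M) y" borel A] A \<open>\<And>y. y \<in> E \<Longrightarrow> p \<in> L2 M y\<close>[OF that] EC(2)[OF that]
        by (simp add: L2_def)
      then have "p -` A \<inter> space M \<in> ?x" by (rule InterI)
      then show "p -` A \<inter> space (sigma (space M) ?x) \<in> sets (sigma (space M) ?x)"
        unfolding sets_subfield[OF sx] space_sigma_space .
    qed simp
    then show ?thesis using that[OF \<open>y \<in> E\<close>] by (simp add: L2_def)
  qed
  have approx: "\<exists>z\<in>E. l2_dist M (cexp M z f) (cexp M ?x f) < \<epsilon>" if f: "f \<in> LL" and \<epsilon>: "\<epsilon> > 0" for f \<epsilon>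
  proof -
    \<comment> \<open>\<open>z\<close> decreases within \<open>E\<close> and minimizes the norm of the projection of \<open>f\<close> in the limit;
      its spectral sets may be taken to decrease everywhere, to \<open>S'\<close>.\<close>
    define \<alpha> where "\<alpha> = (INF y\<in>E. (l2_norm M (cexp M y f))\<^sup>2)"
    have bdd: "bdd_below ((\<lambda>y. (l2_norm M (cexp M y f))\<^sup>2) ` E)" by (rule bdd_belowI2[of _ 0]) simp
    have low: "\<alpha> \<le> (l2_norm M (cexp M y f))\<^sup>2" if "y \<in> E" for y
      unfolding \<alpha>_def by (rule cINF_lower[OF bdd that])
    have "\<exists>w\<in>E. (l2_norm M (cexp M w f))\<^sup>2 < \<alpha> + 1 / real (Suc n)" for n
      using cINF_less_iff[OF E(2) bdd, of "\<alpha> + 1 / real (Suc n)"] unfolding \<alpha>_def[symmetric] by simp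
    then obtain w where w: "\<And>n. w n \<in> E" "\<And>n. (l2_norm M (cexp M (w n) f))\<^sup>2 < \<alpha> + 1 / real (Suc n)" by metis
    define z where "z n = (\<Inter>i\<le>n. w i)" for n
    define S where "S n = (\<Inter>i\<le>n. supp (w i))" for n
    have zS: "z (Suc n) = w (Suc n) \<inter> z n" "S (Suc n) = supp (w (Suc n)) \<inter> S n" for n
      by (auto simp: z_def S_def atMost_Suc)
    have z0: "z 0 = w 0" "S 0 = supp (w 0)" by (auto simp: z_def S_def)
    have zE: "z n \<in> E" for n by (induction n) (auto simp: zS z0 intro: w meet)
    have zw: "z n \<subseteq> w n" for n by (auto simp: z_def)
    have sz: "z n \<in> subfields M" for n by (rule EC(2)[OF zE])
    have Sm: "S n \<in> sets \<mu>" for n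
      by (induction n) (auto simp: zS z0 intro: supp_sets EC w)
    have Pz: "AE s in \<mu>. \<Psi> (cexp M (z n) f) s = indicat_real (S n) s *\<^sub>R \<Psi> f s" for n
    proof (induction n)
      case 0
      show ?case unfolding z0 by (rule Psi_cexp[OF EC(1)[OF w(1)] f])
    next
      case (Suc n)
      note wC = EC(1)[OF w(1)[of "Suc n"]] and pf = cexp_LL[OF sz f, of n]
      have sm: "w (Suc n) \<inter> z n \<in> subfields M" using sz[of "Suc n"] unfolding zS .
      have "AE s in \<mu>. \<Psi> (cexp M (w (Suc n)) (cexp M (z n) f)) s = \<Psi> (cexp M (w (Suc n) \<inter> z n) f) s"
        using Cl_cexp[OF wC EC(1)[OF zE[of n]] f] Psi_eq_iff[OF cexp_LL[OF Cl_subfields[OF wC] pf] cexp_LL[OF sm f]]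
        by simp
      with Psi_cexp[OF wC pf] Suc.IH show ?case
        unfolding zS by eventually_elim (auto simp: indicator_def)
    qed
    define S' where "S' = (\<Inter>n. S n)"
    have S'm: "S' \<in> sets \<mu>" unfolding S'_def using Sm by auto
    define p where "p = specproj S' f"
    have pL: "p \<in> LL" unfolding p_def by (rule specproj_LL[OF f S'm])
    have Pp: "AE s in \<mu>. \<Psi> p s = indicat_real S' s *\<^sub>R \<Psi> f s" unfolding p_def by (rule Psi_specproj[OF f S'm])
    have Sdec: "S m \<subseteq> S n" if "n \<le> m" for n m unfolding S_def using that by auto
    have lim: "(\<lambda>n. l2_dist M (cexp M (z n) f) p) \<longlonglongrightarrow> 0"
    proof -
      have m: "(\<lambda>s. norm (\<Psi> (cexp M (z n) f) s - \<Psi> p s)) \<in> borel_measurable \<mu>" for n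
        using section_norm_measurable[OF section_lincomb[OF Psi_section[OF cexp_LL[OF sz f]] Psi_section[OF pL], where a=1 and b="-1"]] by simp
      have all: "AE s in \<mu>. \<forall>n. \<Psi> (cexp M (z n) f) s = indicat_real (S n) s *\<^sub>R \<Psi> f s"
        using Pz by (simp add: AE_all_countable)
      have "(\<lambda>n. \<integral>s. (norm (\<Psi> (cexp M (z n) f) s - \<Psi> p s))\<^sup>2 \<partial>\<mu>) \<longlonglongrightarrow> (\<integral>s. 0 \<partial>\<mu>)"
      proof (rule integral_dominated_convergence[where w="\<lambda>s. (norm (\<Psi> f s))\<^sup>2"])
        from all Pp show "AE s in \<mu>. (\<lambda>n. (norm (\<Psi> (cexp M (z n) f) s - \<Psi> p s))\<^sup>2) \<longlonglongrightarrow> 0"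
        proof eventually_elim
          case (elim s)
          have "\<forall>\<^sub>F n in sequentially. (norm (\<Psi> (cexp M (z n) f) s - \<Psi> p s))\<^sup>2 = 0"
          proof (cases "s \<in> S'")
            case True
            then show ?thesis using elim by (auto simp: S'_def)
          next
            case False
            then obtain N where "s \<notin> S N" by (auto simp: S'_def)
            then have "s \<notin> S n" if "n \<ge> N" for n using Sdec[OF that] by blast
            then show ?thesis using elim False by (intro eventually_sequentiallyI[of N]) auto
          qed
          then show ?case by (rule tendsto_eventually)
        qed
        fix n
        from all Pp show "AE s in \<mu>. norm ((norm (\<Psi> (cexp M (z n) f) s - \<Psi> p s))\<^sup>2) \<le> (norm (\<Psi> f s))\<^sup>2"
          by eventually_elim (auto simp: indicator_def S'_def)
      qed (use m Psi_integrable[OF f] in auto)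
      then have "(\<lambda>n. (l2_dist M (cexp M (z n) f) p)\<^sup>2) \<longlonglongrightarrow> 0"
        using Psi_dist[OF cexp_LL[OF sz f] pL] by simp
      then have "(\<lambda>n. sqrt ((l2_dist M (cexp M (z n) f) p)\<^sup>2)) \<longlonglongrightarrow> sqrt 0" by (rule tendsto_real_sqrt)
      then show ?thesis by simp
    qed
    \<comment> \<open>By minimality, intersecting \<open>z n\<close> with \<open>v\<close> does not change the limit.\<close>
    have pE: "p \<in> L2 M v" if v: "v \<in> E" for v
    proof -
      note sv = EC(2)[OF v]
      note sm = inter_subfield[OF sv sz]
      have le: "l2_dist M (cexp M (v \<inter> z n) f) (cexp M (z n) f) \<le> sqrt (1 / real (Suc n))" for n
      proof -
        let ?a = "cexp M (z n) f" and ?b = "cexp M (v \<inter> z n) f"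
        note ab = cexp_LL[OF sz f, of n] cexp_LL[OF sm f, of n]
        have bz: "?b \<in> L2 M (z n)" using cexp_L2[OF sm f] L2_mono[OF sm sz] by blast
        have 1: "l2_inner M ?b ?b = l2_inner M f ?b" by (rule cexp_inner[OF sm f cexp_L2[OF sm f]])
        have 2: "l2_inner M ?a ?b = l2_inner M f ?b" by (rule cexp_inner[OF sz f bz])
        have d: "(\<lambda>\<omega>. ?b \<omega> - ?a \<omega>) \<in> LL" by (rule L2_diff[OF ab(2,1)])
        have "(l2_dist M ?b ?a)\<^sup>2 = l2_inner M ?b (\<lambda>\<omega>. ?b \<omega> - ?a \<omega>) - l2_inner M ?a (\<lambda>\<omega>. ?b \<omega> - ?a \<omega>)"
          unfolding l2_dist_def l2_norm_power2 by (rule l2_inner_diff_left[OF ab(2,1) d])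
        also have "l2_inner M ?b (\<lambda>\<omega>. ?b \<omega> - ?a \<omega>) = l2_inner M ?b ?b - l2_inner M ?a ?b"
          using l2_inner_diff_left[OF ab(2,1,2)] by (simp only: l2_inner_commute[of M ?b "\<lambda>\<omega>. ?b \<omega> - ?a \<omega>"])
        also have "l2_inner M ?a (\<lambda>\<omega>. ?b \<omega> - ?a \<omega>) = l2_inner M ?a ?b - l2_inner M ?a ?a"
          using l2_inner_diff_left[OF ab(2,1,1)]
          by (simp only: l2_inner_commute[of M ?a "\<lambda>\<omega>. ?b \<omega> - ?a \<omega>"] l2_inner_commute[of M ?b ?a])
        finally have "(l2_dist M ?b ?a)\<^sup>2 = (l2_norm M ?a)\<^sup>2 - (l2_norm M ?b)\<^sup>2"
          using 1 2 by (simp add: l2_norm_power2)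
        also have "(l2_norm M ?a)\<^sup>2 \<le> (l2_norm M (cexp M (w n) f))\<^sup>2"
        proof -
          note sw = EC(2)[OF w(1)]
          have "AE \<omega> in M. ?a \<omega> = cexp M (z n) (cexp M (w n) f) \<omega>"
            using cexp_tower[OF sz sw zw f, of n] by eventually_elim simp
          then have "l2_norm M ?a = l2_norm M (cexp M (z n) (cexp M (w n) f))"
            by (rule l2_norm_AE_cong) (auto intro!: LL_measurable cexp_LL sz sw f)
          then show ?thesis using cexp_norm_le[OF sz cexp_LL[OF sw f], of n n] by (auto intro!: power_mono)
        qed
        finally have "(l2_dist M ?b ?a)\<^sup>2 \<le> 1 / real (Suc n)"
          using w(2)[of n] low[OF meet[OF v zE], of n] by linarith
        then show ?thesis using real_le_rsqrt by blast
      qed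
      have "(\<lambda>n. l2_dist M (cexp M (v \<inter> z n) f) p) \<longlonglongrightarrow> 0"
      proof (rule tendsto_zero_bound)
        show "l2_dist M (cexp M (v \<inter> z n) f) p \<le> sqrt (1 / real (Suc n)) + l2_dist M (cexp M (z n) f) p" for n
          using l2_dist_triangle[OF cexp_LL[OF sm f] cexp_LL[OF sz f] pL, of n n] le[of n] by linarith
        have "(\<lambda>n. 1 / real (Suc n)) \<longlonglongrightarrow> 0" using LIMSEQ_inverse_real_of_nat by (simp add: inverse_eq_divide)
        then have "(\<lambda>n. sqrt (1 / real (Suc n)) + l2_dist M (cexp M (z n) f) p) \<longlonglongrightarrow> sqrt 0 + 0"
          by (intro tendsto_add tendsto_real_sqrt lim)
        then show "(\<lambda>n. sqrt (1 / real (Suc n)) + l2_dist M (cexp M (z n) f) p) \<longlonglongrightarrow> 0" by simp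
      qed simp
      moreover have "cexp M (v \<inter> z n) f \<in> L2 M v" for n
        using cexp_L2[OF sm f] L2_mono[OF sm sv] by blast
      ultimately show "p \<in> L2 M v"
      proof (intro closed_subspace_limit[OF closed_subspace_L2M[OF sv] pL])
        fix e :: real assume "e > 0"
          and l: "(\<lambda>n. l2_dist M (cexp M (v \<inter> z n) f) p) \<longlonglongrightarrow> 0" and m: "\<And>n. cexp M (v \<inter> z n) f \<in> L2 M v"
        then have "\<forall>\<^sub>F n in sequentially. l2_dist M (cexp M (v \<inter> z n) f) p < e" by (intro order_tendstoD)
        then obtain n where "l2_dist M (cexp M (v \<inter> z n) f) p < e" using eventually_happens'[OF sequentially_bot] by blast
        then show "\<exists>g\<in>L2 M v. l2_dist M p g < e" using m l2_dist_commute[of M p] by metis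
      qed
    qed
    have px: "p \<in> L2 M ?x" by (rule L2x[OF pE])
    have le: "l2_dist M (cexp M (z n) f) (cexp M ?x f) \<le> 3 * l2_dist M (cexp M (z n) f) p" for n
    proof -
      note pz = cexp_LL[OF sz f, of n]
      have "?x \<subseteq> z n" using zE by blast
      then have "l2_dist M (cexp M (z n) f) (cexp M ?x f) = l2_dist M (cexp M (z n) f) (cexp M ?x (cexp M (z n) f))"
      proof (intro l2_dist_AE_cong)
        assume "?x \<subseteq> z n"
        show "AE \<omega> in M. cexp M ?x f \<omega> = cexp M ?x (cexp M (z n) f) \<omega>"
          using cexp_tower[OF sx sz \<open>?x \<subseteq> z n\<close> f] by eventually_elim simp
      qed (auto intro!: cexp_LL sx sz f)
      also have "\<dots> \<le> 2 * l2_dist M (cexp M (z n) f) p"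
        using cexp_dist_approx[OF sx pz px] by (simp add: l2_dist_commute)
      finally show ?thesis using l2_dist_nonneg[of M "cexp M (z n) f" p] by linarith
    qed
    have "\<forall>\<^sub>F n in sequentially. l2_dist M (cexp M (z n) f) p < \<epsilon> / 3"
      using lim \<epsilon> by (intro order_tendstoD) auto
    then obtain n where "l2_dist M (cexp M (z n) f) p < \<epsilon> / 3" using eventually_happens'[OF sequentially_bot] by blast
    then show ?thesis using le[of n] zE[of n] by (intro bexI[of _ "z n"]) auto
  qed
  show ?thesis
  proof (rule Cl_I[OF B_sub sx])
    fix G and \<epsilon> :: real assume G: "finite G" "G \<subseteq> LL" "\<epsilon> > 0"
    have "\<exists>z\<in>E. \<forall>f\<in>G. l2_dist M (cexp M z f) (cexp M ?x f) < \<epsilon>"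
      using G(1,2)
    proof (induction G)
      case empty
      then show ?case using E(2) by auto
    next
      case (insert g G)
      obtain z where z: "z \<in> E" "\<forall>f\<in>G. l2_dist M (cexp M z f) (cexp M ?x f) < \<epsilon>" using insert by auto
      obtain y where y: "y \<in> E" "l2_dist M (cexp M y g) (cexp M ?x g) < \<epsilon>" using approx[of g \<epsilon>] insert(4) G(3) by auto
      have mono: "l2_dist M (cexp M (a \<inter> b) f) (cexp M ?x f) \<le> l2_dist M (cexp M a f) (cexp M ?x f)"
        if a: "a \<in> E" and b: "b \<in> E" and f: "f \<in> LL" for a b f
      proof -
        note s = EC(2)[OF a] EC(2)[OF meet[OF a b]]
        have xab: "?x \<subseteq> a \<inter> b" using a b by blast
        have "cexp M ?x f \<in> L2 M (a \<inter> b)" using cexp_L2[OF sx f] L2_mono[OF sx s(2) xab] by blast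
        then have "l2_dist M (cexp M (a \<inter> b) f) (cexp M ?x f)
            = l2_dist M (cexp M (a \<inter> b) (cexp M a f)) (cexp M (a \<inter> b) (cexp M ?x f))"
        proof (intro l2_dist_AE_cong)
          assume m: "cexp M ?x f \<in> L2 M (a \<inter> b)"
          show "AE \<omega> in M. cexp M (a \<inter> b) f \<omega> = cexp M (a \<inter> b) (cexp M a f) \<omega>"
            using cexp_tower[OF s(2) s(1) _ f] by (auto elim: eventually_mono)
          show "AE \<omega> in M. cexp M ?x f \<omega> = cexp M (a \<inter> b) (cexp M ?x f) \<omega>"
            using cexp_fixed[OF s(2) m] by eventually_elim simp
        qed (auto intro!: cexp_LL s sx f)
        also have "\<dots> \<le> l2_dist M (cexp M a f) (cexp M ?x f)" by (intro cexp_dist_le cexp_LL s sx f)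
        finally show ?thesis .
      qed
      have "l2_dist M (cexp M (z \<inter> y) f) (cexp M ?x f) < \<epsilon>" if "f \<in> insert g G" for f
      proof (cases "f = g")
        case True
        then show ?thesis using mono[OF y(1) z(1), of g] y(2) insert(4) by (simp add: Int_commute)
      next
        case False
        then show ?thesis using mono[OF z(1) y(1), of f] z(2) that insert(4) by fastforce
      qed
      then show ?case using meet[OF z(1) y(1)] by blast
    qed
    then show "\<exists>z\<in>Cl M B. \<forall>f\<in>G. l2_dist M (cexp M z f) (cexp M ?x f) < \<epsilon>" using E(1) by blast
  qed
qed

lemma sigma_gen_subset_iff:
  assumes y: "y \<in> subfields M" and G: "G \<subseteq> LL" shows "sigma_gen M G \<subseteq> y \<longleftrightarrow> G \<subseteq> L2 M y"
proof
  assume s: "sigma_gen M G \<subseteq> y"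
  show "G \<subseteq> L2 M y"
  proof
    fix f assume f: "f \<in> G"
    have "f \<in> borel_measurable (sigma (space M) y)"
    proof (rule measurableI)
      fix A :: "real set" assume "A \<in> sets borel"
      then have "f -` A \<inter> space M \<in> sigma_gen M G"
        unfolding sigma_gen_def using f by (intro sigma_sets.Basic) blast
      then show "f -` A \<inter> space (sigma (space M) y) \<in> sets (sigma (space M) y)" using s y by auto
    qed simp
    then show "f \<in> L2 M y" using f G by (auto simp: L2_def)
  qed
next
  assume s: "G \<subseteq> L2 M y"
  show "sigma_gen M G \<subseteq> y"
    unfolding sigma_gen_def
  proof (rule sigma_algebra.sigma_sets_subset[OF subfields_sigma[OF y]])
    have "f -` A \<inter> space M \<in> y" if "f \<in> G" "A \<in> sets borel" for f A
      using measurable_sets[of f "sigma (space M) y" borel A] that s y by (auto simp: L2_def)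
    moreover have "N \<in> y" if "N \<in> null_sets M" for N
      using that by (auto intro!: null_in_subfield[OF y] measure_eq_0_null_sets)
    ultimately show "{f -` A \<inter> space M | f A. f \<in> G \<and> A \<in> sets borel} \<union> null_sets M \<subseteq> y" by blast
  qed
qed

text \<open>Here \<open>x\<close> is the least element of the closure whose spectral set contains almost all of the atom
  \<open>Q\<close>; the spectral sets of smaller elements miss almost all of \<open>Q\<close>.\<close>
lemma atom_L2c:
  assumes Q: "measure_atom \<mu> Q"
  defines "x \<equiv> \<Inter>{y \<in> Cl M B. sigma_gen M (spectral_subspace M \<mu> \<Psi> Q) \<subseteq> y}"
  shows "x \<in> Clc M B" "spectral_subspace M \<mu> \<Psi> Q = L2c M B x"
proof -
  let ?HQ = "spectral_subspace M \<mu> \<Psi> Q"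
  let ?E = "{y \<in> Cl M B. sigma_gen M ?HQ \<subseteq> y}"
  have HL: "?HQ \<subseteq> LL" by (auto simp: spectral_subspace_iff)
  have iff: "sigma_gen M ?HQ \<subseteq> y \<longleftrightarrow> ?HQ \<subseteq> L2 M y" if "y \<in> Cl M B" for y
    by (rule sigma_gen_subset_iff[OF Cl_subfields[OF that] HL])
  have "sets M \<in> ?E" using iff[OF B_Cl[OF top_B]] HL B_Cl[OF top_B] by simp
  then have xC: "x \<in> Cl M B" unfolding x_def by (intro Inter_Cl) (auto intro: Cl_inter)
  have "sigma_gen M ?HQ \<subseteq> x" unfolding x_def by blast
  then have Hx: "?HQ \<subseteq> L2 M x" using iff[OF xC] by simp
  have sub: "?HQ \<subseteq> L2c M B x"
  proof
    fix f assume f: "f \<in> ?HQ"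
    then have fL: "f \<in> LL" and fs: "AE s in \<mu>. s \<notin> Q \<longrightarrow> \<Psi> f s = 0" by (auto simp: spectral_subspace_iff)
    show "f \<in> L2c M B x"
      unfolding L2c_iff[OF xC]
    proof (intro conjI ballI impI)
      show "f \<in> L2 M x" using f Hx by blast
      fix y g assume y: "y \<in> Cl M B" "y \<subset> x" and g: "g \<in> L2 M y"
      note gL = L2_subsetD[OF g Cl_subfields[OF y(1)]]
      have gs: "AE s in \<mu>. s \<notin> supp y \<longrightarrow> \<Psi> g s = 0" using L2_supp[OF y(1) gL] g by simp
      have "\<not> (AE s in \<mu>. s \<in> Q \<longrightarrow> s \<in> supp y)"
      proof
        assume in_supp: "AE s in \<mu>. s \<in> Q \<longrightarrow> s \<in> supp y"
        have "?HQ \<subseteq> L2 M y"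
        proof
          fix h assume "h \<in> ?HQ"
          then have h: "h \<in> LL" "AE s in \<mu>. s \<notin> Q \<longrightarrow> \<Psi> h s = 0" by (auto simp: spectral_subspace_iff)
          from h(2) in_supp have "AE s in \<mu>. s \<notin> supp y \<longrightarrow> \<Psi> h s = 0" by eventually_elim auto
          then show "h \<in> L2 M y" using L2_supp[OF y(1) h(1)] by simp
        qed
        then have "x \<subseteq> y" unfolding x_def using iff[OF y(1)] y(1) by blast
        then show False using y(2) by blast
      qed
      then have "AE s in \<mu>. s \<in> Q \<longrightarrow> s \<notin> supp y" using atom_cases[OF Q supp_sets[OF y(1)]] by blast
      with fs gs have "AE s in \<mu>. \<Psi> f s = 0 \<or> \<Psi> g s = 0" by eventually_elim auto
      then show "l2_inner M f g = 0" by (rule Psi_disjoint_orth[OF fL gL])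
    qed
  qed
  obtain f where f: "f \<in> ?HQ" "\<not> (AE \<omega> in M. f \<omega> = 0)"
    using spectral_subspace_nontrivial[OF atom_sets[OF Q] atom_not_null[OF Q]] by blast
  show xc: "x \<in> Clc M B" using xC sub f by (auto simp: Clc_def)
  obtain Q' where Q': "measure_atom \<mu> Q'" "L2c M B x = spectral_subspace M \<mu> \<Psi> Q'" using L2c_atom[OF xc] by blast
  have "AE s in \<mu>. s \<in> Q \<longleftrightarrow> s \<in> Q'" using atoms_AE_eq[OF Q Q'(1) f(1) _ f(2)] sub f(1) Q'(2) by blast
  then show "?HQ = L2c M B x" unfolding Q'(2) by (rule spectral_subspace_mono_AE)
qed

end


section \<open>Joins of independent elements\<close>

context noise_algebra
begin

text \<open>An independent factor can be cancelled from a join.\<close>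
lemma join_cancel:
  assumes u: "u \<in> subfields M" and v: "v \<in> subfields M" and i: "indep_set u v"
    and z: "z \<in> subfields M" "z \<subseteq> u" and y: "y \<in> subfields M" "y \<subseteq> v" and x: "x \<subseteq> u" "x \<subseteq> field_join M z y"
  shows "x \<subseteq> z"
proof
  note sj = join_subfield[OF z(1) y(1)]
  fix A assume "A \<in> x"
  then have A: "A \<in> u" "A \<in> field_join M z y" using x by auto
  then have Am: "A \<in> sets M" using subfields_events[OF u] by blast
  have "AE \<omega> in M. cexp M z (indicat_real A) \<omega> = indicat_real A \<omega>"
    using cexp_join_left[OF u v i z y indicator_L2[OF u A(1)]] cexp_fixed[OF sj indicator_L2[OF sj A(2)]]
    by eventually_elim simp
  then have "indicat_real A \<in> L2 M z"
    using L2_AE[OF z(1) cexp_L2[OF z(1) indicator_LL[OF Am]] indicator_LL[OF Am]] by blast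
  then show "A \<in> z" by (rule indicator_L2_mem[OF z(1) Am])
qed

text \<open>Integrating out the second factor of an element of \<open>L2c M B (x \<or> y)\<close> gives an element of
  \<open>L2c M B x\<close>.\<close>
lemma L2c_slice:
  assumes u: "u \<in> Cl M B" "u' \<in> Cl M B" "indep_complement M u u'"
    and x: "x \<in> Cl M B" "x \<subseteq> u" and y: "y \<in> Cl M B" "y \<subseteq> u'"
    and h: "h \<in> L2c M B (field_join M x y)" and C: "C \<in> y"
  shows "cexp M x (\<lambda>\<omega>. h \<omega> * indicat_real C \<omega>) \<in> L2c M B x"
  unfolding L2c_iff[OF x(1)]
proof (intro conjI ballI impI)
  note su = Cl_subfields[OF u(1)] Cl_subfields[OF u(2)] and sx = Cl_subfields[OF x(1)] and sy = Cl_subfields[OF y(1)]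
  note i = indep_complementD[OF u(3)]
  note j = join_Cl[OF u x y]
  have hL: "h \<in> LL" by (rule L2c_LL[OF j h])
  have Cm: "C \<in> sets M" using C subfields_events[OF sy] by blast
  have hC: "(\<lambda>\<omega>. h \<omega> * indicat_real C \<omega>) \<in> LL" by (rule mult_indicator_LL[OF hL Cm])
  show "cexp M x (\<lambda>\<omega>. h \<omega> * indicat_real C \<omega>) \<in> L2 M x" by (rule cexp_L2[OF sx hC])
  fix z k assume z: "z \<in> Cl M B" "z \<subset> x" and k: "k \<in> L2 M z"
  note sz = Cl_subfields[OF z(1)]
  have zu: "z \<subseteq> u" using z(2) x(2) by blast
  have "k \<in> L2 M x" using k L2_mono[OF sz sx] z(2) by blast
  then have "l2_inner M (cexp M x (\<lambda>\<omega>. h \<omega> * indicat_real C \<omega>)) k = l2_inner M (\<lambda>\<omega>. h \<omega> * indicat_real C \<omega>) k"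
    by (rule cexp_inner[OF sx hC])
  also have "\<dots> = l2_inner M h (\<lambda>\<omega>. k \<omega> * indicat_real C \<omega>)"
    by (simp add: l2_inner_real mult.assoc mult.commute[of "indicat_real C _"])
  also have "\<dots> = 0"
  proof -
    have kC: "(\<lambda>\<omega>. k \<omega> * indicat_real C \<omega>) \<in> L2 M (field_join M z y)"
      by (rule L2_join_mult[OF sz sy indep_subset[OF i(1) zu y(2)] k indicator_L2[OF sy C]])
    have zj: "field_join M z y \<in> Cl M B" by (rule join_Cl[OF u z(1) zu y])
    have "field_join M z y \<subseteq> field_join M x y" using z(2) by (intro join_mono) auto
    moreover have "field_join M z y \<noteq> field_join M x y"
    proof
      assume eq: "field_join M z y = field_join M x y"
      have "x \<subseteq> z"
        by (rule join_cancel[OF su i(1) sz zu sy y(2) x(2)]) (simp add: eq join_upper(1))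
      then show False using z(2) by blast
    qed
    ultimately have "field_join M z y \<subset> field_join M x y" by blast
    then show ?thesis using h[unfolded L2c_iff[OF j]] zj kC by blast
  qed
  finally show "l2_inner M (cexp M x (\<lambda>\<omega>. h \<omega> * indicat_real C \<omega>)) k = 0" .
qed

lemma closed_subspace_mult_orth:
  assumes u: "u \<in> subfields M" and v: "v \<in> subfields M" and i: "indep_set u v"
    and f: "f \<in> L2 M u" and h: "h \<in> LL"
  shows "closed_subspace M {g \<in> L2 M v. l2_inner M h (\<lambda>\<omega>. f \<omega> * g \<omega>) = 0}" (is "closed_subspace M ?V")
proof (rule closed_subspaceI)
  show "?V \<subseteq> LL" using L2_subset[OF v] by blast
  show "(\<lambda>_. 0) \<in> ?V" using const_L2[OF v, of 0] by (simp add: l2_inner_real)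
next
  fix g g' and a b :: real assume g: "g \<in> ?V" "g' \<in> ?V"
  then have fg: "(\<lambda>\<omega>. f \<omega> * g \<omega>) \<in> LL" "(\<lambda>\<omega>. f \<omega> * g' \<omega>) \<in> LL" using indep_mult_LL[OF u v i f] by auto
  have "l2_inner M h (\<lambda>\<omega>. f \<omega> * (a * g \<omega> + b * g' \<omega>))
      = l2_inner M (\<lambda>\<omega>. a * (f \<omega> * g \<omega>) + b * (f \<omega> * g' \<omega>)) h"
    unfolding l2_inner_commute[of M h] by (simp add: algebra_simps)
  also have "\<dots> = a * l2_inner M h (\<lambda>\<omega>. f \<omega> * g \<omega>) + b * l2_inner M h (\<lambda>\<omega>. f \<omega> * g' \<omega>)"
    unfolding l2_inner_lincomb_left[OF fg h] l2_inner_commute[of M h] ..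
  finally show "(\<lambda>\<omega>. a * g \<omega> + b * g' \<omega>) \<in> ?V"
    using g closed_subspace_lincomb[OF closed_subspace_L2M[OF v]] by simp
next
  fix g assume gL: "g \<in> LL" and ap: "\<And>\<epsilon>. \<epsilon> > 0 \<Longrightarrow> \<exists>g'\<in>?V. l2_dist M g g' < \<epsilon>"
  have g: "g \<in> L2 M v" by (rule closed_subspace_limit[OF closed_subspace_L2M[OF v] gL]) (use ap in blast)
  let ?K = "l2_norm M f * l2_norm M h + 1"
  have K: "?K > 0" by (intro add_nonneg_pos mult_nonneg_nonneg) auto
  have "\<bar>l2_inner M h (\<lambda>\<omega>. f \<omega> * g \<omega>)\<bar> \<le> 0"
  proof (rule field_le_epsilon)
    fix \<epsilon> :: real assume "\<epsilon> > 0"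
    then obtain g' where g': "g' \<in> L2 M v" "l2_inner M h (\<lambda>\<omega>. f \<omega> * g' \<omega>) = 0" "l2_dist M g g' < \<epsilon> / ?K"
      using ap[of "\<epsilon> / ?K"] K by auto
    have "\<bar>l2_inner M h (\<lambda>\<omega>. f \<omega> * g \<omega>)\<bar> \<le> l2_dist M (\<lambda>\<omega>. f \<omega> * g \<omega>) (\<lambda>\<omega>. f \<omega> * g' \<omega>) * l2_norm M h"
      using l2_inner_dist_bound[OF indep_mult_LL[OF u v i f g] indep_mult_LL[OF u v i f g'(1)] h] g'(2)
      by (simp only: l2_inner_commute[of M h])
    also have "\<dots> \<le> (l2_norm M f * l2_dist M g g') * l2_norm M h"
      using indep_mult_dist[OF u v i f f g g'(1)] by (intro mult_right_mono) auto
    also have "\<dots> = (l2_norm M f * l2_norm M h) * l2_dist M g g'" by simp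
    also have "\<dots> \<le> ?K * l2_dist M g g'" by (intro mult_right_mono) auto
    also have "\<dots> \<le> ?K * (\<epsilon> / ?K)" using g'(3) K by (intro mult_left_mono) auto
    also have "\<dots> = \<epsilon>" using K by simp
    finally show "\<bar>l2_inner M h (\<lambda>\<omega>. f \<omega> * g \<omega>)\<bar> \<le> 0 + \<epsilon>" by simp
  qed
  then show "g \<in> ?V" using g by simp
qed

text \<open>Elements of \<open>L2c M B (x \<or> y)\<close> are orthogonal to the products in \<open>L2 M x \<otimes> L2 M y\<close> whose first
  factor is orthogonal to \<open>L2c M B x\<close>.\<close>
lemma L2c_join_orth:
  assumes u: "u \<in> Cl M B" "u' \<in> Cl M B" "indep_complement M u u'"
    and x: "x \<in> Cl M B" "x \<subseteq> u" and y: "y \<in> Cl M B" "y \<subseteq> u'"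
    and h: "h \<in> L2c M B (field_join M x y)"
    and f: "f \<in> L2 M x" "\<And>k. k \<in> L2c M B x \<Longrightarrow> l2_inner M f k = 0" and g: "g \<in> L2 M y"
  shows "l2_inner M h (\<lambda>\<omega>. f \<omega> * g \<omega>) = 0"
proof -
  note sx = Cl_subfields[OF x(1)] and sy = Cl_subfields[OF y(1)]
  have ixy: "indep_set x y" by (rule indep_subset[OF indep_complementD(1)[OF u(3)] x(2) y(2)])
  have hL: "h \<in> LL" by (rule L2c_LL[OF join_Cl[OF u x y] h])
  have "L2 M y \<subseteq> {g \<in> L2 M y. l2_inner M h (\<lambda>\<omega>. f \<omega> * g \<omega>) = 0}"
  proof (rule L2_subset_closed_subspace_self[OF closed_subspace_mult_orth[OF sx sy ixy f(1) hL] sy])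
    fix C assume C: "C \<in> y"
    have hC: "(\<lambda>\<omega>. h \<omega> * indicat_real C \<omega>) \<in> LL"
      using C subfields_events[OF sy] by (intro mult_indicator_LL[OF hL]) auto
    have "l2_inner M h (\<lambda>\<omega>. f \<omega> * indicat_real C \<omega>) = l2_inner M (\<lambda>\<omega>. h \<omega> * indicat_real C \<omega>) f"
      by (simp add: l2_inner_real ac_simps)
    also have "\<dots> = l2_inner M (cexp M x (\<lambda>\<omega>. h \<omega> * indicat_real C \<omega>)) f"
      by (rule cexp_inner[OF sx hC f(1), symmetric])
    also have "\<dots> = 0"
      using f(2)[OF L2c_slice[OF u x y h C]] by (simp only: l2_inner_commute[of M f])
    finally show "indicat_real C \<in> {g \<in> L2 M y. l2_inner M h (\<lambda>\<omega>. f \<omega> * g \<omega>) = 0}"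
      using indicator_L2[OF sy C] by simp
  qed
  then show ?thesis using g by blast
qed

lemma L2c_mult:
  assumes u: "u \<in> Cl M B" "u' \<in> Cl M B" "indep_complement M u u'"
    and x: "x \<in> Cl M B" "x \<subseteq> u" and y: "y \<in> Cl M B" "y \<subseteq> u'"
    and f: "f \<in> L2c M B x" and g: "g \<in> L2c M B y"
  shows "(\<lambda>\<omega>. f \<omega> * g \<omega>) \<in> L2c M B (field_join M x y)"
  unfolding L2c_iff[OF join_Cl[OF u x y]]
proof (intro conjI ballI impI)
  note su = Cl_subfields[OF u(1)] Cl_subfields[OF u(2)] and sx = Cl_subfields[OF x(1)] and sy = Cl_subfields[OF y(1)]
  have ixy: "indep_set x y" by (rule indep_subset[OF indep_complementD(1)[OF u(3)] x(2) y(2)])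
  note fx = L2c_L2[OF f] and gy = L2c_L2[OF g]
  show "(\<lambda>\<omega>. f \<omega> * g \<omega>) \<in> L2 M (field_join M x y)" by (rule L2_join_mult[OF sx sy ixy fx gy])
  have fgL: "(\<lambda>\<omega>. f \<omega> * g \<omega>) \<in> LL" by (rule indep_mult_LL[OF sx sy ixy fx gy])
  fix z k assume z: "z \<in> Cl M B" "z \<subset> field_join M x y" and k: "k \<in> L2 M z"
  note sz = Cl_subfields[OF z(1)]
  have "f \<in> L2 M u" "g \<in> L2 M u'" using fx gy L2_mono sx sy su x(2) y(2) by blast+
  then have m: "AE \<omega> in M. cexp M z (\<lambda>\<omega>. f \<omega> * g \<omega>) \<omega> = cexp M z f \<omega> * cexp M z g \<omega>"
    by (rule splitsD[OF splits_compl[OF z(1) u]])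
  have "\<not> x \<subseteq> z \<or> \<not> y \<subseteq> z" using join_least[OF sz, of x y] z(2) by blast
  then have "AE \<omega> in M. cexp M z (\<lambda>\<omega>. f \<omega> * g \<omega>) \<omega> = 0"
  proof
    assume "\<not> x \<subseteq> z"
    from L2c_cexp(3)[OF x(1) z(1) f this] m show ?thesis by eventually_elim simp
  next
    assume "\<not> y \<subseteq> z"
    from L2c_cexp(3)[OF y(1) z(1) g this] m show ?thesis by eventually_elim simp
  qed
  then have "l2_inner M (cexp M z (\<lambda>\<omega>. f \<omega> * g \<omega>)) k = l2_inner M (\<lambda>_. 0) k"
    using LL_measurable cexp_LL[OF sz fgL] L2_subsetD[OF k sz] by (intro l2_inner_AE_cong) auto
  then show "l2_inner M (\<lambda>\<omega>. f \<omega> * g \<omega>) k = 0"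
    using cexp_inner[OF sz fgL k] by (simp add: l2_inner_real)
qed

text \<open>Products of independent functions vanish only trivially, as norms are multiplicative.\<close>
lemma mult_not_null:
  assumes "u \<in> subfields M" "v \<in> subfields M" "indep_set u v" "f \<in> L2 M u" "g \<in> L2 M v"
    and "\<not> (AE \<omega> in M. f \<omega> = 0)" "\<not> (AE \<omega> in M. g \<omega> = 0)"
  shows "\<not> (AE \<omega> in M. f \<omega> * g \<omega> = 0)"
  using indep_mult_norm[OF assms(1-5)] l2_norm_zero_iff[OF indep_mult_LL[OF assms(1-5)]] assms(6,7)
    l2_norm_zero_iff[OF L2_subsetD[OF assms(4,1)]] l2_norm_zero_iff[OF L2_subsetD[OF assms(5,2)]] by simp

lemma Clc_join:
  assumes u: "u \<in> Cl M B" "u' \<in> Cl M B" "indep_complement M u u'"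
    and x: "x \<in> Clc M B" "x \<subseteq> u" and y: "y \<in> Clc M B" "y \<subseteq> u'"
  shows "field_join M x y \<in> Clc M B"
proof -
  obtain f where f: "x \<in> Cl M B" "f \<in> L2c M B x" "\<not> (AE \<omega> in M. f \<omega> = 0)" using ClcD[OF x(1)] by blast
  obtain g where g: "y \<in> Cl M B" "g \<in> L2c M B y" "\<not> (AE \<omega> in M. g \<omega> = 0)" using ClcD[OF y(1)] by blast
  have "\<not> (AE \<omega> in M. f \<omega> * g \<omega> = 0)"
    by (rule mult_not_null[OF Cl_subfields[OF f(1)] Cl_subfields[OF g(1)]
          indep_subset[OF indep_complementD(1)[OF u(3)] x(2) y(2)] L2c_L2[OF f(2)] L2c_L2[OF g(2)] f(3) g(3)])
  then show ?thesis
    using L2c_mult[OF u f(1) x(2) g(1) y(2) f(2) g(2)] join_Cl[OF u f(1) x(2) g(1) y(2)]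
    unfolding Clc_def by (intro CollectI conjI bexI[of _ "\<lambda>\<omega>. f \<omega> * g \<omega>"])
qed


section \<open>The ideal \<open>Bc M B\<close>\<close>

text \<open>If \<open>L2c M B y\<close> were trivial, all slices of an element of \<open>L2c M B x\<close> along the part of \<open>x\<close>
  outside of \<open>y\<close> would vanish, and with them the element itself.\<close>
lemma Bc_downward:
  assumes x: "x \<in> Bc M B" and y: "y \<in> B" "y \<subseteq> x"
  shows "y \<in> Bc M B"
proof -
  have xB: "x \<in> B" and xC: "x \<in> Clc M B" using x by (auto simp: Bc_def)
  obtain h where h: "x \<in> Cl M B" "h \<in> L2c M B x" "\<not> (AE \<omega> in M. h \<omega> = 0)" using ClcD[OF xC] by blast
  obtain y' where y': "y' \<in> B" "indep_complement M y y'" using B_compl[OF y(1)] by blast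
  have bB: "x \<inter> y' \<in> B" by (rule B_inter[OF xB y'(1)])
  note sy = B_subfield[OF y(1)] and sb = B_subfield[OF bB]
  have "x \<inter> y = y" using y(2) by blast
  then have xj: "x = field_join M y (x \<inter> y')" using B_split[OF xB y(1) y'] by simp
  have hL: "h \<in> LL" by (rule L2c_LL[OF h(1,2)])
  have "\<exists>f\<in>L2c M B y. \<not> (AE \<omega> in M. f \<omega> = 0)"
  proof (rule ccontr)
    assume "\<not> ?thesis"
    then have null: "AE \<omega> in M. f \<omega> = 0" if "f \<in> L2c M B y" for f using that by blast
    have "L2 M (field_join M y (x \<inter> y')) \<subseteq> {k \<in> LL. l2_inner M h k = 0}"
    proof (rule L2_join_subset_closed_subspace[OF closed_subspace_orth[OF hL] sy sb])
      fix A C assume A: "A \<in> y" and C: "C \<in> x \<inter> y'"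
      have AC: "A \<in> sets M" "C \<in> sets M" using A C subfields_events sy sb by blast+
      have hC: "(\<lambda>\<omega>. h \<omega> * indicat_real C \<omega>) \<in> LL" by (rule mult_indicator_LL[OF hL AC(2)])
      have h': "h \<in> L2c M B (field_join M y (x \<inter> y'))" using h(2) xj by simp
      have "cexp M y (\<lambda>\<omega>. h \<omega> * indicat_real C \<omega>) \<in> L2c M B y"
        by (rule L2c_slice[OF B_Cl[OF y(1)] B_Cl[OF y'(1)] y'(2) B_Cl[OF y(1)] order_refl B_Cl[OF bB] Int_lower2 h' C])
      then have "AE \<omega> in M. cexp M y (\<lambda>\<omega>. h \<omega> * indicat_real C \<omega>) \<omega> = 0" by (rule null)
      then have "l2_inner M (cexp M y (\<lambda>\<omega>. h \<omega> * indicat_real C \<omega>)) (indicat_real A) = l2_inner M (\<lambda>_. 0) (indicat_real A)"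
        using LL_measurable cexp_LL[OF sy hC] AC by (intro l2_inner_AE_cong) auto
      then have "l2_inner M (\<lambda>\<omega>. h \<omega> * indicat_real C \<omega>) (indicat_real A) = 0"
        using cexp_inner[OF sy hC indicator_L2[OF sy A]] by (simp add: l2_inner_real)
      moreover have "(\<lambda>\<omega>. indicat_real A \<omega> * indicat_real C \<omega>) \<in> LL"
        by (rule mult_indicator_LL[OF indicator_LL[OF AC(1)] AC(2)])
      ultimately show "(\<lambda>\<omega>. indicat_real A \<omega> * indicat_real C \<omega>) \<in> {k \<in> LL. l2_inner M h k = 0}"
        by (simp add: l2_inner_real ac_simps)
    qed
    then have "l2_inner M h h = 0" using L2c_L2[OF h(2)] xj by auto
    then show False using l2_orth_self_zero[OF hL] h(3) by blast
  qed
  then show ?thesis using y(1) B_Cl[OF y(1)] by (simp add: Bc_def Clc_def)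
qed

text \<open>The join is that of \<open>x\<close> and the part of \<open>y\<close> outside of \<open>x\<close>, which is independent of \<open>x\<close>.\<close>
lemma Bc_join:
  assumes x: "x \<in> Bc M B" and y: "y \<in> Bc M B" shows "field_join M x y \<in> Bc M B"
proof -
  have xB: "x \<in> B" "x \<in> Clc M B" and yB: "y \<in> B" using x y by (auto simp: Bc_def)
  obtain x' where x': "x' \<in> B" "indep_complement M x x'" using B_compl[OF xB(1)] by blast
  have w: "y \<inter> x' \<in> Bc M B" by (rule Bc_downward[OF y B_inter[OF yB x'(1)]]) auto
  have "field_join M x (y \<inter> x') \<in> Clc M B"
    using w by (intro Clc_join[OF B_Cl[OF xB(1)] B_Cl[OF x'(1)] x'(2) xB(2) order_refl]) (auto simp: Bc_def)
  moreover have "field_join M x (y \<inter> x') = field_join M x y"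
  proof
    note sj = B_subfield[OF B_join[OF xB(1) B_inter[OF yB x'(1)]]]
    show "field_join M x (y \<inter> x') \<subseteq> field_join M x y" by (rule join_mono) auto
    have "y = field_join M (y \<inter> x) (y \<inter> x')" by (rule B_split[OF yB xB(1) x'])
    also have "\<dots> \<subseteq> field_join M x (y \<inter> x')" by (rule join_mono) auto
    finally show "field_join M x y \<subseteq> field_join M x (y \<inter> x')" by (rule join_least[OF sj join_upper(1)])
  qed
  ultimately show ?thesis using B_join[OF xB(1) yB] by (simp add: Bc_def)
qed

lemma Bc_ideal: "ideal_of M B (Bc M B)"
  unfolding ideal_of_def using bot_Bc Bc_downward Bc_join by (auto simp: Bc_def)

lemma countable_below_Bc:
  assumes "x \<in> Bc M B" shows "countable {y \<in> B. y \<subseteq> x}"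
proof (rule countable_subset[OF _ countable_Clc])
  show "{y \<in> B. y \<subseteq> x} \<subseteq> Clc M B" using Bc_downward[OF assms] by (auto simp: Bc_def)
qed


section \<open>The direct sum of the spaces \<open>L2c M B y\<close>\<close>

lemma Clc_L2c_LL: "(\<Union>y\<in>{y \<in> Clc M B. P y}. L2c M B y) \<subseteq> LL"
  using L2c_LL by (auto simp: Clc_def)

lemma sum_below_subset:
  assumes x: "x \<in> Cl M B" shows "closed_span M (\<Union>y\<in>{y \<in> Clc M B. y \<subseteq> x}. L2c M B y) \<subseteq> L2 M x"
proof (rule closed_span_subset_closed_subspace[OF closed_subspace_L2M[OF Cl_subfields[OF x]]])
  show "(\<Union>y\<in>{y \<in> Clc M B. y \<subseteq> x}. L2c M B y) \<subseteq> L2 M x"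
  proof
    fix f assume "f \<in> (\<Union>y\<in>{y \<in> Clc M B. y \<subseteq> x}. L2c M B y)"
    then obtain y where y: "y \<in> Cl M B" "y \<subseteq> x" "f \<in> L2c M B y" by (auto simp: Clc_def)
    then show "f \<in> L2 M x" using L2c_L2 L2_mono[OF Cl_subfields[OF y(1)] Cl_subfields[OF x] y(2)] by blast
  qed
qed

text \<open>By \<open>L2c_cexp\<close>, \<open>cexp M x\<close> maps the direct sum of all pieces into that of the pieces below \<open>x\<close>.\<close>
lemma sum_inter_L2:
  assumes x: "x \<in> Cl M B"
  shows "closed_span M (\<Union>y\<in>Clc M B. L2c M B y) \<inter> L2 M x =
    closed_span M (\<Union>y\<in>{y \<in> Clc M B. y \<subseteq> x}. L2c M B y)"
proof
  let ?V = "closed_span M (\<Union>y\<in>{y \<in> Clc M B. y \<subseteq> x}. L2c M B y)"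
  note sx = Cl_subfields[OF x]
  have V: "closed_subspace M ?V" by (rule closed_span_closed_subspace[OF Clc_L2c_LL])
  show "?V \<subseteq> closed_span M (\<Union>y\<in>Clc M B. L2c M B y) \<inter> L2 M x"
    using sum_below_subset[OF x] by (intro Int_greatest closed_span_mono) auto
  have "closed_span M (\<Union>y\<in>Clc M B. L2c M B y) \<subseteq> {f \<in> LL. cexp M x f \<in> ?V}"
  proof (rule closed_span_subset_closed_subspace[OF closed_subspace_vimage[OF cexp_bounded_ops[OF sx] V]], rule)
    fix f assume "f \<in> (\<Union>y\<in>Clc M B. L2c M B y)"
    then obtain y where yc: "y \<in> Clc M B" and f: "f \<in> L2c M B y" by blast
    have y: "y \<in> Cl M B" using yc by (simp add: Clc_def)
    have fL: "f \<in> LL" by (rule L2c_LL[OF y f])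
    have "cexp M x f \<in> ?V"
    proof (cases "y \<subseteq> x")
      case True
      have fV: "f \<in> ?V" using closed_span_base[OF Clc_L2c_LL, of f "\<lambda>y. y \<subseteq> x"] yc True f by blast
      have "AE \<omega> in M. f \<omega> = cexp M x f \<omega>" using L2c_cexp(2)[OF y x f True] by eventually_elim simp
      then show ?thesis by (rule closed_subspace_AE[OF V fV cexp_LL[OF sx fL]])
    next
      case False
      have "AE \<omega> in M. 0 = cexp M x f \<omega>" using L2c_cexp(3)[OF y x f False] by eventually_elim simp
      then show ?thesis by (rule closed_subspace_AE[OF V closed_subspace_zero[OF V] cexp_LL[OF sx fL]])
    qed
    then show "f \<in> {f \<in> LL. cexp M x f \<in> ?V}" using fL by simp
  qed
  then show "closed_span M (\<Union>y\<in>Clc M B. L2c M B y) \<inter> L2 M x \<subseteq> ?V"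
    using closed_subspace_AE[OF V _ _ cexp_fixed[OF sx]] by blast
qed

lemma sum_below_full:
  assumes a: "a \<in> subfields M"
    and full: "closed_span M (\<Union>y\<in>{y \<in> Clc M B. y \<subseteq> a}. L2c M B y) = L2 M a"
    and x: "x \<in> Cl M B" "x \<subseteq> a"
  shows "closed_span M (\<Union>y\<in>{y \<in> Clc M B. y \<subseteq> x}. L2c M B y) = L2 M x"
proof -
  have "L2 M x \<subseteq> L2 M a" by (rule L2_mono[OF Cl_subfields[OF x(1)] a x(2)])
  also have "\<dots> \<subseteq> closed_span M (\<Union>y\<in>Clc M B. L2c M B y)"
    unfolding full[symmetric] by (rule closed_span_mono) auto
  finally show ?thesis using sum_inter_L2[OF x(1)] by blast
qed

end


section \<open>Products of spectral pieces\<close>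

context spectral_noise_algebra
begin

lemma L2c_projection:
  assumes x: "x \<in> Clc M B"
  obtains T where "T \<in> bounded_ops M" "\<And>f. f \<in> LL \<Longrightarrow> T f \<in> L2c M B x"
    "\<And>f g. f \<in> LL \<Longrightarrow> g \<in> L2c M B x \<Longrightarrow> l2_inner M (\<lambda>\<omega>. f \<omega> - T f \<omega>) g = 0"
proof -
  obtain Q where Q: "measure_atom \<mu> Q" "L2c M B x = spectral_subspace M \<mu> \<Psi> Q" using L2c_atom[OF x] by blast
  note Qm = atom_sets[OF Q(1)]
  show ?thesis
    by (rule that[OF specproj_bounded_ops[OF Qm]])
      (use specproj_spectral_subspace[OF _ Qm] specproj_orth[OF _ Qm] Q(2) in auto)
qed

text \<open>With \<open>T1\<close>, \<open>T2\<close>, \<open>R\<close> the projections onto \<open>L2c M B x\<close>, \<open>L2c M B y\<close>, \<open>L2c M B (x \<or> y)\<close>, one has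
  \<open>R (f g) = T1 f T2 g\<close> for \<open>f\<close> in \<open>L2 M x\<close> and \<open>g\<close> in \<open>L2 M y\<close>; as the products are total in
  \<open>L2 M (x \<or> y)\<close>, this identifies the range of \<open>R\<close>.\<close>
lemma L2c_join:
  assumes u: "u \<in> Cl M B" "u' \<in> Cl M B" "indep_complement M u u'"
    and xc: "x \<in> Clc M B" "x \<subseteq> u" and yc: "y \<in> Clc M B" "y \<subseteq> u'"
  defines "G \<equiv> {\<lambda>\<omega>. f \<omega> * g \<omega> | f g. f \<in> L2c M B x \<and> g \<in> L2c M B y}"
  shows "G \<subseteq> LL" "L2c M B (field_join M x y) = closed_span M G"
proof -
  let ?j = "field_join M x y"
  have x: "x \<in> Cl M B" "x \<subseteq> u" and y: "y \<in> Cl M B" "y \<subseteq> u'" using xc yc by (auto simp: Clc_def)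
  note sx = Cl_subfields[OF x(1)] and sy = Cl_subfields[OF y(1)]
  have i: "indep_set x y" by (rule indep_subset[OF indep_complementD(1)[OF u(3)] x(2) y(2)])
  have j: "?j \<in> Cl M B" by (rule join_Cl[OF u x y])
  have jc: "?j \<in> Clc M B" by (rule Clc_join[OF u xc yc])
  have GL: "G \<subseteq> L2c M B ?j" unfolding G_def using L2c_mult[OF u x y] by blast
  then show GLL: "G \<subseteq> LL" using L2c_LL[OF j] by blast
  have V: "closed_subspace M (closed_span M G)" by (rule closed_span_closed_subspace[OF GLL])
  have "L2c M B ?j \<subseteq> closed_span M G"
  proof
    obtain T1 where T1: "T1 \<in> bounded_ops M" "\<And>f. f \<in> LL \<Longrightarrow> T1 f \<in> L2c M B x"
      "\<And>f g. f \<in> LL \<Longrightarrow> g \<in> L2c M B x \<Longrightarrow> l2_inner M (\<lambda>\<omega>. f \<omega> - T1 f \<omega>) g = 0"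
      using L2c_projection[OF xc(1)] by blast
    obtain T2 where T2: "T2 \<in> bounded_ops M" "\<And>f. f \<in> LL \<Longrightarrow> T2 f \<in> L2c M B y"
      "\<And>f g. f \<in> LL \<Longrightarrow> g \<in> L2c M B y \<Longrightarrow> l2_inner M (\<lambda>\<omega>. f \<omega> - T2 f \<omega>) g = 0"
      using L2c_projection[OF yc(1)] by blast
    obtain R where R: "R \<in> bounded_ops M" "\<And>f. f \<in> LL \<Longrightarrow> R f \<in> L2c M B ?j"
      "\<And>f g. f \<in> LL \<Longrightarrow> g \<in> L2c M B ?j \<Longrightarrow> l2_inner M (\<lambda>\<omega>. f \<omega> - R f \<omega>) g = 0"
      using L2c_projection[OF jc] by blast
    have sub: "L2 M ?j \<subseteq> {f \<in> LL. R f \<in> closed_span M G}"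
    proof (rule L2_join_subset_closed_subspace[OF closed_subspace_vimage[OF R(1) V] sx sy])
      fix A C assume "A \<in> x" "C \<in> y"
      define f g where "f = indicat_real A" and "g = indicat_real C"
      have f: "f \<in> L2 M x" and g: "g \<in> L2 M y"
        unfolding f_def g_def using indicator_L2 sx sy \<open>A \<in> x\<close> \<open>C \<in> y\<close> by auto
      note fL = L2_subsetD[OF f sx] and gL = L2_subsetD[OF g sy]
      note Tf = T1(2)[OF fL] and Tg = T2(2)[OF gL]
      note Tfx = L2c_L2[OF Tf] and Tgy = L2c_L2[OF Tg]
      have df: "(\<lambda>\<omega>. f \<omega> - T1 f \<omega>) \<in> L2 M x" by (rule closed_subspace_diff[OF closed_subspace_L2M[OF sx] f Tfx])
      have dg: "(\<lambda>\<omega>. g \<omega> - T2 g \<omega>) \<in> L2 M y" by (rule closed_subspace_diff[OF closed_subspace_L2M[OF sy] g Tgy])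
      have fgL: "(\<lambda>\<omega>. f \<omega> * g \<omega>) \<in> LL" by (rule indep_mult_LL[OF sx sy i f g])
      have TT: "(\<lambda>\<omega>. T1 f \<omega> * T2 g \<omega>) \<in> G" unfolding G_def using Tf Tg by blast
      note TTL = subsetD[OF GLL TT]
      let ?d = "\<lambda>\<omega>. R (\<lambda>\<omega>. f \<omega> * g \<omega>) \<omega> - T1 f \<omega> * T2 g \<omega>"
      have d: "?d \<in> L2c M B ?j"
        by (rule closed_subspace_diff[OF closed_subspace_L2c[OF j] R(2)[OF fgL] subsetD[OF GL TT]])
      note dL = L2c_LL[OF j d]
      have RL: "R (\<lambda>\<omega>. f \<omega> * g \<omega>) \<in> LL" by (rule L2c_LL[OF j R(2)[OF fgL]])
      have o1: "l2_inner M ?d (\<lambda>\<omega>. (f \<omega> - T1 f \<omega>) * g \<omega>) = 0"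
        by (rule L2c_join_orth[OF u x y d df T1(3)[OF fL] g])
      have d': "?d \<in> L2c M B (field_join M y x)" using d unfolding join_commute[of x] .
      have o2: "l2_inner M ?d (\<lambda>\<omega>. (g \<omega> - T2 g \<omega>) * T1 f \<omega>) = 0"
        by (rule L2c_join_orth[OF u(2,1) indep_complement_commute[OF u(3)] y x d' dg T2(3)[OF gL] Tfx])
      have p1: "(\<lambda>\<omega>. (f \<omega> - T1 f \<omega>) * g \<omega>) \<in> LL" by (rule indep_mult_LL[OF sx sy i df g])
      have p2: "(\<lambda>\<omega>. (g \<omega> - T2 g \<omega>) * T1 f \<omega>) \<in> LL"
        by (rule indep_mult_LL[OF sy sx indep_commute[OF i] dg Tfx])
      have "l2_inner M (\<lambda>\<omega>. f \<omega> * g \<omega> - T1 f \<omega> * T2 g \<omega>) ?d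
          = l2_inner M (\<lambda>\<omega>. 1 * ((f \<omega> - T1 f \<omega>) * g \<omega>) + 1 * ((g \<omega> - T2 g \<omega>) * T1 f \<omega>)) ?d"
        by (rule arg_cong[where f="\<lambda>h. l2_inner M h ?d"]) (auto simp: algebra_simps)
      also have "\<dots> = 0"
        unfolding l2_inner_lincomb_left[OF p1 p2 dL] using o1 o2
        by (simp only: l2_inner_commute[of M _ ?d])
      finally have 1: "l2_inner M (\<lambda>\<omega>. f \<omega> * g \<omega>) ?d = l2_inner M (\<lambda>\<omega>. T1 f \<omega> * T2 g \<omega>) ?d"
        unfolding l2_inner_diff_left[OF fgL TTL dL] by simp
      have 2: "l2_inner M (\<lambda>\<omega>. f \<omega> * g \<omega>) ?d = l2_inner M (R (\<lambda>\<omega>. f \<omega> * g \<omega>)) ?d"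
        using R(3)[OF fgL d] unfolding l2_inner_diff_left[OF fgL RL dL] by simp
      have "l2_inner M ?d ?d = 0" unfolding l2_inner_diff_left[OF RL TTL dL] using 1 2 by simp
      then have "AE \<omega> in M. ?d \<omega> = 0" by (rule l2_orth_self_zero[OF dL])
      then have "AE \<omega> in M. T1 f \<omega> * T2 g \<omega> = R (\<lambda>\<omega>. f \<omega> * g \<omega>) \<omega>" by eventually_elim simp
      then have "R (\<lambda>\<omega>. f \<omega> * g \<omega>) \<in> closed_span M G"
        by (rule closed_subspace_AE[OF V closed_span_base[OF GLL TT] RL])
      then show "(\<lambda>\<omega>. indicat_real A \<omega> * indicat_real C \<omega>) \<in> {f \<in> LL. R f \<in> closed_span M G}"
        using fgL unfolding f_def g_def by simp
    qed
    fix h assume h: "h \<in> L2c M B ?j"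
    note hL = L2c_LL[OF j h] and RL = L2c_LL[OF j R(2)[OF L2c_LL[OF j h]]]
    have RhV: "R h \<in> closed_span M G" using sub L2c_L2[OF h] by blast
    have d: "(\<lambda>\<omega>. h \<omega> - R h \<omega>) \<in> L2c M B ?j"
      by (rule closed_subspace_diff[OF closed_subspace_L2c[OF j] h R(2)[OF hL]])
    have "AE \<omega> in M. h \<omega> - R h \<omega> = 0"
      by (rule l2_orth_self_zero[OF L2c_LL[OF j d] R(3)[OF hL d]])
    then have "AE \<omega> in M. R h \<omega> = h \<omega>" by eventually_elim simp
    then show "h \<in> closed_span M G" by (rule closed_subspace_AE[OF V RhV hL])
  qed
  moreover have "closed_span M G \<subseteq> L2c M B ?j"
    by (rule closed_span_subset_closed_subspace[OF closed_subspace_L2c[OF j] GL])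
  ultimately show "L2c M B ?j = closed_span M G" by blast
qed

lemma L2c_join_indep:
  assumes xy: "(x \<in> Bc M B \<and> y \<in> Bc M B \<and> indep_set x y) \<or>
    (x \<in> Clc M B \<and> y \<in> Clc M B \<and>
      (\<exists>u\<in>noise_completion M B. \<exists>v\<in>noise_completion M B. x \<subseteq> u \<and> y \<subseteq> v \<and> indep_set u v))"
  shows "let G = {\<lambda>\<omega>. f \<omega> * g \<omega> | f g. f \<in> L2c M B x \<and> g \<in> L2c M B y} in
           field_join M x y \<in> Cl M B \<and> G \<subseteq> LL \<and> L2c M B (field_join M x y) = closed_span M G"
proof -
  have BC: "z \<in> noise_completion M B" if z: "z \<in> B" for z
    using B_compl[OF z] B_Cl z unfolding noise_completion_def by blast
  have "\<exists>u v. u \<in> noise_completion M B \<and> v \<in> noise_completion M B \<and> x \<in> Clc M B \<and> y \<in> Clc M B \<and>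
      x \<subseteq> u \<and> y \<subseteq> v \<and> indep_set u v"
    using xy BC unfolding Bc_def by blast
  then obtain u v where uv: "u \<in> noise_completion M B" "v \<in> noise_completion M B" "x \<in> Clc M B" "y \<in> Clc M B"
    "x \<subseteq> u" "y \<subseteq> v" "indep_set u v" by blast
  obtain u' where u: "u \<in> Cl M B" "u' \<in> Cl M B" "indep_complement M u u'"
    using uv(1) unfolding noise_completion_def by blast
  have v: "v \<in> Cl M B" using uv(2) unfolding noise_completion_def by blast
  have "y \<subseteq> u'" using indep_subset_complement[OF v u uv(7)] uv(6) by blast
  moreover have "x \<in> Cl M B" "y \<in> Cl M B" using uv(3,4) by (auto simp: Clc_def)
  ultimately show ?thesis
    unfolding Let_def
    using join_Cl[OF u _ uv(5)] L2c_join[OF u uv(3,5,4)] by blast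
qed

lemma L2c_spectral_atom:
  assumes x: "x \<in> Clc M B"
  shows "\<exists>Q. measure_atom \<mu> Q \<and> L2c M B x = spectral_subspace M \<mu> \<Psi> Q \<and>
    (\<forall>Q'. measure_atom \<mu> Q' \<and> L2c M B x = spectral_subspace M \<mu> \<Psi> Q' \<longrightarrow> (AE s in \<mu>. s \<in> Q \<longleftrightarrow> s \<in> Q'))"
proof -
  obtain Q where Q: "measure_atom \<mu> Q" "L2c M B x = spectral_subspace M \<mu> \<Psi> Q" using L2c_atom[OF x] by blast
  obtain f where f: "f \<in> L2c M B x" "\<not> (AE \<omega> in M. f \<omega> = 0)" using ClcD[OF x] by blast
  have "AE s in \<mu>. s \<in> Q \<longleftrightarrow> s \<in> Q'" if Q': "measure_atom \<mu> Q'" "L2c M B x = spectral_subspace M \<mu> \<Psi> Q'" for Q'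
    by (rule atoms_AE_eq[OF Q(1) Q'(1) _ _ f(2)]) (use f(1) Q(2) Q'(2) in auto)
  then show ?thesis using Q by blast
qed

lemma atom_L2c_unique:
  assumes Q: "measure_atom \<mu> Q"
  shows "let x = \<Inter>{y \<in> Cl M B. sigma_gen M (spectral_subspace M \<mu> \<Psi> Q) \<subseteq> y} in
           x \<in> Clc M B \<and> spectral_subspace M \<mu> \<Psi> Q = L2c M B x \<and>
           (\<forall>y\<in>Cl M B. spectral_subspace M \<mu> \<Psi> Q = L2c M B y \<longrightarrow> y = x)"
proof -
  define x where "x = \<Inter>{y \<in> Cl M B. sigma_gen M (spectral_subspace M \<mu> \<Psi> Q) \<subseteq> y}"
  note x = atom_L2c[OF Q, folded x_def]
  obtain f where f: "x \<in> Cl M B" "f \<in> L2c M B x" "\<not> (AE \<omega> in M. f \<omega> = 0)" using ClcD[OF x(1)] by blast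
  have "y = x" if y: "y \<in> Cl M B" "spectral_subspace M \<mu> \<Psi> Q = L2c M B y" for y
  proof (rule ccontr)
    assume "y \<noteq> x"
    then have "l2_inner M f f = 0" using L2c_orth[OF y(1) f(1) _ _ f(2), of f] f(2) y(2) x(2) by auto
    then show False using l2_orth_self_zero[OF L2c_LL[OF f(1,2)]] f(3) by blast
  qed
  then show ?thesis using x unfolding Let_def x_def[symmetric] by blast
qed

end

theorem theorem5p8:
  fixes M :: "'a measure" and B :: "'a set set set"
    and \<mu> :: "'s measure" and H :: "'s \<Rightarrow> 'h::real_inner set" and \<SS> :: "('s \<Rightarrow> 'h) set"
    and \<Psi> :: "('a \<Rightarrow> real) \<Rightarrow> 's \<Rightarrow> 'h"
  assumes "prob_space M" and "essentially_separable M"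
    and "noise_boolean_algebra M B"
    and "spectral_resolution M B \<mu> H \<SS> \<Psi>"
  shows
    "\<comment> \<open>(i)\<close>
     (L2c M B (bot_field M) = {f \<in> L2 M (sets M). \<exists>c. AE \<omega> in M. f \<omega> = c} \<and>
      bot_field M \<in> Bc M B) \<and>
     \<comment> \<open>(ii)\<close>
     (\<forall>x\<in>Cl M B. \<forall>y\<in>Cl M B. \<forall>g\<in>L2c M B x.
        (AE \<omega> in M. cexp M y g \<omega> = cexp M (x \<inter> y) g \<omega>) \<and>
        (x \<subseteq> y \<longleftrightarrow> x \<subseteq> x \<inter> y) \<and>
        (x \<subseteq> y \<longrightarrow> (AE \<omega> in M. cexp M y g \<omega> = g \<omega>)) \<and>
        (\<not> x \<subseteq> y \<longrightarrow> (AE \<omega> in M. cexp M y g \<omega> = 0))) \<and>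
     \<comment> \<open>(iii)\<close>
     (\<forall>x\<in>Clc M B. \<exists>Q. measure_atom \<mu> Q \<and> L2c M B x = spectral_subspace M \<mu> \<Psi> Q \<and>
        (\<forall>Q'. measure_atom \<mu> Q' \<and> L2c M B x = spectral_subspace M \<mu> \<Psi> Q' \<longrightarrow>
           (AE s in \<mu>. s \<in> Q \<longleftrightarrow> s \<in> Q'))) \<and>
     \<comment> \<open>(iv)\<close>
     (\<forall>Q. measure_atom \<mu> Q \<longrightarrow>
        (let x = \<Inter>{y \<in> Cl M B. sigma_gen M (spectral_subspace M \<mu> \<Psi> Q) \<subseteq> y} in
           x \<in> Clc M B \<and> spectral_subspace M \<mu> \<Psi> Q = L2c M B x \<and>
           (\<forall>y\<in>Cl M B. spectral_subspace M \<mu> \<Psi> Q = L2c M B y \<longrightarrow> y = x))) \<and>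
     \<comment> \<open>(v)\<close>
     ((\<forall>x\<in>Cl M B. closed_span M (L2c M B x) = L2c M B x) \<and>
      (\<forall>x\<in>Cl M B. \<forall>y\<in>Cl M B. x \<noteq> y \<longrightarrow>
         (\<forall>f\<in>L2c M B x. \<forall>g\<in>L2c M B y. l2_inner M f g = 0))) \<and>
     \<comment> \<open>(vi)\<close>
     countable (Clc M B) \<and>
     \<comment> \<open>(vii)\<close>
     (\<forall>x y. (x \<in> Bc M B \<and> y \<in> Bc M B \<and> prob_space.indep_set M x y) \<or>
            (x \<in> Clc M B \<and> y \<in> Clc M B \<and>
             (\<exists>u\<in>noise_completion M B. \<exists>v\<in>noise_completion M B.
                x \<subseteq> u \<and> y \<subseteq> v \<and> prob_space.indep_set M u v)) \<longrightarrow>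
        (let G = {\<lambda>\<omega>. f \<omega> * g \<omega> | f g. f \<in> L2c M B x \<and> g \<in> L2c M B y} in
           field_join M x y \<in> Cl M B \<and> G \<subseteq> L2 M (sets M) \<and>
           L2c M B (field_join M x y) = closed_span M G)) \<and>
     \<comment> \<open>(viii)\<close>
     (ideal_of M B (Bc M B) \<and> (\<forall>x\<in>Bc M B. countable {y \<in> B. y \<subseteq> x})) \<and>
     \<comment> \<open>(ix)\<close>
     ((\<forall>x\<in>Cl M B.
         closed_span M (\<Union>y\<in>Clc M B. L2c M B y) \<inter> L2 M x =
         closed_span M (\<Union>y\<in>{y \<in> Clc M B. y \<subseteq> x}. L2c M B y)) \<and>
      (\<forall>a\<in>subfields M.
         closed_span M (\<Union>y\<in>{y \<in> Clc M B. y \<subseteq> a}. L2c M B y) = L2 M a \<longrightarrow>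
         (\<forall>x\<in>Cl M B. x \<subseteq> a \<longrightarrow>
            closed_span M (\<Union>y\<in>{y \<in> Clc M B. y \<subseteq> x}. L2c M B y) = L2 M x)))"
proof -
  interpret prob_space M by fact
  interpret spectral_noise_algebra M B \<mu> H \<SS> \<Psi> by unfold_locales fact+
  show ?thesis
  proof (intro conjI, goal_cases)
    case 1 show ?case by (rule L2c_bot)
  next
    case 2 show ?case by (rule bot_Bc)
  next
    case 3 show ?case using L2c_cexp by blast
  next
    case 4 show ?case using L2c_spectral_atom by blast
  next
    case 5 show ?case using atom_L2c_unique by blast
  next
    case 6 show ?case using closed_span_closed_subspace_eq[OF closed_subspace_L2c] by blast
  next
    case 7 show ?case using L2c_orth by blast
  next
    case 8 show ?case by (rule countable_Clc)
  next
    case 9 show ?case using L2c_join_indep by blast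
  next
    case 10 show ?case by (rule Bc_ideal)
  next
    case 11 show ?case using countable_below_Bc by blast
  next
    case 12 show ?case using sum_inter_L2 by blast
  next
    case 13 show ?case using sum_below_full by blast
  qed
qed

end
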